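(* Let $\Omega\subset\mathbb{R}^2$ be a bounded polygonal domain, $f\in L^2(\Omega)$, $\chi\in H^2(\Omega)$ with $\max_{x\in\partial\Omega}\chi(x)<0$, and $K:=\{\varphi\in H^2_0(\Omega):\varphi\ge\chi\text{ a.e. in }\Omega\}$. There exists a positive constant $C(\chi)$ depending only on $\chi$ such that any solution $(u,v)\in K\times H^2_0(\Omega)$ of $$a(u,u-\varphi_1)+2b(u,v,u-\varphi_1)\le (f,u-\varphi_1)_{L^2(\Omega)}\ \ \forall\varphi_1\in K,\qquad a(v,\varphi_2)-b(u,u,\varphi_2)=0\ \ \forall \varphi_2\in H^2_0(\Omega)$$ satisfies: (a) $\tfrac12|\!|\!|u|\!|\!|^2+|\!|\!|v|\!|\!|^2\le N^2(f,u):=2j(u)+2C_{\rm F}^2\|f\|_{L^2(\Omega)}^2\le M^2(f,\chi):=C(\chi)+3C_{\rm F}^2\|f\|^2_{L^2(\Omega)}$; (b) if $C_{\rm S}^2\big(\tfrac12|\!|\!|u|\!|\!|^2+|\!|\!|v|\!|\!|^2\big)<(\sqrt2-1)^2$, then $(u,v)$ is the only solution of this problem.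
   Context: $|\!|\!|\varphi|\!|\!|:=\|D^2\varphi\|_{L^2(\Omega)}$. $a(\varphi_1,\varphi_2):=(D^2\varphi_1,D^2\varphi_2)_{L^2(\Omega)}$, $b(\varphi_1,\varphi_2,\varphi_3):=-\tfrac12([\varphi_1,\varphi_2],\varphi_3)_{L^2(\Omega)}$ with the von Kármán bracket $[\varphi_1,\varphi_2]:=\varphi_{1,xx}\varphi_{2,yy}+\varphi_{1,yy}\varphi_{2,xx}-2\varphi_{1,xy}\varphi_{2,xy}$. $G:H^2_0(\Omega)\to H^2_0(\Omega)$ is defined by $a(G(\varphi),\psi)=b(\varphi,\varphi,\psi)$ for all $\psi\in H^2_0(\Omega)$, and $j(\xi):=\tfrac12|\!|\!|\xi|\!|\!|^2+\tfrac12|\!|\!|G(\xi)|\!|\!|^2-(f,\xi)_{L^2(\Omega)}$. $C_{\rm S}$ and $C_{\rm F}$ are the Sobolev and Friedrichs constants: $\|w\|_{L^\infty(\Omega)}\le C_{\rm S}|\!|\!|w|\!|\!|$ and $\|w\|_{L^2(\Omega)}\le C_{\rm F}|\!|\!|w|\!|\!|$ for all $w\in H^2_0(\Omega)$. *)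

theory Defs
  imports "HOL-Analysis.Analysis"
begin

type_synonym pt = "real \<times> real"

text \<open>A bounded polygonal domain: a nonempty bounded open connected subset of the
plane whose boundary is a finite union of closed line segments, and which has
no slits (it is the interior of its closure).\<close>
definition polygonal_domain :: "pt set \<Rightarrow> bool" where
  "polygonal_domain \<Omega> \<longleftrightarrow> open \<Omega> \<and> connected \<Omega> \<and> bounded \<Omega> \<and> \<Omega> \<noteq> {} \<and>
     interior (closure \<Omega>) = \<Omega> \<and>
     (\<exists>S :: (pt \<times> pt) set. finite S \<and>
        frontier \<Omega> = (\<Union>(a,b)\<in>S. closed_segment a b))"

definition px :: "(pt \<Rightarrow> real) \<Rightarrow> pt \<Rightarrow> real" where
  "px f = (\<lambda>(x,y). deriv (\<lambda>t. f (t,y)) x)"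

definition py :: "(pt \<Rightarrow> real) \<Rightarrow> pt \<Rightarrow> real" where
  "py f = (\<lambda>(x,y). deriv (\<lambda>t. f (x,t)) y)"

fun pds :: "bool list \<Rightarrow> (pt \<Rightarrow> real) \<Rightarrow> pt \<Rightarrow> real" where
  "pds [] f = f"
| "pds (b # bs) f = (if b then px else py) (pds bs f)"

definition smooth2 :: "(pt \<Rightarrow> real) \<Rightarrow> bool" where
  "smooth2 f \<longleftrightarrow> (\<forall>bs. continuous_on UNIV (pds bs f) \<and>
      (\<forall>x y. (\<lambda>t. pds bs f (t,y)) differentiable (at x) \<and>
             (\<lambda>t. pds bs f (x,t)) differentiable (at y)))"

definition test_fun :: "pt set \<Rightarrow> (pt \<Rightarrow> real) \<Rightarrow> bool" where
  "test_fun \<Omega> \<phi> \<longleftrightarrow> smooth2 \<phi> \<and> compact (closure {z. \<phi> z \<noteq> 0}) \<and>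
      closure {z. \<phi> z \<noteq> 0} \<subseteq> \<Omega>"

definition L2 :: "pt set \<Rightarrow> (pt \<Rightarrow> real) \<Rightarrow> bool" where
  "L2 \<Omega> w \<longleftrightarrow> set_borel_measurable lebesgue \<Omega> w \<and>
      set_integrable lebesgue \<Omega> (\<lambda>z. (w z)\<^sup>2)"

definition l2ip :: "pt set \<Rightarrow> (pt \<Rightarrow> real) \<Rightarrow> (pt \<Rightarrow> real) \<Rightarrow> real" where
  "l2ip \<Omega> f g = (LINT z:\<Omega>|lebesgue. f z * g z)"

definition l2norm :: "pt set \<Rightarrow> (pt \<Rightarrow> real) \<Rightarrow> real" where
  "l2norm \<Omega> f = sqrt (LINT z:\<Omega>|lebesgue. (f z)\<^sup>2)"

definition is_weak_deriv :: "pt set \<Rightarrow> bool list \<Rightarrow> (pt \<Rightarrow> real) \<Rightarrow> (pt \<Rightarrow> real) \<Rightarrow> bool" where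
  "is_weak_deriv \<Omega> bs w g \<longleftrightarrow>
     (\<forall>\<phi>. test_fun \<Omega> \<phi> \<longrightarrow>
        (LINT z:\<Omega>|lebesgue. w z * pds bs \<phi> z) =
          (-1) ^ length bs * (LINT z:\<Omega>|lebesgue. g z * \<phi> z))"

definition H2 :: "pt set \<Rightarrow> (pt \<Rightarrow> real) \<Rightarrow> bool" where
  "H2 \<Omega> w \<longleftrightarrow> L2 \<Omega> w \<and>
     (\<forall>bs. length bs \<le> 2 \<longrightarrow> (\<exists>g. L2 \<Omega> g \<and> is_weak_deriv \<Omega> bs w g))"

definition wd :: "pt set \<Rightarrow> bool list \<Rightarrow> (pt \<Rightarrow> real) \<Rightarrow> pt \<Rightarrow> real" where
  "wd \<Omega> bs w = (SOME g. L2 \<Omega> g \<and> is_weak_deriv \<Omega> bs w g)"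

definition h2norm2 :: "pt set \<Rightarrow> (pt \<Rightarrow> real) \<Rightarrow> real" where
  "h2norm2 \<Omega> w = (\<Sum>bs\<in>{bs::bool list. length bs \<le> 2}.
      (LINT z:\<Omega>|lebesgue. (wd \<Omega> bs w z)\<^sup>2))"

definition H20 :: "pt set \<Rightarrow> (pt \<Rightarrow> real) \<Rightarrow> bool" where
  "H20 \<Omega> w \<longleftrightarrow> H2 \<Omega> w \<and>
     (\<exists>\<phi>::nat \<Rightarrow> pt \<Rightarrow> real. (\<forall>n. test_fun \<Omega> (\<phi> n)) \<and>
        (\<lambda>n. h2norm2 \<Omega> (\<lambda>z. \<phi> n z - w z)) \<longlonglongrightarrow> 0)"

abbreviation "dxx \<Omega> w \<equiv> wd \<Omega> [True,True] w"
abbreviation "dxy \<Omega> w \<equiv> wd \<Omega> [True,False] w"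
abbreviation "dyx \<Omega> w \<equiv> wd \<Omega> [False,True] w"
abbreviation "dyy \<Omega> w \<equiv> wd \<Omega> [False,False] w"

definition aform :: "pt set \<Rightarrow> (pt \<Rightarrow> real) \<Rightarrow> (pt \<Rightarrow> real) \<Rightarrow> real" where
  "aform \<Omega> w1 w2 = (LINT z:\<Omega>|lebesgue.
      dxx \<Omega> w1 z * dxx \<Omega> w2 z + dxy \<Omega> w1 z * dxy \<Omega> w2 z +
      dyx \<Omega> w1 z * dyx \<Omega> w2 z + dyy \<Omega> w1 z * dyy \<Omega> w2 z)"

definition tnorm :: "pt set \<Rightarrow> (pt \<Rightarrow> real) \<Rightarrow> real" where
  "tnorm \<Omega> w = sqrt (aform \<Omega> w w)"

definition vk_bracket :: "pt set \<Rightarrow> (pt \<Rightarrow> real) \<Rightarrow> (pt \<Rightarrow> real) \<Rightarrow> pt \<Rightarrow> real" where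
  "vk_bracket \<Omega> w1 w2 z = dxx \<Omega> w1 z * dyy \<Omega> w2 z + dyy \<Omega> w1 z * dxx \<Omega> w2 z
      - 2 * dxy \<Omega> w1 z * dxy \<Omega> w2 z"

definition bform :: "pt set \<Rightarrow> (pt \<Rightarrow> real) \<Rightarrow> (pt \<Rightarrow> real) \<Rightarrow> (pt \<Rightarrow> real) \<Rightarrow> real" where
  "bform \<Omega> w1 w2 w3 = - (1/2) * l2ip \<Omega> (vk_bracket \<Omega> w1 w2) w3"

definition Gop :: "pt set \<Rightarrow> (pt \<Rightarrow> real) \<Rightarrow> pt \<Rightarrow> real" where
  "Gop \<Omega> \<xi> = (SOME g. H20 \<Omega> g \<and> (\<forall>\<psi>. H20 \<Omega> \<psi> \<longrightarrow> aform \<Omega> g \<psi> = bform \<Omega> \<xi> \<xi> \<psi>))"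

definition jfun :: "pt set \<Rightarrow> (pt \<Rightarrow> real) \<Rightarrow> (pt \<Rightarrow> real) \<Rightarrow> real" where
  "jfun \<Omega> f \<xi> = (1/2) * (tnorm \<Omega> \<xi>)\<^sup>2 + (1/2) * (tnorm \<Omega> (Gop \<Omega> \<xi>))\<^sup>2 - l2ip \<Omega> f \<xi>"

definition Kset :: "pt set \<Rightarrow> (pt \<Rightarrow> real) \<Rightarrow> (pt \<Rightarrow> real) set" where
  "Kset \<Omega> obs = {\<phi>. H20 \<Omega> \<phi> \<and> (AE z in lebesgue. z \<in> \<Omega> \<longrightarrow> \<phi> z \<ge> obs z)}"

definition vk_solution :: "pt set \<Rightarrow> (pt \<Rightarrow> real) \<Rightarrow> (pt \<Rightarrow> real) \<Rightarrow> (pt \<Rightarrow> real) \<Rightarrow> (pt \<Rightarrow> real) \<Rightarrow> bool" where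
  "vk_solution \<Omega> obs f u v \<longleftrightarrow> u \<in> Kset \<Omega> obs \<and> H20 \<Omega> v \<and>
     (\<forall>\<phi>1\<in>Kset \<Omega> obs.
        aform \<Omega> u (\<lambda>z. u z - \<phi>1 z) + 2 * bform \<Omega> u v (\<lambda>z. u z - \<phi>1 z)
          \<le> l2ip \<Omega> f (\<lambda>z. u z - \<phi>1 z)) \<and>
     (\<forall>\<phi>2. H20 \<Omega> \<phi>2 \<longrightarrow> aform \<Omega> v \<phi>2 - bform \<Omega> u u \<phi>2 = 0)"

definition sobolev_const :: "pt set \<Rightarrow> real \<Rightarrow> bool" where
  "sobolev_const \<Omega> C \<longleftrightarrow> (\<forall>w. H20 \<Omega> w \<longrightarrow>
      (AE z in lebesgue. z \<in> \<Omega> \<longrightarrow> \<bar>w z\<bar> \<le> C * tnorm \<Omega> w))"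

definition friedrichs_const :: "pt set \<Rightarrow> real \<Rightarrow> bool" where
  "friedrichs_const \<Omega> C \<longleftrightarrow> (\<forall>w. H20 \<Omega> w \<longrightarrow> l2norm \<Omega> w \<le> C * tnorm \<Omega> w)"

end

theory Submission
  imports Defs
begin

text \<open>
  The form \<open>b\<close> is symmetric on \<open>H\<^sup>2\<^sub>0\<close> by integration by parts and density of test functions. Testing
  the variational inequality with a fixed \<open>\<phi> \<in> K\<close> and inserting \<open>b(u,v,u) = a(v,v)\<close> reduces the bound on
  \<open>N\<^sup>2(f,u)\<close> to an estimate that no longer contains \<open>f\<close>: \<open>2 a(u,\<phi>) + 4 b(u,v,\<phi>) \<le> |u|\<^sup>2 + 3 |v|\<^sup>2 + C(\<phi>)\<close>
  whenever \<open>v = G(u)\<close>. Solutions need not be minimisers of \<open>j\<close>, so this estimate is the heart of the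
  matter. Its qualitative reason is that \<open>[u,u] = 0\<close> with zero boundary data forces \<open>u = 0\<close>. The quantitative
  form is \<open>\<parallel>Du\<parallel>\<^sup>2 \<le> 2 b(u,u,\<psi>) + \<delta> |u|\<^sup>2\<close>, where \<open>\<psi>\<close> equals \<open>|z|\<^sup>2 / 2\<close> away from the boundary and is cut off
  logarithmically there; the error is absorbed by a Hardy inequality at the boundary segments. For
  uniqueness, the difference of two solutions is a zero of a quadratic form that is positive definite
  when \<open>(u,v)\<close> is small.
\<close>

section \<open>Functions with derivatives of all orders\<close>

text \<open>The obstacle is one of homogeneity. The term \<open>b(u,v,\<phi>)\<close> grows like |u|
  |v|, as fast as the quadratic terms that have to absorb it, and \<open>\<phi>\<close> may be
  large, so Young's inequality alone gives nothing. The gain is that for smooth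
  \<open>\<phi>\<close> an integration by parts leaves only first derivatives of u and v under the
  integral, while \<open>b(u,u,\<psi>) = a(v,\<psi>)\<close> is merely linear in v: a gradient
  estimate by \<open>b(u,u,\<psi>)\<close> lowers the growth below quadratic, up to a small
  remainder. The shape of \<open>\<psi>\<close> is forced. A function whose Hessian is the identity
  turns \<open>2 b(u,u,\<psi>)\<close> into the Dirichlet integral, but \<open>\<psi>\<close> must
  vanish near the boundary. An ordinary cut-off at distance r has second derivatives of order
  r^(-2), the order of the Hardy weight itself, and hence an error that is not small. A cut-off that
  depends on \<open>\<epsilon>\<close> times a logarithm of the distance gains the factor
  \<open>\<epsilon>\<close>.\<close>

primrec Ck :: "'a::real_normed_vector set \<Rightarrow> nat \<Rightarrow> ('a \<Rightarrow> real) \<Rightarrow> bool" where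
  "Ck U 0 = (\<lambda>f. continuous_on U f)"
| "Ck U (Suc n) = (\<lambda>f. \<exists>f'. (\<forall>x\<in>U. (f has_derivative f' x) (at x)) \<and> (\<forall>v. Ck U n (\<lambda>x. f' x v)))"

text \<open>Total rather than partial derivatives are iterated, each evaluated at a fixed direction
  so that only real functions occur. The notion is thus closed under products and under composition
  with real functions, which is how every cut-off below arises.\<close>

definition smooth :: "'a::real_normed_vector set \<Rightarrow> ('a \<Rightarrow> real) \<Rightarrow> bool" where
  "smooth U f \<longleftrightarrow> (\<forall>n. Ck U n f)"

lemma CkI:
  assumes "\<And>x. x \<in> U \<Longrightarrow> (f has_derivative f' x) (at x)" "\<And>v. Ck U n (\<lambda>x. f' x v)"
  shows "Ck U (Suc n) f"
  using assms by auto

lemma CkE: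
  assumes "Ck U (Suc n) f"
  obtains f' where "\<And>x. x \<in> U \<Longrightarrow> (f has_derivative f' x) (at x)" "\<And>v. Ck U n (\<lambda>x. f' x v)"
  using assms by auto

lemma Ck_cong:
  assumes "open U" "Ck U n f" "\<And>x. x \<in> U \<Longrightarrow> f x = g x"
  shows "Ck U n g"
proof (cases n)
  case 0
  then show ?thesis using assms by (auto cong: continuous_on_cong)
next
  case (Suc m)
  then obtain f' where f': "\<And>x. x \<in> U \<Longrightarrow> (f has_derivative f' x) (at x)" "\<And>v. Ck U m (\<lambda>x. f' x v)"
    using assms(2) by auto
  have "(g has_derivative f' x) (at x)" if "x \<in> U" for x
    by (rule has_derivative_transform_within_open[OF f'(1)[OF that] assms(1) that assms(3)])
  then show ?thesis using f' Suc by auto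
qed

lemma Ck_imp_continuous: "Ck U n f \<Longrightarrow> continuous_on U f"
  by (cases n) (auto intro!: continuous_at_imp_continuous_on intro: has_derivative_continuous)

lemma Ck_SucD: "Ck U (Suc n) f \<Longrightarrow> Ck U n f"
proof (induction n arbitrary: f)
  case 0
  then show ?case using Ck_imp_continuous[of U 1 f] by simp
next
  case (Suc n)
  obtain f' where f': "\<And>x. x \<in> U \<Longrightarrow> (f has_derivative f' x) (at x)" "\<And>v. Ck U (Suc n) (\<lambda>x. f' x v)"
    using CkE[OF Suc.prems] by blast
  show ?case by (rule CkI[OF f'(1)]) (auto intro: Suc.IH f'(2) simp del: Ck.simps)
qed

lemma Ck_const: "Ck U n (\<lambda>x. c)"
  by (induction n arbitrary: c) (auto intro!: exI[of _ "\<lambda>_ _. 0"])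

lemma Ck_bounded_linear: "bounded_linear f \<Longrightarrow> Ck U n f"
proof (cases n)
  case (Suc m)
  assume "bounded_linear f"
  then show ?thesis unfolding Suc
    by (intro CkI[where f' = "\<lambda>_. f"] bounded_linear_imp_has_derivative Ck_const)
qed (auto intro: linear_continuous_on)

lemma Ck_add: "Ck U n f \<Longrightarrow> Ck U n g \<Longrightarrow> Ck U n (\<lambda>x. f x + g x)"
proof (induction n arbitrary: f g)
  case 0
  then show ?case by (auto intro: continuous_intros)
next
  case (Suc n)
  obtain f' where "\<And>x. x \<in> U \<Longrightarrow> (f has_derivative f' x) (at x)" "\<And>v. Ck U n (\<lambda>x. f' x v)"
    using CkE[OF Suc.prems(1)] by blast
  moreover obtain g' where "\<And>x. x \<in> U \<Longrightarrow> (g has_derivative g' x) (at x)" "\<And>v. Ck U n (\<lambda>x. g' x v)"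
    using CkE[OF Suc.prems(2)] by blast
  ultimately show ?case by (intro CkI[where f' = "\<lambda>x v. f' x v + g' x v"] has_derivative_add Suc.IH)
qed

lemma Ck_mult: "Ck U n f \<Longrightarrow> Ck U n g \<Longrightarrow> Ck U n (\<lambda>x. f x * g x)"
proof (induction n arbitrary: f g)
  case 0
  then show ?case by (auto intro: continuous_intros)
next
  case (Suc n)
  have fg: "Ck U n f" "Ck U n g" using Suc.prems Ck_SucD by blast+
  obtain f' where "\<And>x. x \<in> U \<Longrightarrow> (f has_derivative f' x) (at x)" "\<And>v. Ck U n (\<lambda>x. f' x v)"
    using CkE[OF Suc.prems(1)] by blast
  moreover obtain g' where "\<And>x. x \<in> U \<Longrightarrow> (g has_derivative g' x) (at x)" "\<And>v. Ck U n (\<lambda>x. g' x v)"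
    using CkE[OF Suc.prems(2)] by blast
  ultimately show ?case
    by (intro CkI[where f' = "\<lambda>x v. f x * g' x v + f' x v * g x"] has_derivative_mult Ck_add Suc.IH fg)
qed

lemma Ck_compose:
  fixes h :: "real \<Rightarrow> real"
  shows "Ck I n h \<Longrightarrow> Ck U n f \<Longrightarrow> f ` U \<subseteq> I \<Longrightarrow> Ck U n (\<lambda>x. h (f x))"
proof (induction n arbitrary: h)
  case 0
  then show ?case by (auto intro: continuous_on_compose2)
next
  case (Suc n)
  obtain f' where f': "\<And>x. x \<in> U \<Longrightarrow> (f has_derivative f' x) (at x)" "\<And>v. Ck U n (\<lambda>x. f' x v)"
    using CkE[OF Suc.prems(2)] by blast
  obtain h' where h': "\<And>x. x \<in> I \<Longrightarrow> (h has_derivative h' x) (at x)" "\<And>v. Ck I n (\<lambda>x. h' x v)"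
    using CkE[OF Suc.prems(1)] by blast
  have hc: "((\<lambda>x. h (f x)) has_derivative (\<lambda>v. h' (f x) 1 * f' x v)) (at x)" if "x \<in> U" for x
  proof -
    have fx: "f x \<in> I" using that Suc.prems by auto
    have "bounded_linear (h' (f x))" using h'(1)[OF fx] has_derivative_bounded_linear by blast
    then have lin: "h' (f x) t = h' (f x) 1 * t" for t
      by (metis bounded_linear.linear linear_cmul mult.commute mult_1_right real_scaleR_def)
    have "(\<lambda>v. h' (f x) (f' x v)) = (\<lambda>v. h' (f x) 1 * f' x v)" by (rule ext) (rule lin)
    then show ?thesis using has_derivative_compose[OF f'(1)[OF that] h'(1)[OF fx]] by simp
  qed
  have "Ck U n (\<lambda>x. h' (f x) 1)" by (rule Suc.IH[OF h'(2) Ck_SucD[OF Suc.prems(2)] Suc.prems(3)])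
  from Ck_mult[OF this f'(2)] have "Ck U n (\<lambda>x. h' (f x) 1 * f' x v)" for v .
  with hc show ?case by (rule CkI[where f' = "\<lambda>x v. h' (f x) 1 * f' x v"])
qed

text \<open>On the overlap the two derivatives agree by uniqueness, so local regularity glues. This
  is how a cut-off is extended by zero across the boundary.\<close>

lemma Ck_Un:
  assumes "open U" "open V"
  shows "Ck U n f \<Longrightarrow> Ck V n f \<Longrightarrow> Ck (U \<union> V) n f"
proof (induction n arbitrary: f)
  case 0
  then show ?case using assms by (auto intro: continuous_on_open_Un)
next
  case (Suc n)
  obtain f' where f': "\<And>x. x \<in> U \<Longrightarrow> (f has_derivative f' x) (at x)" "\<And>v. Ck U n (\<lambda>x. f' x v)"
    using CkE[OF Suc.prems(1)] by blast
  obtain g' where g': "\<And>x. x \<in> V \<Longrightarrow> (f has_derivative g' x) (at x)" "\<And>v. Ck V n (\<lambda>x. g' x v)"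
    using CkE[OF Suc.prems(2)] by blast
  define k where "k = (\<lambda>x. if x \<in> U then f' x else g' x)"
  have kV: "k x = g' x" if "x \<in> V" for x
    using has_derivative_unique[OF f'(1) g'(1)[OF that]] by (auto simp: k_def)
  have "(f has_derivative k x) (at x)" if "x \<in> U \<union> V" for x
    using that f'(1) g'(1) by (auto simp: k_def)
  moreover have "Ck U n (\<lambda>x. k x v)" for v
    by (rule Ck_cong[OF assms(1) f'(2)]) (auto simp: k_def)
  moreover have "Ck V n (\<lambda>x. k x v)" for v
    by (rule Ck_cong[OF assms(2) g'(2)]) (auto simp: kV)
  ultimately show ?case by (intro CkI[where f' = k]) (auto intro: Suc.IH)
qed

lemma smooth_const [simp]: "smooth U (\<lambda>x. c)"
  and smooth_bounded_linear: "bounded_linear f \<Longrightarrow> smooth U f"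
  and smooth_add: "smooth U f \<Longrightarrow> smooth U g \<Longrightarrow> smooth U (\<lambda>x. f x + g x)"
  and smooth_mult: "smooth U f \<Longrightarrow> smooth U g \<Longrightarrow> smooth U (\<lambda>x. f x * g x)"
  and smooth_compose: "smooth I h \<Longrightarrow> smooth U f \<Longrightarrow> f ` U \<subseteq> I \<Longrightarrow> smooth U (\<lambda>x. h (f x))"
  and smooth_Un: "open U \<Longrightarrow> open V \<Longrightarrow> smooth U f \<Longrightarrow> smooth V f \<Longrightarrow> smooth (U \<union> V) f"
  and smooth_cong: "open U \<Longrightarrow> smooth U f \<Longrightarrow> (\<And>x. x \<in> U \<Longrightarrow> f x = k x) \<Longrightarrow> smooth U k"
  by (auto simp: smooth_def intro: Ck_const Ck_bounded_linear Ck_add Ck_mult Ck_compose Ck_Un Ck_cong)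

lemma smooth_diff: "smooth U f \<Longrightarrow> smooth U g \<Longrightarrow> smooth U (\<lambda>x. f x - g x)"
  using smooth_add[of U f "\<lambda>x. (-1) * g x"] smooth_mult[of U "\<lambda>x. -1" g] by auto

lemma smooth_imp_continuous_on: "smooth U f \<Longrightarrow> continuous_on U f"
  using Ck_imp_continuous smooth_def by blast

text \<open>For each order n the definition supplies a derivative of its own; uniqueness identifies
  them on U, so a single one is smooth to all orders.\<close>

lemma smooth_has_derivative:
  assumes "smooth U f" "open U"
  obtains f' where "\<And>x. x \<in> U \<Longrightarrow> (f has_derivative f' x) (at x)" "\<And>v. smooth U (\<lambda>x. f' x v)"
proof -
  have "\<exists>f'. (\<forall>x\<in>U. (f has_derivative f' x) (at x)) \<and> (\<forall>v. Ck U n (\<lambda>x. f' x v))" for n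
    using assms(1)[unfolded smooth_def, rule_format, of "Suc n"] by simp
  then obtain F where F: "\<And>n x. x \<in> U \<Longrightarrow> (f has_derivative F n x) (at x)" "\<And>n v. Ck U n (\<lambda>x. F n x v)"
    by metis
  have eq: "F n x v = F 0 x v" if "x \<in> U" for n x v
    using has_derivative_unique[OF F(1)[OF that, of n] F(1)[OF that, of 0]] by simp
  have "Ck U n (\<lambda>x. F 0 x v)" for n v
    by (rule Ck_cong[OF assms(2) F(2)[of n v] eq])
  then show ?thesis using F(1) that[of "F 0"] by (auto simp: smooth_def)
qed

text \<open>The factor c and the free exponent p make the family closed under differentiation; the
  inverse and the square root are members.\<close>

lemma Ck_powr: "Ck {0<..} n (\<lambda>x. c * x powr p)"
proof (induction n arbitrary: c p)
  case (Suc n)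
  have "((\<lambda>x. c * x powr p) has_derivative (\<lambda>v. (c * p) * x powr (p - 1) * v)) (at x)" if "x \<in> {0<..}" for x
  proof -
    have "((\<lambda>x. c * x powr p) has_field_derivative c * p * x powr (p - 1)) (at x)"
      using that by (auto intro!: derivative_eq_intros)
    then show ?thesis by (simp add: has_field_derivative_def)
  qed
  moreover have "Ck {0<..} n (\<lambda>x. (c * p) * x powr (p - 1) * v)" for v :: real
    by (intro Ck_mult Suc Ck_const)
  ultimately show ?case by (rule CkI)
qed (auto intro!: continuous_intros)

lemma smooth_inverse: "smooth {0<..} (\<lambda>x::real. inverse x)"
  unfolding smooth_def using Ck_powr[of _ 1 "-1"]
  by (auto intro!: Ck_cong[of "{0<..}" _ "\<lambda>x. 1 * x powr - 1" inverse] simp: powr_minus)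

lemma smooth_sqrt: "smooth {0<..} sqrt"
  unfolding smooth_def using Ck_powr[of _ 1 "1/2"]
  by (auto intro!: Ck_cong[of "{0<..}" _ "\<lambda>x. 1 * x powr (1/2)" sqrt] simp: powr_half_sqrt)

lemma smooth_ln: "smooth {0<..} (ln :: real \<Rightarrow> real)"
  unfolding smooth_def
proof
  fix n
  show "Ck {0<..} n (ln :: real \<Rightarrow> real)"
  proof (cases n)
    case (Suc m)
    have "(ln has_derivative (\<lambda>v. inverse x * v)) (at x)" if "x \<in> {0<..}" for x :: real
      using that DERIV_ln[of x] by (auto simp: has_field_derivative_def)
    moreover have "Ck {0<..} m (\<lambda>x. inverse x * v)" for v :: real
      using smooth_inverse by (intro Ck_mult Ck_const) (auto simp: smooth_def)
    ultimately show ?thesis unfolding Suc by (rule CkI)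
  qed (auto intro!: continuous_intros)
qed

section \<open>A smooth step function on the line\<close>

definition flat_powr :: "real \<Rightarrow> real \<Rightarrow> real" where
  "flat_powr p t = (if t \<le> 0 then 0 else t powr p * exp (- 1 / t))"

text \<open>With x = 1/t this is the decay of x^(-p) e^(-x). Negative p matter, because
  differentiation lowers the exponent without bound.\<close>

lemma flat_powr_tendsto: "(flat_powr p \<longlongrightarrow> 0) (at 0)"
proof -
  obtain n :: nat where n: "- p \<le> real n" using real_arch_simple by blast
  have "((\<lambda>x. x powr (- p) / exp x) \<longlongrightarrow> 0) at_top"
  proof (rule tendsto_sandwich[OF _ _ tendsto_const tendsto_power_div_exp_0[of n]])
    show "\<forall>\<^sub>F x in at_top. x powr (- p) / exp x \<le> x ^ n / exp x"
      using eventually_ge_at_top[of 1]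
    proof eventually_elim
      case (elim x)
      then have "x powr (- p) \<le> x powr real n" using n by (intro powr_mono) auto
      then show ?case using elim by (simp add: powr_realpow divide_right_mono)
    qed
  qed simp
  from filterlim_compose[OF this filterlim_inverse_at_top_right]
  have "((\<lambda>t. inverse t powr (- p) / exp (inverse t)) \<longlongrightarrow> 0) (at_right 0)" .
  then have "((\<lambda>t. t powr p * exp (- 1 / t)) \<longlongrightarrow> 0) (at_right 0)"
    by (rule Lim_transform_eventually)
      (auto simp: eventually_at_filter powr_minus exp_minus powr_divide inverse_eq_divide)
  then have "(flat_powr p \<longlongrightarrow> 0) (at_right 0)"
    by (rule Lim_transform_eventually) (auto simp: flat_powr_def eventually_at_filter)
  moreover have "(flat_powr p \<longlongrightarrow> 0) (at_left 0)"
    by (rule Lim_transform_eventually[OF tendsto_const]) (auto simp: flat_powr_def eventually_at_filter)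
  ultimately show ?thesis by (simp add: filterlim_at_split)
qed

text \<open>The functions t^p e^(-1/t), extended by zero, form a family closed under differentiation
  when p ranges over all reals. Smoothness of every member, also at 0, then follows by a single
  induction.\<close>

lemma flat_powr_deriv: "(flat_powr p has_field_derivative p * flat_powr (p - 1) t + flat_powr (p - 2) t) (at t)"
proof -
  consider "t < 0" | "t = 0" | "t > 0" by linarith
  then show ?thesis
  proof cases
    case 1
    have "((\<lambda>_. 0) has_field_derivative 0) (at t)" by simp
    then have "(flat_powr p has_field_derivative 0) (at t)"
      by (rule has_field_derivative_transform_within_open[of _ _ _ "{..<0}"]) (use 1 in \<open>auto simp: flat_powr_def\<close>)
    then show ?thesis using 1 by (simp add: flat_powr_def)
  next
    case 2
    \<comment> \<open>The difference quotient of \<open>flat_powr p\<close> at 0 is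
      \<open>flat_powr (p - 1)\<close>.\<close>
    have "((\<lambda>h. (flat_powr p h - flat_powr p 0) / (h - 0)) \<longlongrightarrow> 0) (at 0)"
      by (rule Lim_transform_eventually[OF flat_powr_tendsto[of "p - 1"]])
        (auto simp: flat_powr_def eventually_at_filter powr_diff)
    then show ?thesis using 2 by (simp add: has_field_derivative_iff flat_powr_def)
  next
    case 3
    have d1: "((\<lambda>t. t powr p) has_field_derivative p * t powr (p - 1)) (at t)"
      using 3 by (rule has_real_derivative_powr)
    have d2: "((\<lambda>t. exp (- 1 / t)) has_field_derivative exp (- 1 / t) * (1 / t\<^sup>2)) (at t)"
      using 3 by (auto intro!: derivative_eq_intros simp: power2_eq_square)
    have "t powr (p - 2) = t powr p * (1 / t\<^sup>2)"
      using 3 by (simp add: powr_diff)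
    then have "((\<lambda>t. t powr p * exp (- 1 / t)) has_field_derivative p * flat_powr (p - 1) t + flat_powr (p - 2) t) (at t)"
      using DERIV_mult[OF d1 d2] 3 by (simp add: flat_powr_def algebra_simps)
    then show ?thesis
      by (rule has_field_derivative_transform_within_open[of _ _ _ "{0<..}"]) (use 3 in \<open>auto simp: flat_powr_def\<close>)
  qed
qed

lemma Ck_flat_powr: "Ck UNIV n (flat_powr p)"
proof (induction n arbitrary: p)
  case 0
  then show ?case by (auto intro!: continuous_at_imp_continuous_on DERIV_isCont flat_powr_deriv)
next
  case (Suc n)
  have "(flat_powr p has_derivative (\<lambda>v. (p * flat_powr (p - 1) t + flat_powr (p - 2) t) * v)) (at t)" for t
    using flat_powr_deriv[of p t] by (simp add: has_field_derivative_def)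
  then show ?case
    by (rule CkI) (intro Ck_mult Ck_add Ck_const Suc)
qed

text \<open>The step is e(t) / (e(t) + e(1 - t)) with e = \<open>flat_powr 0\<close>; its
  denominator never vanishes. The derivatives are continuous and vanish off [0,1], hence one bound
  \<open>C\<close> serves both, and it is this bound that the estimates of the cut-off
  consume.\<close>

lemma smooth_step_exists:
  obtains h h1 h2 :: "real \<Rightarrow> real" and C where "smooth UNIV h"
    "\<And>t. t \<le> 0 \<Longrightarrow> h t = 0" "\<And>t. t \<ge> 1 \<Longrightarrow> h t = 1" "\<And>t. 0 \<le> h t" "\<And>t. h t \<le> 1"
    "\<And>t. (h has_field_derivative h1 t) (at t)" "\<And>t. (h1 has_field_derivative h2 t) (at t)"
    "\<And>t. \<bar>h1 t\<bar> \<le> C" "\<And>t. \<bar>h2 t\<bar> \<le> C"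
proof -
  define e where "e = flat_powr 0"
  have e0: "e t \<ge> 0" and epos: "t > 0 \<Longrightarrow> e t > 0" and eneg: "t \<le> 0 \<Longrightarrow> e t = 0" for t
    by (auto simp: e_def flat_powr_def)
  have pos: "e t + e (1 - t) > 0" for t
    using epos[of t] epos[of "1-t"] e0[of t] e0[of "1-t"] by (cases "t > 0") linarith+
  define h where "h = (\<lambda>t. e t * inverse (e t + e (1 - t)))"
  have se: "smooth UNIV e" using Ck_flat_powr by (auto simp: smooth_def e_def)
  have "smooth UNIV (\<lambda>t::real. 1 - t)"
    by (intro smooth_diff smooth_bounded_linear smooth_const) auto
  then have "smooth UNIV (\<lambda>t. e (1 - t))" by (rule smooth_compose[OF se]) auto
  then have sh: "smooth UNIV h" unfolding h_def using pos
    by (intro smooth_mult se smooth_compose[OF smooth_inverse] smooth_add) auto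
  have h0: "t \<le> 0 \<Longrightarrow> h t = 0" for t by (simp add: h_def eneg)
  have h1: "t \<ge> 1 \<Longrightarrow> h t = 1" for t using epos[of t] by (simp add: h_def eneg)
  have hb: "0 \<le> h t" "h t \<le> 1" for t
    using pos[of t] e0[of t] e0[of "1-t"] by (auto simp: h_def field_simps)
  obtain f' where f': "\<And>x. (h has_derivative f' x) (at x)" "\<And>v. smooth UNIV (\<lambda>x. f' x v)"
    using smooth_has_derivative[OF sh] by auto
  have lin: "f' x v = f' x 1 * v" for x v
    using has_derivative_bounded_linear[OF f'(1)[of x]]
    by (metis bounded_linear.linear linear_cmul mult.commute mult_1_right real_scaleR_def)
  define k where "k = (\<lambda>x. f' x 1)"
  have k: "(h has_field_derivative k t) (at t)" for t
    using f'(1)[of t] lin unfolding has_field_derivative_def k_def by (metis (no_types, lifting) ext)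
  have sk: "smooth UNIV k" using f'(2) k_def by auto
  obtain g' where g': "\<And>x. (k has_derivative g' x) (at x)" "\<And>v. smooth UNIV (\<lambda>x. g' x v)"
    using smooth_has_derivative[OF sk] by auto
  have ling: "g' x v = g' x 1 * v" for x v
    using has_derivative_bounded_linear[OF g'(1)[of x]]
    by (metis bounded_linear.linear linear_cmul mult.commute mult_1_right real_scaleR_def)
  define l where "l = (\<lambda>x. g' x 1)"
  have l: "(k has_field_derivative l t) (at t)" for t
    using g'(1)[of t] ling unfolding has_field_derivative_def l_def by (metis (no_types, lifting) ext)
  have sl: "smooth UNIV l" using g'(2) l_def by auto
  have k0: "k t = 0" if "t < 0 \<or> t > 1" for t
  proof -
    have "((\<lambda>_. if t < 0 then 0 else 1) has_field_derivative 0) (at t)" by simp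
    then have "(h has_field_derivative 0) (at t)"
      by (rule has_field_derivative_transform_within_open[of _ _ _ "if t < 0 then {..<0} else {1<..}"])
        (use that h0 h1 in \<open>auto split: if_splits\<close>)
    then show ?thesis using k DERIV_unique by blast
  qed
  have l0: "l t = 0" if "t < 0 \<or> t > 1" for t
  proof -
    have "((\<lambda>_. 0) has_field_derivative 0) (at t)" by simp
    then have "(k has_field_derivative 0) (at t)"
      by (rule has_field_derivative_transform_within_open[of _ _ _ "if t < 0 then {..<0} else {1<..}"])
        (use that k0 in \<open>auto split: if_splits\<close>)
    then show ?thesis using l DERIV_unique by blast
  qed
  have bd: "\<exists>C. \<forall>t\<in>{0..1}. \<bar>f t\<bar> \<le> C" if "smooth UNIV f" for f :: "real \<Rightarrow> real"
  proof -
    have "compact (f ` {0..1})"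
      by (rule compact_continuous_image[OF continuous_on_subset[OF smooth_imp_continuous_on[OF that]]]) auto
    then show ?thesis using compact_imp_bounded[of "f ` {0..1}"] by (auto simp: bounded_iff)
  qed
  obtain C1 C2 where C: "\<forall>t\<in>{0..1}. \<bar>k t\<bar> \<le> C1" "\<forall>t\<in>{0..1}. \<bar>l t\<bar> \<le> C2"
    using bd[OF sk] bd[OF sl] by blast
  have "\<bar>k t\<bar> \<le> \<bar>C1\<bar> + \<bar>C2\<bar>" "\<bar>l t\<bar> \<le> \<bar>C1\<bar> + \<bar>C2\<bar>" for t
    using C[rule_format, of t] k0[of t] l0[of t] by (cases "t \<in> {0..1}"; force)+
  then show ?thesis using that[OF sh h0 h1 hb k l] by blast
qed

section \<open>From total derivatives to iterated partial derivatives\<close>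

lemma has_derivative_partials:
  fixes f :: "pt \<Rightarrow> real"
  assumes "(f has_derivative f') (at (x, y))"
  shows "((\<lambda>t. f (t, y)) has_field_derivative f' (1, 0)) (at x)"
    and "((\<lambda>t. f (x, t)) has_field_derivative f' (0, 1)) (at y)"
proof -
  interpret bounded_linear f' using assms has_derivative_bounded_linear by blast
  have "((\<lambda>t. (t, y)) has_derivative (\<lambda>t. (t, 0))) (at x)" "((\<lambda>t. (x, t)) has_derivative (\<lambda>t. (0, t))) (at y)"
    by (auto intro!: derivative_eq_intros)
  then have "((\<lambda>t. f (t, y)) has_derivative (\<lambda>t. f' (t, 0))) (at x)" "((\<lambda>t. f (x, t)) has_derivative (\<lambda>t. f' (0, t))) (at y)"
    using has_derivative_compose[of "\<lambda>t. (t, y)" "\<lambda>t. (t, 0)" x UNIV f f']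
      has_derivative_compose[of "\<lambda>t. (x, t)" "\<lambda>t. (0, t)" y UNIV f f'] assms
    by blast+
  moreover have "(\<lambda>t. f' (t, 0)) = (\<lambda>t. f' (1, 0) * t)" "(\<lambda>t. f' (0, t)) = (\<lambda>t. f' (0, 1) * t)"
  proof -
    have "f' (t, 0) = f' (1, 0) * t" "f' (0, t) = f' (0, 1) * t" for t
    using scaleR[of t "(1,0)"] scaleR[of t "(0,1)"] by (simp_all only: scaleR_Pair real_scaleR_def mult_zero_right mult_1_right mult.commute[of _ t])
    then show "(\<lambda>t. f' (t, 0)) = (\<lambda>t. f' (1, 0) * t)" "(\<lambda>t. f' (0, t)) = (\<lambda>t. f' (0, 1) * t)"
      by blast+
  qed
  ultimately show "((\<lambda>t. f (t, y)) has_field_derivative f' (1, 0)) (at x)"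
    and "((\<lambda>t. f (x, t)) has_field_derivative f' (0, 1)) (at y)"
    by (simp_all add: has_field_derivative_def)
qed

lemma smooth_pds:
  assumes "smooth UNIV f"
  shows "smooth UNIV (pds bs f)"
proof (induction bs)
  case Nil
  then show ?case using assms by simp
next
  case (Cons b bs)
  obtain f' where f': "\<And>z. (pds bs f has_derivative f' z) (at z)" "\<And>v. smooth UNIV (\<lambda>x. f' x v)"
    using smooth_has_derivative[OF Cons] by auto
  have "px (pds bs f) = (\<lambda>z. f' z (1, 0))" "py (pds bs f) = (\<lambda>z. f' z (0, 1))"
    using has_derivative_partials[OF f'(1)] by (auto simp: px_def py_def fun_eq_iff intro!: DERIV_imp_deriv)
  then show ?case using f'(2) by simp
qed

lemma smooth_imp_smooth2:
  assumes "smooth UNIV f"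
  shows "smooth2 f"
  unfolding smooth2_def
proof (intro allI conjI)
  fix bs x y
  show "continuous_on UNIV (pds bs f)" using smooth_pds[OF assms] smooth_imp_continuous_on by blast
  have "\<exists>f'. \<forall>z. (pds bs f has_derivative f' z) (at z)"
    using smooth_pds[OF assms, of bs, unfolded smooth_def, rule_format, of "Suc 0"] by auto
  then obtain f' where "\<forall>z. (pds bs f has_derivative f' z) (at z)" ..
  then have f': "(pds bs f has_derivative f' (x, y)) (at (x, y))" ..
  show "(\<lambda>t. pds bs f (t, y)) differentiable (at x)" "(\<lambda>t. pds bs f (x, t)) differentiable (at y)"
    using has_derivative_partials[OF f'] by (auto simp: real_differentiable_def)
qed

section \<open>Integration by parts in the plane\<close>

text \<open>Differentiability is recorded along coordinate lines, the form in which
  \<open>smooth2\<close> supplies it and in which Fubini's theorem and the fundamental theorem of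
  calculus use it.\<close>

definition C1 :: "(pt \<Rightarrow> real) \<Rightarrow> bool" where
  "C1 F \<longleftrightarrow> continuous_on UNIV F \<and> continuous_on UNIV (px F) \<and> continuous_on UNIV (py F) \<and>
     (\<forall>x y. (\<lambda>t. F (t, y)) differentiable (at x) \<and> (\<lambda>t. F (x, t)) differentiable (at y))"

lemma DERIV_px: "C1 F \<Longrightarrow> ((\<lambda>t. F (t, y)) has_field_derivative px F (x, y)) (at x)"
  and DERIV_py: "C1 F \<Longrightarrow> ((\<lambda>t. F (x, t)) has_field_derivative py F (x, y)) (at y)"
  by (simp_all add: C1_def px_def py_def DERIV_deriv_iff_real_differentiable)

lemma px_eqI: "((\<lambda>t. F (t, y)) has_field_derivative D) (at x) \<Longrightarrow> px F (x, y) = D"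
  and py_eqI: "((\<lambda>t. F (x, t)) has_field_derivative D) (at y) \<Longrightarrow> py F (x, y) = D"
  by (simp_all add: px_def py_def DERIV_imp_deriv)

lemma C1I:
  assumes "\<And>x y. ((\<lambda>t. F (t, y)) has_field_derivative F1 (x, y)) (at x)"
    and "\<And>x y. ((\<lambda>t. F (x, t)) has_field_derivative F2 (x, y)) (at y)"
    and "continuous_on UNIV F" "continuous_on UNIV F1" "continuous_on UNIV F2"
  shows "C1 F" "px F = F1" "py F = F2"
proof -
  show *: "px F = F1" "py F = F2" using px_eqI[OF assms(1)] py_eqI[OF assms(2)] by auto
  show "C1 F" using assms unfolding C1_def * by (fastforce simp: real_differentiable_def)
qed

lemma C1_mult:
  assumes "C1 f" "C1 g"
  shows "C1 (\<lambda>z. f z * g z)"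
    and px_mult: "px (\<lambda>z. f z * g z) = (\<lambda>z. f z * px g z + px f z * g z)"
    and py_mult: "py (\<lambda>z. f z * g z) = (\<lambda>z. f z * py g z + py f z * g z)"
proof -
  have "((\<lambda>t. f (t, y) * g (t, y)) has_field_derivative f (x, y) * px g (x, y) + px f (x, y) * g (x, y)) (at x)" for x y
    using DERIV_mult[OF DERIV_px[OF assms(1)] DERIV_px[OF assms(2)], of y y x] by (simp add: algebra_simps)
  moreover have "((\<lambda>t. f (x, t) * g (x, t)) has_field_derivative f (x, y) * py g (x, y) + py f (x, y) * g (x, y)) (at y)" for x y
    using DERIV_mult[OF DERIV_py[OF assms(1)] DERIV_py[OF assms(2)], of x x y] by (simp add: algebra_simps)
  moreover have "continuous_on UNIV (\<lambda>z. f z * px g z + px f z * g z)" "continuous_on UNIV (\<lambda>z. f z * py g z + py f z * g z)"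
     "continuous_on UNIV (\<lambda>z. f z * g z)"
    using assms unfolding C1_def by (auto intro!: continuous_on_add continuous_on_mult)
  ultimately show "C1 (\<lambda>z. f z * g z)" "px (\<lambda>z. f z * g z) = (\<lambda>z. f z * px g z + px f z * g z)"
    "py (\<lambda>z. f z * g z) = (\<lambda>z. f z * py g z + py f z * g z)"
    by (intro C1I; simp)+
qed

lemma C1_lincomb:
  assumes "C1 f" "C1 g"
  shows "C1 (\<lambda>z. c * f z + d * g z)"
    and px_lincomb: "px (\<lambda>z. c * f z + d * g z) = (\<lambda>z. c * px f z + d * px g z)"
    and py_lincomb: "py (\<lambda>z. c * f z + d * g z) = (\<lambda>z. c * py f z + d * py g z)"
proof -
  have "((\<lambda>t. c * f (t, y) + d * g (t, y)) has_field_derivative c * px f (x, y) + d * px g (x, y)) (at x)" for x y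
    by (intro DERIV_add DERIV_cmult DERIV_px assms)
  moreover have "((\<lambda>t. c * f (x, t) + d * g (x, t)) has_field_derivative c * py f (x, y) + d * py g (x, y)) (at y)" for x y
    by (intro DERIV_add DERIV_cmult DERIV_py assms)
  moreover have "continuous_on UNIV (\<lambda>z. c * f z + d * g z)" "continuous_on UNIV (\<lambda>z. c * px f z + d * px g z)"
     "continuous_on UNIV (\<lambda>z. c * py f z + d * py g z)"
    using assms unfolding C1_def by (auto intro!: continuous_on_add continuous_on_mult continuous_on_const)
  ultimately show "C1 (\<lambda>z. c * f z + d * g z)" "px (\<lambda>z. c * f z + d * g z) = (\<lambda>z. c * px f z + d * px g z)"
    "py (\<lambda>z. c * f z + d * g z) = (\<lambda>z. c * py f z + d * py g z)"
    by (intro C1I; simp)+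
qed

lemma partials_zero_on_open:
  assumes "open U" "\<And>z. z \<in> U \<Longrightarrow> F z = 0" "z \<in> U"
  shows "((\<lambda>t. F (t, snd z)) has_field_derivative 0) (at (fst z))"
    and "((\<lambda>t. F (fst z, t)) has_field_derivative 0) (at (snd z))"
    and "px F z = 0" "py F z = 0"
proof -
  have 1: "open ((\<lambda>t. (t, snd z)) -` U)" "open ((\<lambda>t. (fst z, t)) -` U)"
    using assms(1) by (auto intro!: open_vimage continuous_intros)
  show *: "((\<lambda>t. F (t, snd z)) has_field_derivative 0) (at (fst z))"
    by (rule has_field_derivative_transform_within_open[OF DERIV_const 1(1)]) (use assms in auto)
  show **: "((\<lambda>t. F (fst z, t)) has_field_derivative 0) (at (snd z))"
    by (rule has_field_derivative_transform_within_open[OF DERIV_const 1(2)]) (use assms in auto)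
  show "px F z = 0" "py F z = 0" using px_eqI[OF *] py_eqI[OF **] by simp_all
qed

lemma pds_zero_on_open:
  assumes "open U" "\<And>z. z \<in> U \<Longrightarrow> F z = 0"
  shows "z \<in> U \<Longrightarrow> pds bs F z = 0"
proof (induction bs arbitrary: z)
  case Nil
  then show ?case using assms by simp
next
  case (Cons b bs)
  then show ?case using partials_zero_on_open(3,4)[OF assms(1), of "pds bs F"] by simp
qed

lemma smooth2_C1: "smooth2 f \<Longrightarrow> C1 (pds bs f)"
  unfolding C1_def smooth2_def
  by (metis pds.simps(2))

lemma smooth2_lincomb:
  assumes "smooth2 f" "smooth2 g"
  shows "smooth2 (\<lambda>z. c * f z + d * g z)"
    and pds_lincomb: "pds bs (\<lambda>z. c * f z + d * g z) = (\<lambda>z. c * pds bs f z + d * pds bs g z)"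
proof -
  have *: "pds bs (\<lambda>z. c * f z + d * g z) = (\<lambda>z. c * pds bs f z + d * pds bs g z)" for bs
    by (induction bs) (simp_all add: px_lincomb py_lincomb smooth2_C1 assms)
  then show "pds bs (\<lambda>z. c * f z + d * g z) = (\<lambda>z. c * pds bs f z + d * pds bs g z)" .
  have "C1 (pds bs (\<lambda>z. c * f z + d * g z))" for bs
    unfolding * by (intro C1_lincomb smooth2_C1 assms)
  then show "smooth2 (\<lambda>z. c * f z + d * g z)" unfolding smooth2_def C1_def by auto
qed

text \<open>The double difference \<open>\<Delta>\<close> over a small square equals h^2 times
  either mixed derivative at some point of the square, by two mean value theorems taken in either
  order. Continuity carries the equality to the corner.\<close>

lemma mixed_partials:
  assumes f: "smooth2 f"
  shows "px (py f) (x, y) = py (px f) (x, y)"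
proof (rule ccontr)
  define A where "A = px (py f)"
  define B where "B = py (px f)"
  assume "\<not> ?thesis"
  then have ne: "dist (A (x, y)) (B (x, y)) / 2 > 0" by (simp add: A_def B_def)
  let ?e = "dist (A (x, y)) (B (x, y)) / 2"
  have cont: "continuous_on UNIV A" "continuous_on UNIV B"
    using f[unfolded smooth2_def, rule_format, of "[True, False]"] f[unfolded smooth2_def, rule_format, of "[False, True]"]
    by (simp_all add: A_def B_def)
  obtain d1 where d1: "d1 > 0" "\<And>z. dist z (x, y) < d1 \<Longrightarrow> dist (A z) (A (x, y)) < ?e"
    using cont(1) ne unfolding continuous_on_iff by (metis UNIV_I)
  obtain d2 where d2: "d2 > 0" "\<And>z. dist z (x, y) < d2 \<Longrightarrow> dist (B z) (B (x, y)) < ?e"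
    using cont(2) ne unfolding continuous_on_iff by (metis UNIV_I)
  define h where "h = min d1 d2 / 4"
  have h: "h > 0" using d1 d2 by (simp add: h_def)
  have near: "dist (p, q) (x, y) < d1" "dist (p, q) (x, y) < d2" if "x < p" "p < x + h" "y < q" "q < y + h" for p q
  proof -
    have "dist (p, q) (x, y) \<le> \<bar>p - x\<bar> + \<bar>q - y\<bar>"
      unfolding dist_Pair_Pair by (simp add: dist_real_def sqrt_sum_squares_le_sum_abs)
    also have "\<dots> < 2 * h" using that by auto
    also have "\<dots> < min d1 d2" using d1(1) d2(1) by (auto simp: h_def min_def)
    finally show "dist (p, q) (x, y) < d1" "dist (p, q) (x, y) < d2" by auto
  qed
  have C: "C1 f" "C1 (px f)" "C1 (py f)"
    using smooth2_C1[OF f, of "[]"] smooth2_C1[OF f, of "[True]"] smooth2_C1[OF f, of "[False]"] by simp_all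
  define \<Delta> where "\<Delta> = f (x + h, y + h) - f (x + h, y) - f (x, y + h) + f (x, y)"
  have "\<exists>p. x < p \<and> p < x + h \<and>
      (f (x + h, y + h) - f (x + h, y)) - (f (x, y + h) - f (x, y)) = (x + h - x) * (px f (p, y + h) - px f (p, y))"
    using h by (intro MVT2) (auto intro!: DERIV_diff DERIV_px C)
  then obtain p where p: "x < p" "p < x + h" "\<Delta> = h * (px f (p, y + h) - px f (p, y))"
    by (auto simp: \<Delta>_def algebra_simps)
  have "\<exists>q. y < q \<and> q < y + h \<and> px f (p, y + h) - px f (p, y) = (y + h - y) * B (p, q)"
    using h unfolding B_def by (intro MVT2) (auto intro!: DERIV_py C)
  then obtain q where q: "y < q" "q < y + h" "\<Delta> = h * (h * B (p, q))" using p by auto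
  have "\<exists>q'. y < q' \<and> q' < y + h \<and>
      (f (x + h, y + h) - f (x, y + h)) - (f (x + h, y) - f (x, y)) = (y + h - y) * (py f (x + h, q') - py f (x, q'))"
    using h by (intro MVT2) (auto intro!: DERIV_diff DERIV_py C)
  then obtain q' where q': "y < q'" "q' < y + h" "\<Delta> = h * (py f (x + h, q') - py f (x, q'))"
    by (auto simp: \<Delta>_def algebra_simps)
  have "\<exists>p'. x < p' \<and> p' < x + h \<and> py f (x + h, q') - py f (x, q') = (x + h - x) * A (p', q')"
    using h unfolding A_def by (intro MVT2) (auto intro!: DERIV_px C)
  then obtain p' where p': "x < p'" "p' < x + h" "\<Delta> = h * (h * A (p', q'))" using q' by auto
  have "A (p', q') = B (p, q)" using p'(3) q(3) h by auto
  moreover have "dist (A (p', q')) (A (x, y)) < ?e" using near p' q' d1 by blast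
  moreover have "dist (B (p, q)) (B (x, y)) < ?e" using near p q d2 by blast
  ultimately have "dist (A (x, y)) (B (x, y)) < ?e + ?e" by (metis dist_commute dist_triangle_less_add)
  then show False by simp
qed

lemma bounded_support_integrable:
  fixes F :: "pt \<Rightarrow> real"
  assumes "continuous_on UNIV F" "bounded {z. F z \<noteq> 0}"
  shows "integrable lborel F"
proof -
  let ?K = "closure {z. F z \<noteq> 0}"
  have "compact ?K" using bounded_closure[OF assms(2)] compact_eq_bounded_closed by blast
  then have "integrable lborel (\<lambda>x. indicator ?K x *\<^sub>R F x)"
    by (rule borel_integrable_compact) (use assms(1) continuous_on_subset in blast)
  moreover have "(\<lambda>x. indicator ?K x *\<^sub>R F x) = F"
    using closure_subset[of "{z. F z \<noteq> 0}"] by (auto simp: indicator_def fun_eq_iff)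
  ultimately show ?thesis by simp
qed

lemma integral_vanishing_derivative:
  fixes g g' :: "real \<Rightarrow> real"
  assumes "\<And>t. (g has_field_derivative g' t) (at t)" "continuous_on UNIV g'"
    and "\<And>t. \<bar>t\<bar> \<ge> R \<Longrightarrow> g t = 0" "R > 0"
  shows "(\<integral>t. g' t \<partial>lborel) = 0"
proof -
  have "g' t = 0" if "\<bar>t\<bar> > R" for t
  proof -
    have "open {t::real. \<bar>t\<bar> > R}" by (auto intro!: open_Collect_less continuous_intros)
    then have "(g has_field_derivative 0) (at t)"
      by (rule has_field_derivative_transform_within_open[OF DERIV_const]) (use that assms(3) in \<open>auto simp: less_imp_le\<close>)
    then show ?thesis using assms(1) DERIV_unique by blast
  qed
  then have *: "g' = (\<lambda>t. g' t * indicator {-R..R} t)"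
    by (intro ext) (force simp: indicator_def)
  have "(\<integral>t. g' t * indicator {-R..R} t \<partial>lborel) = g R - g (-R)"
    by (rule integral_FTC_Icc_real) (use assms in \<open>auto simp: continuous_on_eq_continuous_at\<close>)
  also have "\<dots> = 0" using assms(3)[of R] assms(3)[of "-R"] assms(4) by simp
  finally show ?thesis using * by simp
qed

lemma bounded_support_partials:
  assumes "bounded {z. F z \<noteq> 0}"
  shows "bounded {z. px F z \<noteq> 0}" "bounded {z. py F z \<noteq> 0}"
proof -
  let ?U = "- closure {z. F z \<noteq> 0}"
  have U: "open ?U" by (rule open_Compl[OF closed_closure])
  have F0: "F z = 0" if "z \<in> ?U" for z using that closure_subset[of "{z. F z \<noteq> 0}"] by auto
  have "px F z = 0" "py F z = 0" if "z \<in> ?U" for z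
    using partials_zero_on_open(3,4)[OF U F0 that] by simp_all
  then have "{z. px F z \<noteq> 0} \<subseteq> closure {z. F z \<noteq> 0}" "{z. py F z \<noteq> 0} \<subseteq> closure {z. F z \<noteq> 0}" by auto
  then show "bounded {z. px F z \<noteq> 0}" "bounded {z. py F z \<noteq> 0}"
    using assms bounded_closure bounded_subset by blast+
qed

text \<open>The divergence theorem for compactly supported fields: Fubini reduces it to the
  fundamental theorem of calculus on each line.\<close>

lemma integral_partials_zero:
  assumes F: "C1 F" and b: "bounded {z. F z \<noteq> 0}"
  shows "integrable lborel (px F)" "integrable lborel (py F)"
    and "(\<integral>z. px F z \<partial>lborel) = 0" "(\<integral>z. py F z \<partial>lborel) = 0"
proof -
  show int: "integrable lborel (px F)" "integrable lborel (py F)"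
    using F bounded_support_partials[OF b] by (auto intro!: bounded_support_integrable simp: C1_def)
  obtain R0 where R0: "\<And>z. F z \<noteq> 0 \<Longrightarrow> norm z \<le> R0" using b by (auto simp: bounded_iff)
  define R where "R = \<bar>R0\<bar> + 1"
  have R: "R > 0" by (simp add: R_def)
  have z: "F (x, y) = 0" if "\<bar>x\<bar> \<ge> R \<or> \<bar>y\<bar> \<ge> R" for x y
    using R0[of "(x, y)"] norm_fst_le[of x y] norm_snd_le[of y x] that
    unfolding R_def by fastforce
  have cont: "continuous_on UNIV (px F)" "continuous_on UNIV (py F)" using F by (auto simp: C1_def)
  have "(\<integral>x. px F (x, y) \<partial>lborel) = 0" for y
    by (rule integral_vanishing_derivative[where g = "\<lambda>t. F (t, y)" and R = R])
      (use z R in \<open>auto intro!: DERIV_px[OF F] continuous_on_compose2[OF cont(1)] continuous_intros\<close>)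
  moreover have "integrable (lborel \<Otimes>\<^sub>M lborel) (case_prod (\<lambda>x y. px F (x, y)))"
    using int(1) by (simp add: lborel_prod)
  ultimately show "(\<integral>z. px F z \<partial>lborel) = 0"
    using lborel_pair.integral_snd[of "\<lambda>x y. px F (x, y)"] by (simp add: lborel_prod)
  have "(\<integral>y. py F (x, y) \<partial>lborel) = 0" for x
    by (rule integral_vanishing_derivative[where g = "\<lambda>t. F (x, t)" and R = R])
      (use z R in \<open>auto intro!: DERIV_py[OF F] continuous_on_compose2[OF cont(2)] continuous_intros\<close>)
  moreover have "integrable (lborel \<Otimes>\<^sub>M lborel) (case_prod (\<lambda>x y. py F (x, y)))"
    using int(2) by (simp add: lborel_prod)
  ultimately show "(\<integral>z. py F z \<partial>lborel) = 0"
    using lborel_pair.integral_fst[of "\<lambda>x y. py F (x, y)"] by (simp add: lborel_prod)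
qed

lemma bounded_support_mult:
  assumes "bounded {z. f z \<noteq> 0} \<or> bounded {z. g z \<noteq> 0}"
  shows "bounded {z. f z * (g z :: real) \<noteq> 0}"
  using assms by (auto intro: bounded_subset)

lemma integration_by_parts:
  assumes f: "C1 f" and g: "C1 g" and b: "bounded {z. f z \<noteq> 0} \<or> bounded {z. g z \<noteq> 0}"
  shows "(\<integral>z. px f z * g z \<partial>lborel) = - (\<integral>z. f z * px g z \<partial>lborel)"
    and "(\<integral>z. py f z * g z \<partial>lborel) = - (\<integral>z. f z * py g z \<partial>lborel)"
proof -
  note p = integral_partials_zero(3,4)[OF C1_mult(1)[OF f g] bounded_support_mult[OF b]]
  have c: "continuous_on UNIV f" "continuous_on UNIV g" "continuous_on UNIV (px f)" "continuous_on UNIV (px g)"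
    "continuous_on UNIV (py f)" "continuous_on UNIV (py g)" using f g by (auto simp: C1_def)
  have i: "integrable lborel (\<lambda>z. f z * px g z)" "integrable lborel (\<lambda>z. px f z * g z)"
    "integrable lborel (\<lambda>z. f z * py g z)" "integrable lborel (\<lambda>z. py f z * g z)"
    using b bounded_support_partials[of f] bounded_support_partials[of g]
    by (auto intro!: bounded_support_integrable continuous_on_mult c bounded_support_mult)
  show "(\<integral>z. px f z * g z \<partial>lborel) = - (\<integral>z. f z * px g z \<partial>lborel)"
    "(\<integral>z. py f z * g z \<partial>lborel) = - (\<integral>z. f z * py g z \<partial>lborel)"
    using p unfolding px_mult[OF f g] py_mult[OF f g] by (simp_all add: i)
qed

section \<open>Test functions and the fundamental lemma\<close>

lemma test_fun_smooth2: "test_fun \<Omega> \<phi> \<Longrightarrow> smooth2 \<phi>"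
  by (simp add: test_fun_def)

lemma test_fun_C1: "test_fun \<Omega> \<phi> \<Longrightarrow> C1 (pds bs \<phi>)"
  by (simp add: test_fun_def smooth2_C1)

lemma test_fun_pds_continuous: "test_fun \<Omega> \<phi> \<Longrightarrow> continuous_on UNIV (pds bs \<phi>)"
  by (simp add: test_fun_def smooth2_def)

lemma test_fun_pds_support:
  assumes "test_fun \<Omega> \<phi>" "pds bs \<phi> z \<noteq> 0"
  shows "z \<in> closure {z. \<phi> z \<noteq> 0}"
proof (rule ccontr)
  let ?U = "- closure {z. \<phi> z \<noteq> 0}"
  assume "z \<notin> closure {z. \<phi> z \<noteq> 0}"
  then have z: "z \<in> ?U" by simp
  have U: "open ?U" by (rule open_Compl[OF closed_closure])
  have \<phi>0: "\<phi> w = 0" if "w \<in> ?U" for w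
    using that closure_subset[of "{z. \<phi> z \<noteq> 0}"] by auto
  have "pds bs \<phi> z = 0" by (rule pds_zero_on_open[OF U \<phi>0 z])
  then show False using assms(2) by simp
qed

lemma test_fun_pds_outside: "test_fun \<Omega> \<phi> \<Longrightarrow> z \<notin> \<Omega> \<Longrightarrow> pds bs \<phi> z = 0"
  using test_fun_pds_support unfolding test_fun_def by blast

lemma test_fun_pds_bounded_support:
  assumes "test_fun \<Omega> \<phi>" shows "bounded {z. pds bs \<phi> z \<noteq> 0}"
proof -
  have "bounded (closure {z. \<phi> z \<noteq> 0})" using assms by (simp add: test_fun_def compact_imp_bounded)
  then show ?thesis by (rule bounded_subset) (use test_fun_pds_support[OF assms] in blast)
qed

lemma test_fun_lincomb:
  assumes "test_fun \<Omega> f" "test_fun \<Omega> g"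
  shows "test_fun \<Omega> (\<lambda>z. c * f z + d * g z)"
proof -
  have "closure {z. c * f z + d * g z \<noteq> 0} \<subseteq> closure ({z. f z \<noteq> 0} \<union> {z. g z \<noteq> 0})"
    by (rule closure_mono) auto
  then have sub: "closure {z. c * f z + d * g z \<noteq> 0} \<subseteq> closure {z. f z \<noteq> 0} \<union> closure {z. g z \<noteq> 0}"
    by simp
  moreover have "compact (closure {z. f z \<noteq> 0} \<union> closure {z. g z \<noteq> 0})"
    using assms by (intro compact_Un) (auto simp: test_fun_def)
  ultimately have "compact (closure {z. c * f z + d * g z \<noteq> 0})"
    using sub bounded_subset[OF compact_imp_bounded] compact_eq_bounded_closed closed_closure by blast
  then show ?thesis using assms sub unfolding test_fun_def by (auto intro!: smooth2_lincomb)
qed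

text \<open>Moving the derivatives one at a time reverses their order, whence \<open>rev bs\<close>.
  The list \<open>cs\<close> of derivatives already moved is what the induction needs.\<close>

lemma pds_integration_by_parts:
  assumes "test_fun \<Omega> \<psi>" "smooth2 f"
  shows "(\<integral>z. pds bs f z * pds cs \<psi> z \<partial>lborel) = (-1) ^ length bs * (\<integral>z. f z * pds (rev bs @ cs) \<psi> z \<partial>lborel)"
proof (induction bs arbitrary: cs)
  case (Cons b bs)
  have "(\<integral>z. pds (b # bs) f z * pds cs \<psi> z \<partial>lborel) = - (\<integral>z. pds bs f z * pds (b # cs) \<psi> z \<partial>lborel)"
    using integration_by_parts[OF smooth2_C1[OF assms(2), of bs] test_fun_C1[OF assms(1), of cs]
      disjI2[OF test_fun_pds_bounded_support[OF assms(1)]]]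
    by simp
  then show ?case unfolding Cons.IH by simp
qed simp

section \<open>Integrals over the domain and square integrability\<close>

lemma set_integral_lborel:
  fixes G :: "pt \<Rightarrow> real"
  assumes "G \<in> borel_measurable borel" "\<And>z. z \<notin> \<Omega> \<Longrightarrow> G z = 0"
  shows "(LINT z:\<Omega>|lebesgue. G z) = (\<integral>z. G z \<partial>lborel)"
proof -
  have "(LINT z:\<Omega>|lebesgue. G z) = integral\<^sup>L lebesgue G"
    unfolding set_lebesgue_integral_def
    by (rule Bochner_Integration.integral_cong) (use assms(2) in \<open>auto simp: indicator_def\<close>)
  also have "\<dots> = (\<integral>z. G z \<partial>lborel)" using assms(1) by (intro integral_completion) simp
  finally show ?thesis .
qed

lemma set_integrable_bounded_support:
  fixes G :: "pt \<Rightarrow> real"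
  assumes "open \<Omega>" "continuous_on UNIV G" "bounded {z. G z \<noteq> 0}"
  shows "set_integrable lebesgue \<Omega> G"
proof -
  have "integrable lebesgue G"
    using bounded_support_integrable[OF assms(2,3)] integrable_completion[of G lborel] by auto
  then show ?thesis unfolding set_integrable_def
    using integrable_mult_indicator[of \<Omega> lebesgue G] assms(1) by auto
qed

lemma L2_bounded_support:
  assumes "open \<Omega>" "continuous_on UNIV G" "bounded {z. G z \<noteq> 0}"
  shows "L2 \<Omega> G"
proof -
  have "set_integrable lebesgue \<Omega> (\<lambda>z. (G z)\<^sup>2)"
    using assms by (intro set_integrable_bounded_support) (auto intro!: continuous_intros)
  moreover have "set_borel_measurable lebesgue \<Omega> G"
    using set_integrable_bounded_support[OF assms] by (simp add: set_integrable_def set_borel_measurable_def borel_measurable_integrable)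
  ultimately show ?thesis by (simp add: L2_def)
qed

lemma L2_test_fun: "open \<Omega> \<Longrightarrow> test_fun \<Omega> \<phi> \<Longrightarrow> L2 \<Omega> (pds bs \<phi>)"
  by (intro L2_bounded_support test_fun_pds_continuous test_fun_pds_bounded_support)

lemma L2_mult_integrable:
  assumes "L2 \<Omega> f" "L2 \<Omega> g"
  shows "set_integrable lebesgue \<Omega> (\<lambda>z. f z * g z)"
  unfolding set_integrable_def
proof (rule Bochner_Integration.integrable_bound)
  show "integrable lebesgue (\<lambda>z. indicator \<Omega> z *\<^sub>R (f z)\<^sup>2 + indicator \<Omega> z *\<^sub>R (g z)\<^sup>2)"
    using assms unfolding L2_def set_integrable_def by (intro Bochner_Integration.integrable_add) auto
  have "(\<lambda>z. (indicator \<Omega> z *\<^sub>R f z) * (indicator \<Omega> z *\<^sub>R g z)) \<in> borel_measurable lebesgue"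
    using assms unfolding L2_def set_borel_measurable_def by (intro borel_measurable_times) auto
  then show "(\<lambda>z. indicator \<Omega> z *\<^sub>R (f z * g z)) \<in> borel_measurable lebesgue"
    by (rule measurable_cong[THEN iffD1, rotated]) (auto simp: indicator_def)
  have "\<bar>f z * g z\<bar> \<le> (f z)\<^sup>2 + (g z)\<^sup>2" for z
    using sum_squares_bound[of "f z" "g z"] sum_squares_bound[of "- f z" "g z"] zero_le_power2[of "f z"] zero_le_power2[of "g z"]
    by (auto simp: abs_le_iff)
  then show "AE z in lebesgue. norm (indicator \<Omega> z *\<^sub>R (f z * g z)) \<le> norm (indicator \<Omega> z *\<^sub>R (f z)\<^sup>2 + indicator \<Omega> z *\<^sub>R (g z)\<^sup>2)"
    by (auto simp: indicator_def)
qed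

lemma L2_lincomb:
  assumes "L2 \<Omega> f" "L2 \<Omega> g"
  shows "L2 \<Omega> (\<lambda>z. c * f z + d * g z)"
proof -
  have "set_integrable lebesgue \<Omega> (\<lambda>z. c\<^sup>2 * (f z)\<^sup>2 + (2 * c * d) * (f z * g z) + d\<^sup>2 * (g z)\<^sup>2)"
    using assms L2_mult_integrable[OF assms] unfolding L2_def
    by (intro set_integral_add(1) set_integrable_mult_right) auto
  moreover have "(\<lambda>z. c * (indicator \<Omega> z *\<^sub>R f z) + d * (indicator \<Omega> z *\<^sub>R g z)) \<in> borel_measurable lebesgue"
    using assms unfolding L2_def set_borel_measurable_def
    by (intro borel_measurable_add borel_measurable_times borel_measurable_const) auto
  then have "set_borel_measurable lebesgue \<Omega> (\<lambda>z. c * f z + d * g z)"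
    unfolding set_borel_measurable_def by (simp add: algebra_simps)
  ultimately show ?thesis unfolding L2_def by (simp add: power2_eq_square algebra_simps)
qed

lemma L2_integrable:
  assumes "open \<Omega>" "bounded \<Omega>" "L2 \<Omega> f"
  shows "set_integrable lebesgue \<Omega> f"
proof -
  have "\<Omega> \<in> lmeasurable" using assms by (intro bounded_set_imp_lmeasurable) auto
  then have "set_integrable lebesgue \<Omega> (\<lambda>_. 1 :: real)"
    unfolding set_integrable_def using integrable_real_indicator[of \<Omega> lebesgue] by (auto simp: fmeasurable_def)
  then have "L2 \<Omega> (\<lambda>_. 1)" unfolding L2_def
    by (auto simp: set_borel_measurable_def set_integrable_def borel_measurable_integrable)
  then show ?thesis using L2_mult_integrable[OF assms(3)] by fastforce
qed

text \<open>A product of four one-dimensional steps, one for each side of the box; letting the steps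
  steepen approximates the indicator function pointwise, and the uniform bound 1 prepares dominated
  convergence.\<close>

lemma box_bump:
  fixes a1 a2 b1 b2 :: real
  obtains \<phi> :: "nat \<Rightarrow> pt \<Rightarrow> real" where
    "\<And>n \<Omega>. n > 0 \<Longrightarrow> box (a1, a2) (b1, b2) \<subseteq> \<Omega> \<Longrightarrow> test_fun \<Omega> (\<phi> n)"
    "\<And>n z. 0 \<le> \<phi> n z" "\<And>n z. \<phi> n z \<le> 1"
    "\<And>z. (\<lambda>n. \<phi> n z) \<longlonglongrightarrow> indicator (box (a1, a2) (b1, b2)) z"
proof -
  obtain h h1 h2 :: "real \<Rightarrow> real" and C where h: "smooth UNIV h"
    "\<And>t. t \<le> 0 \<Longrightarrow> h t = 0" "\<And>t. t \<ge> 1 \<Longrightarrow> h t = 1" "\<And>t. 0 \<le> h t" "\<And>t. h t \<le> 1"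
    using smooth_step_exists by metis
  \<comment> \<open>The shift by 1 makes the step vanish wherever l is at most 1/n, so the support
    lies in a closed box strictly inside the open one.\<close>
  define k where "k = (\<lambda>n (l::pt \<Rightarrow> real) z. h (real n * l z - 1))"
  define \<phi> where "\<phi> = (\<lambda>n z. k n (\<lambda>z. fst z - a1) z * k n (\<lambda>z. b1 - fst z) z * (k n (\<lambda>z. snd z - a2) z * k n (\<lambda>z. b2 - snd z) z))"
  have lin: "smooth UNIV (\<lambda>z. fst z - a1)" "smooth UNIV (\<lambda>z. b1 - fst z)" "smooth UNIV (\<lambda>z. snd z - a2)" "smooth UNIV (\<lambda>z. b2 - snd z)"
    by (intro smooth_diff smooth_const smooth_bounded_linear bounded_linear_fst bounded_linear_snd)+
  have sk: "smooth UNIV (k n l)" if "smooth UNIV l" for n l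
    unfolding k_def by (rule smooth_compose[OF h(1)]) (auto intro!: smooth_diff smooth_mult smooth_const that)
  have s\<phi>: "smooth UNIV (\<phi> n)" for n
    unfolding \<phi>_def by (intro smooth_mult sk lin)
  have k01: "0 \<le> k n l z" "k n l z \<le> 1" for n l z using h by (auto simp: k_def)
  have kpos: "l z \<ge> 1 / real n" if "k n l z \<noteq> 0" "n > 0" for n l z
  proof -
    have "real n * l z - 1 > 0" using that h(2)[of "real n * l z - 1"] by (force simp: k_def)
    then show ?thesis using that(2) by (simp add: field_simps)
  qed
  have klim: "(\<lambda>n. k n l z) \<longlonglongrightarrow> (if l z > 0 then 1 else 0)" for l z
  proof (cases "l z > 0")
    case True
    obtain N :: nat where N: "2 / l z \<le> real N" using real_arch_simple by blast
    have "k n l z = 1" if "n \<ge> N" for n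
    proof -
      have "2 / l z \<le> real n" using N that by linarith
      then have "2 \<le> real n * l z" using True by (simp add: field_simps)
      then show ?thesis by (simp add: k_def h(3))
    qed
    then have "eventually (\<lambda>n. 1 = k n l z) sequentially" by (auto simp: eventually_sequentially)
    then show ?thesis using True by (simp add: Lim_transform_eventually[OF tendsto_const])
  next
    case False
    then have "k n l z = 0" for n
      unfolding k_def by (intro h(2)) (smt (verit) mult_nonneg_nonpos of_nat_0_le_iff)
    then show ?thesis using False by simp
  qed
  show ?thesis
  proof (rule that)
    fix n :: nat and \<Omega> :: "pt set" assume n: "n > 0" and sub: "box (a1, a2) (b1, b2) \<subseteq> \<Omega>"
    let ?c = "cbox (a1 + 1 / real n, a2 + 1 / real n) (b1 - 1 / real n, b2 - 1 / real n)"
    have "{z. \<phi> n z \<noteq> 0} \<subseteq> ?c"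
    proof
      fix z assume "z \<in> {z. \<phi> n z \<noteq> 0}"
      then have "k n (\<lambda>z. fst z - a1) z \<noteq> 0" "k n (\<lambda>z. b1 - fst z) z \<noteq> 0" "k n (\<lambda>z. snd z - a2) z \<noteq> 0" "k n (\<lambda>z. b2 - snd z) z \<noteq> 0"
        by (auto simp: \<phi>_def)
      from this[THEN kpos[OF _ n]] show "z \<in> ?c" by (cases z) auto
    qed
    then have cl: "closure {z. \<phi> n z \<noteq> 0} \<subseteq> ?c" by (rule closure_minimal) (rule closed_cbox)
    then have "compact (closure {z. \<phi> n z \<noteq> 0})"
      by (meson bounded_cbox bounded_subset closed_closure compact_eq_bounded_closed)
    moreover have "?c \<subseteq> box (a1, a2) (b1, b2)" 
    proof -
      have "cbox (a1 + e, a2 + e) (b1 - e, b2 - e) \<subseteq> box (a1, a2) (b1, b2)" if "e > 0" for e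
        using that by (auto simp: box_def cbox_def Basis_prod_def)
      then show ?thesis using n by simp
    qed
    ultimately show "test_fun \<Omega> (\<phi> n)" using cl sub smooth_imp_smooth2[OF s\<phi>] by (auto simp: test_fun_def)
  next
    fix n z
    show "0 \<le> \<phi> n z" "\<phi> n z \<le> 1" unfolding \<phi>_def by (intro mult_nonneg_nonneg mult_le_one k01)+
  next
    fix z
    have "(\<lambda>n. \<phi> n z) \<longlonglongrightarrow> (if fst z - a1 > 0 then 1 else 0) * (if b1 - fst z > 0 then 1 else 0) *
      ((if snd z - a2 > 0 then 1 else 0) * (if b2 - snd z > 0 then 1 else 0))"
      unfolding \<phi>_def by (intro tendsto_mult klim)
    moreover have "(if fst z - a1 > 0 then 1 else 0) * (if b1 - fst z > 0 then 1 else 0) *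
      ((if snd z - a2 > 0 then 1 else 0) * (if b2 - snd z > 0 then 1 else 0)) = indicat_real (box (a1, a2) (b1, b2)) z"
      by (cases z) (auto simp: indicator_def box_def Basis_prod_def)
    ultimately show "(\<lambda>n. \<phi> n z) \<longlonglongrightarrow> indicator (box (a1, a2) (b1, b2)) z" by simp
  qed
qed

text \<open>The Borel sets over which \<open>G\<close> has integral zero form a Dynkin system, and
  boxes are an intersection-stable generator.\<close>

lemma AE_zero_if_box_integrals_zero:
  fixes g :: "pt \<Rightarrow> real"
  assumes g: "integrable lborel g" and z: "\<And>a b. box a b \<subseteq> box c d \<Longrightarrow> (LINT z:box a b|lborel. g z) = 0"
  shows "AE z in lborel. z \<in> box c d \<longrightarrow> g z = 0"
proof -
  let ?B = "box c d"
  \<comment> \<open>Cutting off to the box makes the total integral itself a box integral, which the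
    complement step requires.\<close>
  define G where "G = (\<lambda>z. indicator ?B z * g z)"
  have G: "integrable lborel G"
    using integrable_mult_indicator[OF _ g, of ?B] by (simp add: G_def)
  have SI: "set_integrable lborel A G" if "A \<in> sets borel" for A
    using integrable_mult_indicator[OF _ G, of A] that by (simp add: set_integrable_def)
  have box0: "(LINT z:box a b|lborel. G z) = 0" for a b
  proof -
    obtain a' b' where ab: "box a b \<inter> ?B = box a' b'" using box_Int_box by blast
    have "(LINT z:box a b|lborel. G z) = (LINT z:box a b \<inter> ?B|lborel. g z)"
      unfolding set_lebesgue_integral_def
      by (rule Bochner_Integration.integral_cong) (auto simp: G_def indicator_def)
    then show ?thesis using z[of a' b'] ab by auto
  qed
  have tot: "integral\<^sup>L lborel G = 0"
    using box0[of c d] unfolding set_lebesgue_integral_def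
    by (metis (no_types, lifting) G_def Bochner_Integration.integral_cong indicator_simps mult_eq_0_iff real_scaleR_def mult_1)
  have "(LINT z:A|lborel. G z) = 0" if "A \<in> sets borel" for A
  proof -
    have "Int_stable (range (\<lambda>(a, b). box a b :: pt set))"
    proof (rule Int_stableI)
      fix A B :: "pt set"
      assume "A \<in> range (\<lambda>(a, b). box a b)" "B \<in> range (\<lambda>(a, b). box a b)"
      then obtain a b a' b' where "A = box a b" "B = box a' b'" by auto
      then obtain a'' b'' where "A \<inter> B = box a'' b''" using box_Int_box by blast
      then show "A \<inter> B \<in> range (\<lambda>(a, b). box a b)" by auto
    qed
    moreover have "range (\<lambda>(a, b). box a b :: pt set) \<subseteq> Pow UNIV" by simp
    moreover have "A \<in> sigma_sets UNIV (range (\<lambda>(a, b). box a b :: pt set))"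
      using that by (simp add: borel_eq_box)
    ultimately show ?thesis
    proof (induction rule: sigma_sets_induct_disjoint)
      case (basic A)
      then show ?case using box0 by auto
    next
      case empty
      then show ?case by (simp add: set_lebesgue_integral_def)
    next
      case (compl A)
      then have A: "A \<in> sets borel" by (simp add: borel_eq_box)
      have "(LINT z:UNIV - A|lborel. G z) + (LINT z:A|lborel. G z) = (LINT z:UNIV - A \<union> A|lborel. G z)"
        using A by (intro set_integral_Un[symmetric] SI) auto
      then show ?case using compl tot by (simp add: set_lebesgue_integral_def)
    next
      case (union A)
      then have A: "range A \<subseteq> sets borel" by (simp add: borel_eq_box)
      have "(LINT z:(\<Union>i. A i)|lborel. G z) = (\<Sum>i. (LINT z:A i|lborel. G z))"
        by (rule lebesgue_integral_countable_add) (use A union SI in \<open>auto simp: disjoint_family_on_def\<close>)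
      then show ?case using union by simp
    qed
  qed
  then have "AE z in lborel. G z = 0"
    using density_unique_real[OF G, of "\<lambda>_. 0"] by (simp add: set_lebesgue_integral_def)
  then show ?thesis by eventually_elim (auto simp: G_def indicator_def split: if_splits)
qed

text \<open>Bumps converge boundedly to the indicator of a box, so the integral over every box
  inside the open set vanishes; countably many such boxes exhaust the set.\<close>

lemma fundamental_lemma:
  assumes \<Omega>: "open \<Omega>" and g: "set_integrable lebesgue \<Omega> g"
    and z: "\<And>\<phi>. test_fun \<Omega> \<phi> \<Longrightarrow> (LINT z:\<Omega>|lebesgue. g z * \<phi> z) = 0"
  shows "AE z in lebesgue. z \<in> \<Omega> \<longrightarrow> g z = 0"
proof -
  define G where "G = (\<lambda>z. indicator \<Omega> z *\<^sub>R g z)"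
  have G: "integrable lebesgue G" using g by (simp add: set_integrable_def G_def)
  then have "G \<in> borel_measurable lebesgue" by (rule borel_measurable_integrable)
  \<comment> \<open>The generator argument runs on Borel sets, hence the passage to a Borel function
    that agrees almost everywhere.\<close>
  then obtain g' where g': "g' \<in> borel_measurable lborel" "AE z in lborel. G z = g' z"
    using completion_ex_borel_measurable_real by blast
  have AEg': "AE z in lebesgue. G z = g' z" using g'(2) AE_completion by blast
  have Ig': "integrable lebesgue g'"
    using integrable_cong_AE[of G lebesgue g'] G g'(1) AEg' measurable_completion[OF g'(1)] by blast
  then have ig': "integrable lborel g'" using integrable_completion[OF g'(1)] by blast
  have box0: "(LINT z:box a b|lborel. g' z) = 0" if sub: "box a b \<subseteq> \<Omega>" for a b
  proof -
    obtain a1 a2 b1 b2 where ab: "a = (a1, a2)" "b = (b1, b2)" by fastforce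
    obtain \<phi> :: "nat \<Rightarrow> pt \<Rightarrow> real" where \<phi>:
      "\<And>n \<Omega>. n > 0 \<Longrightarrow> box a b \<subseteq> \<Omega> \<Longrightarrow> test_fun \<Omega> (\<phi> n)"
      "\<And>n z. 0 \<le> \<phi> n z" "\<And>n z. \<phi> n z \<le> 1"
      "\<And>z. (\<lambda>n. \<phi> n z) \<longlonglongrightarrow> indicator (box a b) z"
      unfolding ab using box_bump[of a1 a2 b1 b2] by metis
    have tf: "test_fun \<Omega> (\<phi> (Suc n))" for n using \<phi>(1)[of "Suc n"] sub by simp
    have m\<phi>: "\<phi> (Suc n) \<in> borel_measurable borel" for n
      using test_fun_pds_continuous[OF tf, of "[]"] by (simp add: borel_measurable_continuous_onI)
    have "(\<lambda>n. \<integral>z. g' z * \<phi> (Suc n) z \<partial>lborel) \<longlonglongrightarrow> (\<integral>z. g' z * indicator (box a b) z \<partial>lborel)"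
    proof (rule integral_dominated_convergence[where w = "\<lambda>z. \<bar>g' z\<bar>"])
      show "AE z in lborel. (\<lambda>n. g' z * \<phi> (Suc n) z) \<longlonglongrightarrow> g' z * indicator (box a b) z"
        by (intro AE_I2 tendsto_mult tendsto_const LIMSEQ_Suc[OF \<phi>(4)])
      show "AE z in lborel. norm (g' z * \<phi> (Suc n) z) \<le> \<bar>g' z\<bar>" for n
        using \<phi>(2,3) by (auto simp: abs_mult intro!: mult_left_le)
    qed (use ig' m\<phi> g' in auto)
    moreover have "(\<integral>z. g' z * \<phi> (Suc n) z \<partial>lborel) = 0" for n
    proof -
      have "(\<integral>z. g' z * \<phi> (Suc n) z \<partial>lborel) = (\<integral>z. g' z * \<phi> (Suc n) z \<partial>lebesgue)"
        using g' m\<phi> by (intro integral_completion[symmetric]) auto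
      also have "\<dots> = (\<integral>z. G z * \<phi> (Suc n) z \<partial>lebesgue)"
      proof (rule integral_cong_AE)
        have "\<phi> (Suc n) \<in> borel_measurable lebesgue" using measurable_completion[of "\<phi> (Suc n)" lborel borel] m\<phi> by simp
        then show "(\<lambda>z. g' z * \<phi> (Suc n) z) \<in> borel_measurable lebesgue" "(\<lambda>z. G z * \<phi> (Suc n) z) \<in> borel_measurable lebesgue"
          using measurable_completion[OF g'(1)] \<open>G \<in> borel_measurable lebesgue\<close> by (auto intro!: borel_measurable_times)
        show "AE z in lebesgue. g' z * \<phi> (Suc n) z = G z * \<phi> (Suc n) z"
          using AEg' by eventually_elim simp
      qed
      also have "\<dots> = (LINT z:\<Omega>|lebesgue. g z * \<phi> (Suc n) z)"
        unfolding set_lebesgue_integral_def G_def by (simp add: mult.assoc)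
      finally show ?thesis using z[OF tf] by simp
    qed
    ultimately have "(\<integral>z. g' z * indicator (box a b) z \<partial>lborel) = 0"
      by (simp add: LIMSEQ_const_iff)
    then show ?thesis unfolding set_lebesgue_integral_def by (simp add: mult.commute)
  qed
  obtain D where D: "countable D" "\<And>X. X \<in> D \<Longrightarrow> X \<subseteq> \<Omega> \<and> (\<exists>a b. X = box a b)" "\<Union>D = \<Omega>"
    using open_countable_Union_open_box[OF \<Omega>] by (metis Pow_iff subsetD)
  have "AE z in lborel. \<forall>X\<in>D. z \<in> X \<longrightarrow> g' z = 0"
    unfolding AE_ball_countable[OF D(1)]
  proof
    fix X assume "X \<in> D"
    then obtain a b where X: "X = box a b" "X \<subseteq> \<Omega>" using D(2) by blast
    then show "AE z in lborel. z \<in> X \<longrightarrow> g' z = 0"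
      using AE_zero_if_box_integrals_zero[OF ig', of a b] box0 by blast
  qed
  then have "AE z in lebesgue. z \<in> \<Omega> \<longrightarrow> g' z = 0" using D(3) by (intro AE_completion) (auto elim!: eventually_mono)
  with AEg' show ?thesis by eventually_elim (auto simp: G_def)
qed

section \<open>Weak derivatives and the forms \<open>a\<close> and \<open>b\<close>\<close>

lemma set_integral_cong_AE':
  fixes f g :: "pt \<Rightarrow> real"
  assumes "set_integrable lebesgue A f" "set_integrable lebesgue A g" "AE z in lebesgue. z \<in> A \<longrightarrow> f z = g z"
  shows "(LINT z:A|lebesgue. f z) = (LINT z:A|lebesgue. g z)"
  unfolding set_lebesgue_integral_def
  by (rule integral_cong_AE)
    (use assms(1,2) in \<open>auto simp: set_integrable_def intro: borel_measurable_integrable\<close>,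
     use assms(3) in \<open>eventually_elim, auto simp: indicator_def\<close>)

text \<open>Undoes the order reversal caused by integration by parts, for the orders that occur in
  \<open>H2\<close>.\<close>

lemma pds_rev:
  assumes "smooth2 \<psi>" "length bs \<le> 2"
  shows "pds (rev bs) \<psi> = pds bs \<psi>"
proof -
  have "bs = [] \<or> (\<exists>b. bs = [b]) \<or> (\<exists>b c. bs = [b, c])"
    using assms(2) by (cases bs; cases "tl bs") auto
  then show ?thesis using mixed_partials[OF assms(1)] by (auto simp: fun_eq_iff)
qed

text \<open>The best weight is t = B / A. Both numbers are shifted by e > 0 so that the quotient and
  its inverse make sense, and e then tends to 0. The Cauchy-Schwarz type bounds below are obtained
  from weighted Young inequalities in this way.\<close>

lemma mult_le_if_weighted:
  assumes "\<And>t::real. t > 0 \<Longrightarrow> X \<le> t * A\<^sup>2 + B\<^sup>2 / t" "A \<ge> 0" "B \<ge> 0"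
  shows "X \<le> 2 * A * B"
proof -
  have "X \<le> 2 * (A + e) * (B + e)" if "e > 0" for e
  proof -
    have "X \<le> (B + e) / (A + e) * A\<^sup>2 + B\<^sup>2 / ((B + e) / (A + e))" using assms that by (intro assms(1)) auto
    also have "\<dots> \<le> (B + e) / (A + e) * (A + e)\<^sup>2 + (B + e)\<^sup>2 / ((B + e) / (A + e))"
      using assms that by (intro add_mono mult_left_mono divide_right_mono power_mono) auto
    also have "\<dots> = 2 * (A + e) * (B + e)"
    proof -
      have "Q / P * P\<^sup>2 + Q\<^sup>2 / (Q / P) = 2 * P * Q" if "P > 0" "Q > 0" for P Q :: real
        using that by (simp add: power2_eq_square)
      then show ?thesis using assms that by simp
    qed
    finally show ?thesis .
  qed
  then have "eventually (\<lambda>e. X \<le> 2 * (A + e) * (B + e)) (at_right 0)" by (auto simp: eventually_at_filter)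
  moreover have "((\<lambda>e. 2 * (A + e) * (B + e)) \<longlongrightarrow> 2 * (A + 0) * (B + 0)) (at_right 0)"
    by (intro tendsto_intros)
  ultimately show ?thesis using tendsto_lowerbound by fastforce
qed

section \<open>Calculus of weak derivatives almost everywhere\<close>

locale bounded_domain =
  fixes \<Omega> :: "pt set"
  assumes open_\<Omega>: "open \<Omega>" and bounded_\<Omega>: "bounded \<Omega>"
begin

abbreviation II :: "(pt \<Rightarrow> real) \<Rightarrow> real" where "II f \<equiv> LINT z:\<Omega>|lebesgue. f z"
abbreviation si :: "(pt \<Rightarrow> real) \<Rightarrow> bool" where "si f \<equiv> set_integrable lebesgue \<Omega> f"

lemma is_weak_deriv_test_fun:
  assumes \<phi>: "test_fun \<Omega> \<phi>" and l: "length bs \<le> 2"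
  shows "is_weak_deriv \<Omega> bs \<phi> (pds bs \<phi>)"
  unfolding is_weak_deriv_def
proof (intro allI impI)
  fix \<psi> assume \<psi>: "test_fun \<Omega> \<psi>"
  have c: "continuous_on UNIV \<phi>" "continuous_on UNIV \<psi>"
    using test_fun_pds_continuous[OF \<phi>, of "[]"] test_fun_pds_continuous[OF \<psi>, of "[]"] by simp_all
  have "II (\<lambda>z. \<phi> z * pds bs \<psi> z) = (\<integral>z. \<phi> z * pds bs \<psi> z \<partial>lborel)"
    by (rule set_integral_lborel)
      (use test_fun_pds_outside[OF \<psi>] c test_fun_pds_continuous[OF \<psi>] in \<open>auto intro!: borel_measurable_continuous_onI continuous_on_mult\<close>)
  moreover have "II (\<lambda>z. pds bs \<phi> z * \<psi> z) = (\<integral>z. pds bs \<phi> z * \<psi> z \<partial>lborel)"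
    by (rule set_integral_lborel)
      (use test_fun_pds_outside[OF \<phi>] c test_fun_pds_continuous[OF \<phi>] in \<open>auto intro!: borel_measurable_continuous_onI continuous_on_mult\<close>)
  moreover have "(\<integral>z. pds bs \<phi> z * \<psi> z \<partial>lborel) = (-1) ^ length bs * (\<integral>z. \<phi> z * pds bs \<psi> z \<partial>lborel)"
    using pds_integration_by_parts[OF \<psi> test_fun_smooth2[OF \<phi>], of bs "[]"] pds_rev[OF test_fun_smooth2[OF \<psi>] l] by simp
  ultimately show "II (\<lambda>z. \<phi> z * pds bs \<psi> z) = (-1) ^ length bs * II (\<lambda>z. pds bs \<phi> z * \<psi> z)"
    by (simp add: power_mult_distrib[symmetric] mult.assoc[symmetric] flip: power_add)
qed

lemma weak_deriv_unique:
  assumes "L2 \<Omega> g" "is_weak_deriv \<Omega> bs w g" "L2 \<Omega> k" "is_weak_deriv \<Omega> bs w k"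
  shows "AE z in lebesgue. z \<in> \<Omega> \<longrightarrow> g z = k z"
proof -
  have "L2 \<Omega> (\<lambda>z. 1 * g z + (-1) * k z)" using assms L2_lincomb by blast
  then have si: "si (\<lambda>z. g z - k z)" using L2_integrable[OF open_\<Omega> bounded_\<Omega>] by simp
  have "II (\<lambda>z. (g z - k z) * \<phi> z) = 0" if \<phi>: "test_fun \<Omega> \<phi>" for \<phi>
  proof -
    have i: "si (\<lambda>z. g z * \<phi> z)" "si (\<lambda>z. k z * \<phi> z)"
      using assms L2_test_fun[OF open_\<Omega> \<phi>, of "[]"] by (auto intro!: L2_mult_integrable)
    have "II (\<lambda>z. g z * \<phi> z) = II (\<lambda>z. k z * \<phi> z)"
      using assms(2,4) \<phi> unfolding is_weak_deriv_def by simp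
    then show ?thesis using set_integral_diff(2)[OF i] by (simp add: algebra_simps)
  qed
  from fundamental_lemma[OF open_\<Omega> si this] show ?thesis by simp
qed

lemma H2_L2: "H2 \<Omega> w \<Longrightarrow> L2 \<Omega> w" by (simp add: H2_def)

lemma wd_weak_deriv:
  assumes "H2 \<Omega> w" "length bs \<le> 2"
  shows "L2 \<Omega> (wd \<Omega> bs w)" "is_weak_deriv \<Omega> bs w (wd \<Omega> bs w)"
proof -
  have "\<exists>g. L2 \<Omega> g \<and> is_weak_deriv \<Omega> bs w g" using assms by (simp add: H2_def)
  from someI_ex[OF this] show "L2 \<Omega> (wd \<Omega> bs w)" "is_weak_deriv \<Omega> bs w (wd \<Omega> bs w)"
    by (simp_all add: wd_def)
qed

text \<open>\<open>wd\<close> is an arbitrary choice among the weak derivatives; computations with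
  it go through this uniqueness and hold almost everywhere only.\<close>

lemma wd_eqI:
  assumes "L2 \<Omega> g" "is_weak_deriv \<Omega> bs w g"
  shows "AE z in lebesgue. z \<in> \<Omega> \<longrightarrow> wd \<Omega> bs w z = g z"
proof -
  have "\<exists>g. L2 \<Omega> g \<and> is_weak_deriv \<Omega> bs w g" using assms by blast
  from someI_ex[OF this] show ?thesis
    using weak_deriv_unique[OF _ _ assms] by (simp add: wd_def)
qed

lemma is_weak_deriv_lincomb:
  assumes "L2 \<Omega> u" "L2 \<Omega> v" "L2 \<Omega> g" "L2 \<Omega> k" "is_weak_deriv \<Omega> bs u g" "is_weak_deriv \<Omega> bs v k"
  shows "is_weak_deriv \<Omega> bs (\<lambda>z. c * u z + d * v z) (\<lambda>z. c * g z + d * k z)"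
  unfolding is_weak_deriv_def
proof (intro allI impI)
  fix \<phi> assume \<phi>: "test_fun \<Omega> \<phi>"
  note t = L2_test_fun[OF open_\<Omega> \<phi>]
  have "II (\<lambda>z. (c * u z + d * v z) * pds bs \<phi> z) = c * II (\<lambda>z. u z * pds bs \<phi> z) + d * II (\<lambda>z. v z * pds bs \<phi> z)"
    using set_integral_add(2)[OF set_integrable_mult_right[of c lebesgue \<Omega>, OF L2_mult_integrable[OF assms(1) t]]
        set_integrable_mult_right[of d lebesgue \<Omega>, OF L2_mult_integrable[OF assms(2) t]]]
    by (simp add: algebra_simps)
  moreover have "II (\<lambda>z. (c * g z + d * k z) * \<phi> z) = c * II (\<lambda>z. g z * \<phi> z) + d * II (\<lambda>z. k z * \<phi> z)"
    using set_integral_add(2)[OF set_integrable_mult_right[of c lebesgue \<Omega>, OF L2_mult_integrable[OF assms(3) t[of "[]"]]]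
        set_integrable_mult_right[of d lebesgue \<Omega>, OF L2_mult_integrable[OF assms(4) t[of "[]"]]]]
    by (simp add: algebra_simps)
  ultimately show "II (\<lambda>z. (c * u z + d * v z) * pds bs \<phi> z) = (- 1) ^ length bs * II (\<lambda>z. (c * g z + d * k z) * \<phi> z)"
    using assms(5,6) \<phi> unfolding is_weak_deriv_def by (simp add: algebra_simps)
qed

lemma H2_lincomb:
  assumes "H2 \<Omega> u" "H2 \<Omega> v"
  shows "H2 \<Omega> (\<lambda>z. c * u z + d * v z)"
  unfolding H2_def
proof (intro conjI allI impI)
  show "L2 \<Omega> (\<lambda>z. c * u z + d * v z)" using assms by (simp add: H2_def L2_lincomb)
  fix bs :: "bool list" assume l: "length bs \<le> 2"
  show "\<exists>g. L2 \<Omega> g \<and> is_weak_deriv \<Omega> bs (\<lambda>z. c * u z + d * v z) g"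
    using is_weak_deriv_lincomb[OF H2_L2[OF assms(1)] H2_L2[OF assms(2)] wd_weak_deriv(1)[OF assms(1) l]
        wd_weak_deriv(1)[OF assms(2) l] wd_weak_deriv(2)[OF assms(1) l] wd_weak_deriv(2)[OF assms(2) l]]
      L2_lincomb[OF wd_weak_deriv(1)[OF assms(1) l] wd_weak_deriv(1)[OF assms(2) l]] by blast
qed

lemma wd_lincomb:
  assumes "H2 \<Omega> u" "H2 \<Omega> v" "length bs \<le> 2"
  shows "AE z in lebesgue. z \<in> \<Omega> \<longrightarrow> wd \<Omega> bs (\<lambda>z. c * u z + d * v z) z = c * wd \<Omega> bs u z + d * wd \<Omega> bs v z"
  by (rule wd_eqI)
    (intro is_weak_deriv_lincomb L2_lincomb H2_L2[OF assms(1)] H2_L2[OF assms(2)]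
      wd_weak_deriv[OF assms(1,3)] wd_weak_deriv[OF assms(2,3)])+

lemma wd2_lincomb:
  assumes "H2 \<Omega> u" "H2 \<Omega> v"
  shows "AE z in lebesgue. z \<in> \<Omega> \<longrightarrow>
    dxx \<Omega> (\<lambda>z. c * u z + d * v z) z = c * dxx \<Omega> u z + d * dxx \<Omega> v z \<and>
    dxy \<Omega> (\<lambda>z. c * u z + d * v z) z = c * dxy \<Omega> u z + d * dxy \<Omega> v z \<and>
    dyx \<Omega> (\<lambda>z. c * u z + d * v z) z = c * dyx \<Omega> u z + d * dyx \<Omega> v z \<and>
    dyy \<Omega> (\<lambda>z. c * u z + d * v z) z = c * dyy \<Omega> u z + d * dyy \<Omega> v z"
proof -
  have l: "length [b, b'] \<le> 2" for b b' :: bool by simp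
  show ?thesis
    using wd_lincomb[OF assms l, of True True c d] wd_lincomb[OF assms l, of True False c d]
      wd_lincomb[OF assms l, of False True c d] wd_lincomb[OF assms l, of False False c d]
    by eventually_elim simp
qed

lemma H2_test_fun: "test_fun \<Omega> \<phi> \<Longrightarrow> H2 \<Omega> \<phi>"
  unfolding H2_def using L2_test_fun[OF open_\<Omega>, of \<phi>] L2_test_fun[OF open_\<Omega>, of \<phi> "[]"] is_weak_deriv_test_fun by auto

lemma wd_test_fun:
  assumes "test_fun \<Omega> \<phi>" "length bs \<le> 2"
  shows "AE z in lebesgue. z \<in> \<Omega> \<longrightarrow> wd \<Omega> bs \<phi> z = pds bs \<phi> z"
  using assms by (intro wd_eqI is_weak_deriv_test_fun L2_test_fun open_\<Omega>)

lemma II_nonneg: "(\<And>z. f z \<ge> 0) \<Longrightarrow> II f \<ge> 0"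
  unfolding set_lebesgue_integral_def by (intro integral_nonneg_AE) auto

lemma II_mono_AE:
  assumes "si f" "si g" "AE z in lebesgue. z \<in> \<Omega> \<longrightarrow> f z \<le> g z"
  shows "II f \<le> II g"
  unfolding set_lebesgue_integral_def
  by (rule integral_mono_AE)
    (use assms in \<open>auto simp: set_integrable_def indicator_def elim!: eventually_mono\<close>)

lemma L2_sq: "L2 \<Omega> f \<Longrightarrow> si (\<lambda>z. (f z)\<^sup>2)" by (simp add: L2_def)

lemma finite_short_lists: "finite {bs :: bool list. length bs \<le> 2}"
  using finite_lists_length_le[of "UNIV :: bool set" 2] by simp

lemma h2norm2_nonneg: "h2norm2 \<Omega> w \<ge> 0"
  unfolding h2norm2_def by (intro sum_nonneg II_nonneg) simp

text \<open>A crude substitute for the triangle inequality, enough to see that linear combinations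
  of null sequences are null.\<close>

lemma h2norm2_lincomb:
  assumes "H2 \<Omega> u" "H2 \<Omega> v"
  shows "h2norm2 \<Omega> (\<lambda>z. c * u z + d * v z) \<le> 2 * c\<^sup>2 * h2norm2 \<Omega> u + 2 * d\<^sup>2 * h2norm2 \<Omega> v"
proof -
  have "II (\<lambda>z. (wd \<Omega> bs (\<lambda>z. c * u z + d * v z) z)\<^sup>2) \<le>
      2 * c\<^sup>2 * II (\<lambda>z. (wd \<Omega> bs u z)\<^sup>2) + 2 * d\<^sup>2 * II (\<lambda>z. (wd \<Omega> bs v z)\<^sup>2)" if l: "length bs \<le> 2" for bs
  proof -
    have i: "si (\<lambda>z. 2 * c\<^sup>2 * (wd \<Omega> bs u z)\<^sup>2)" "si (\<lambda>z. 2 * d\<^sup>2 * (wd \<Omega> bs v z)\<^sup>2)"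
      using assms l by (auto intro!: L2_sq wd_weak_deriv set_integrable_mult_right)
    have "II (\<lambda>z. (wd \<Omega> bs (\<lambda>z. c * u z + d * v z) z)\<^sup>2) \<le> II (\<lambda>z. 2 * c\<^sup>2 * (wd \<Omega> bs u z)\<^sup>2 + 2 * d\<^sup>2 * (wd \<Omega> bs v z)\<^sup>2)"
    proof (rule II_mono_AE)
      show "si (\<lambda>z. (wd \<Omega> bs (\<lambda>z. c * u z + d * v z) z)\<^sup>2)"
        using assms l by (intro L2_sq wd_weak_deriv H2_lincomb)
      show "si (\<lambda>z. 2 * c\<^sup>2 * (wd \<Omega> bs u z)\<^sup>2 + 2 * d\<^sup>2 * (wd \<Omega> bs v z)\<^sup>2)"
        using i by (rule set_integral_add)
      have "(a + b)\<^sup>2 \<le> 2 * a\<^sup>2 + 2 * b\<^sup>2" for a b :: real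
        using sum_squares_bound[of a b] by (simp add: power2_sum)
      from this[of "c * _" "d * _"]
      show "AE z in lebesgue. z \<in> \<Omega> \<longrightarrow> (wd \<Omega> bs (\<lambda>z. c * u z + d * v z) z)\<^sup>2 \<le> 2 * c\<^sup>2 * (wd \<Omega> bs u z)\<^sup>2 + 2 * d\<^sup>2 * (wd \<Omega> bs v z)\<^sup>2"
        using wd_lincomb[OF assms l, of c d] by (auto elim!: eventually_mono simp: power_mult_distrib mult.assoc)
    qed
    also have "\<dots> = 2 * c\<^sup>2 * II (\<lambda>z. (wd \<Omega> bs u z)\<^sup>2) + 2 * d\<^sup>2 * II (\<lambda>z. (wd \<Omega> bs v z)\<^sup>2)"
      using set_integral_add(2)[OF i] by simp
    finally show ?thesis .
  qed
  then have "h2norm2 \<Omega> (\<lambda>z. c * u z + d * v z) \<le>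
    (\<Sum>bs\<in>{bs. length bs \<le> 2}. 2 * c\<^sup>2 * II (\<lambda>z. (wd \<Omega> bs u z)\<^sup>2) + 2 * d\<^sup>2 * II (\<lambda>z. (wd \<Omega> bs v z)\<^sup>2))"
    unfolding h2norm2_def by (intro sum_mono) auto
  then show ?thesis by (simp add: h2norm2_def sum.distrib sum_distrib_left)
qed

lemma H20_H2: "H20 \<Omega> w \<Longrightarrow> H2 \<Omega> w" by (simp add: H20_def)

lemma H20_lincomb:
  assumes "H20 \<Omega> u" "H20 \<Omega> v"
  shows "H20 \<Omega> (\<lambda>z. c * u z + d * v z)"
proof -
  obtain \<phi> \<psi> where \<phi>: "\<And>n. test_fun \<Omega> (\<phi> n)" "(\<lambda>n. h2norm2 \<Omega> (\<lambda>z. \<phi> n z - u z)) \<longlonglongrightarrow> 0"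
    and \<psi>: "\<And>n. test_fun \<Omega> (\<psi> n)" "(\<lambda>n. h2norm2 \<Omega> (\<lambda>z. \<psi> n z - v z)) \<longlonglongrightarrow> 0"
    using assms unfolding H20_def by blast
  define \<theta> where "\<theta> = (\<lambda>n z. c * \<phi> n z + d * \<psi> n z)"
  have 1: "test_fun \<Omega> (\<theta> n)" for n unfolding \<theta>_def by (intro test_fun_lincomb \<phi> \<psi>)
  have H: "H2 \<Omega> (\<lambda>z. \<phi> n z - u z)" "H2 \<Omega> (\<lambda>z. \<psi> n z - v z)" for n
    using H2_lincomb[OF H2_test_fun[OF \<phi>(1)] H20_H2[OF assms(1)], of 1 n "-1"]
      H2_lincomb[OF H2_test_fun[OF \<psi>(1)] H20_H2[OF assms(2)], of 1 n "-1"] by simp_all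
  have eq: "(\<lambda>z. \<theta> n z - (c * u z + d * v z)) = (\<lambda>z. c * (\<phi> n z - u z) + d * (\<psi> n z - v z))" for n
    by (auto simp: \<theta>_def algebra_simps)
  have "(\<lambda>n. h2norm2 \<Omega> (\<lambda>z. \<theta> n z - (c * u z + d * v z))) \<longlonglongrightarrow> 0"
  proof (rule tendsto_sandwich[OF _ _ tendsto_const])
    show "\<forall>\<^sub>F n in sequentially. 0 \<le> h2norm2 \<Omega> (\<lambda>z. \<theta> n z - (c * u z + d * v z))"
      by (simp add: h2norm2_nonneg)
    show "\<forall>\<^sub>F n in sequentially. h2norm2 \<Omega> (\<lambda>z. \<theta> n z - (c * u z + d * v z)) \<le>
       2 * c\<^sup>2 * h2norm2 \<Omega> (\<lambda>z. \<phi> n z - u z) + 2 * d\<^sup>2 * h2norm2 \<Omega> (\<lambda>z. \<psi> n z - v z)"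
      unfolding eq by (intro always_eventually allI h2norm2_lincomb H)
    have "(\<lambda>n. 2 * c\<^sup>2 * h2norm2 \<Omega> (\<lambda>z. \<phi> n z - u z) + 2 * d\<^sup>2 * h2norm2 \<Omega> (\<lambda>z. \<psi> n z - v z)) \<longlonglongrightarrow> 2 * c\<^sup>2 * 0 + 2 * d\<^sup>2 * 0"
      by (intro tendsto_intros \<phi> \<psi>)
    then show "(\<lambda>n. 2 * c\<^sup>2 * h2norm2 \<Omega> (\<lambda>z. \<phi> n z - u z) + 2 * d\<^sup>2 * h2norm2 \<Omega> (\<lambda>z. \<psi> n z - v z)) \<longlonglongrightarrow> 0" by simp
  qed
  with 1 H2_lincomb[OF assms[THEN H20_H2]] show ?thesis unfolding H20_def by blast
qed

lemma H20_diff: "H20 \<Omega> u \<Longrightarrow> H20 \<Omega> v \<Longrightarrow> H20 \<Omega> (\<lambda>z. u z - v z)"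
  using H20_lincomb[of u v 1 "-1"] by simp

lemma H20_test_fun:
  assumes "test_fun \<Omega> \<phi>" shows "H20 \<Omega> \<phi>"
proof -
  \<comment> \<open>The zero function is the combination with coefficients 0 and 0; the weak
    derivatives chosen for it vanish only almost everywhere, so the norm is not zero by mere
    unfolding.\<close>
  have "h2norm2 \<Omega> (\<lambda>z. \<phi> z - \<phi> z) \<le> 0"
    using h2norm2_lincomb[OF H2_test_fun[OF assms] H2_test_fun[OF assms], of 0 0] by simp
  then have "h2norm2 \<Omega> (\<lambda>z. \<phi> z - \<phi> z) = 0" using h2norm2_nonneg by (rule antisym)
  then show ?thesis unfolding H20_def using H2_test_fun[OF assms] assms
    by (intro conjI exI[of _ "\<lambda>_. \<phi>"]) auto
qed

section \<open>The energy form and its norm\<close>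

lemma aform_integrable:
  assumes "H2 \<Omega> u" "H2 \<Omega> v"
  shows "si (\<lambda>z. dxx \<Omega> u z * dxx \<Omega> v z + dxy \<Omega> u z * dxy \<Omega> v z +
      dyx \<Omega> u z * dyx \<Omega> v z + dyy \<Omega> u z * dyy \<Omega> v z)"
  using assms by (intro set_integral_add(1) L2_mult_integrable wd_weak_deriv) auto

lemma aform_sym: "aform \<Omega> u v = aform \<Omega> v u"
  by (simp add: aform_def mult.commute)

lemma aform_lincomb:
  assumes "H2 \<Omega> u" "H2 \<Omega> v" "H2 \<Omega> w"
  shows "aform \<Omega> (\<lambda>z. c * u z + d * v z) w = c * aform \<Omega> u w + d * aform \<Omega> v w"
proof -
  note i = set_integrable_mult_right[of c lebesgue \<Omega>, OF aform_integrable[OF assms(1,3)]]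
    set_integrable_mult_right[of d lebesgue \<Omega>, OF aform_integrable[OF assms(2,3)]]
  have "aform \<Omega> (\<lambda>z. c * u z + d * v z) w =
    II (\<lambda>z. c * (dxx \<Omega> u z * dxx \<Omega> w z + dxy \<Omega> u z * dxy \<Omega> w z + dyx \<Omega> u z * dyx \<Omega> w z + dyy \<Omega> u z * dyy \<Omega> w z) +
      d * (dxx \<Omega> v z * dxx \<Omega> w z + dxy \<Omega> v z * dxy \<Omega> w z + dyx \<Omega> v z * dyx \<Omega> w z + dyy \<Omega> v z * dyy \<Omega> w z))"
    unfolding aform_def
    by (rule set_integral_cong_AE'[OF aform_integrable[OF H2_lincomb[OF assms(1,2)] assms(3)] set_integral_add(1)[OF i]],
      use wd2_lincomb[OF assms(1,2), of c d] in \<open>eventually_elim, simp add: algebra_simps\<close>)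
  then show ?thesis using set_integral_add(2)[OF i] by (simp add: aform_def)
qed

lemma aform_diff:
  assumes "H2 \<Omega> u" "H2 \<Omega> v" "H2 \<Omega> w"
  shows "aform \<Omega> (\<lambda>z. u z - v z) w = aform \<Omega> u w - aform \<Omega> v w"
  using aform_lincomb[OF assms, of 1 "-1"] by simp

lemma aform_nonneg: "aform \<Omega> u u \<ge> 0"
  unfolding aform_def by (rule II_nonneg) simp

lemma tnorm_nonneg: "tnorm \<Omega> u \<ge> 0" by (simp add: tnorm_def aform_nonneg)

lemma tnorm_sq: "(tnorm \<Omega> u)\<^sup>2 = aform \<Omega> u u" by (simp add: tnorm_def aform_nonneg)

lemma aform_Cauchy_Schwarz:
  assumes "H2 \<Omega> u" "H2 \<Omega> v"
  shows "\<bar>aform \<Omega> u v\<bar> \<le> tnorm \<Omega> u * tnorm \<Omega> v"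
proof -
  \<comment> \<open>The values s = 1 and s = -1 give the two signs of the absolute value. Expanding
    a(w,w) for w = t u - s v yields the weighted bound.\<close>
  have *: "2 * (s * aform \<Omega> u v) \<le> 2 * tnorm \<Omega> u * tnorm \<Omega> v" if s: "s\<^sup>2 = 1" for s
  proof (rule mult_le_if_weighted)
    fix t :: real assume t: "t > 0"
    define w where "w = (\<lambda>z. t * u z + (- s) * v z)"
    have w: "H2 \<Omega> w" unfolding w_def by (intro H2_lincomb assms)
    have 1: "aform \<Omega> w x = t * aform \<Omega> u x + (- s) * aform \<Omega> v x" if "H2 \<Omega> x" for x
      unfolding w_def by (rule aform_lincomb[OF assms that])
    have "0 \<le> aform \<Omega> w w" by (rule aform_nonneg)
    also have "\<dots> = t * aform \<Omega> w u + (- s) * aform \<Omega> w v"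
      using 1[OF w] aform_sym[of w u] aform_sym[of w v] by simp
    also have "\<dots> = t * (t * aform \<Omega> u u - 2 * s * aform \<Omega> u v) + s\<^sup>2 * aform \<Omega> v v"
    proof -
      have "aform \<Omega> w u = t * aform \<Omega> u u + (- s) * aform \<Omega> u v" "aform \<Omega> w v = t * aform \<Omega> u v + (- s) * aform \<Omega> v v"
        using 1[OF assms(1)] 1[OF assms(2)] aform_sym[of u v] by simp_all
      then show ?thesis by (simp only:) (simp add: algebra_simps power2_eq_square)
    qed
    finally have "0 \<le> (t * (t * aform \<Omega> u u - 2 * s * aform \<Omega> u v) + aform \<Omega> v v) / t" using t s by simp
    also have "\<dots> = t * aform \<Omega> u u - 2 * s * aform \<Omega> u v + aform \<Omega> v v / t" using t by (simp add: field_simps)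
    finally show "2 * (s * aform \<Omega> u v) \<le> t * (tnorm \<Omega> u)\<^sup>2 + (tnorm \<Omega> v)\<^sup>2 / t" by (simp add: tnorm_sq)
  qed (simp_all add: tnorm_nonneg)
  from *[of 1] *[of "-1"] show ?thesis by (simp add: abs_le_iff)
qed

lemma tnorm_le_h2norm2:
  assumes "H2 \<Omega> w" shows "(tnorm \<Omega> w)\<^sup>2 \<le> h2norm2 \<Omega> w"
proof -
  let ?A = "{[True,True],[True,False],[False,True],[False,False]} :: bool list set"
  have "h2norm2 \<Omega> w \<ge> (\<Sum>bs\<in>?A. II (\<lambda>z. (wd \<Omega> bs w z)\<^sup>2))"
    unfolding h2norm2_def by (intro sum_mono2 finite_short_lists II_nonneg) auto
  moreover have "(\<Sum>bs\<in>?A. II (\<lambda>z. (wd \<Omega> bs w z)\<^sup>2)) = aform \<Omega> w w"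
  proof -
    have i: "si (\<lambda>z. (dxx \<Omega> w z)\<^sup>2)" "si (\<lambda>z. (dxy \<Omega> w z)\<^sup>2)" "si (\<lambda>z. (dyx \<Omega> w z)\<^sup>2)" "si (\<lambda>z. (dyy \<Omega> w z)\<^sup>2)"
      using assms by (auto intro!: L2_sq wd_weak_deriv)
    note a = set_integral_add(1)[OF i(1,2)]
    show ?thesis
      using set_integral_add(2)[OF set_integral_add(1)[OF a i(3)] i(4)] set_integral_add(2)[OF a i(3)] set_integral_add(2)[OF i(1,2)]
      unfolding aform_def power2_eq_square[symmetric] by simp
  qed
  ultimately show ?thesis by (simp add: tnorm_sq)
qed

lemma test_fun_approx:
  assumes "H20 \<Omega> w"
  obtains \<phi> where "\<And>n. test_fun \<Omega> (\<phi> n)" "(\<lambda>n. tnorm \<Omega> (\<lambda>z. \<phi> n z - w z)) \<longlonglongrightarrow> 0"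
proof -
  obtain \<phi> where \<phi>: "\<And>n. test_fun \<Omega> (\<phi> n)" "(\<lambda>n. h2norm2 \<Omega> (\<lambda>z. \<phi> n z - w z)) \<longlonglongrightarrow> 0"
    using assms unfolding H20_def by blast
  have H: "H2 \<Omega> (\<lambda>z. \<phi> n z - w z)" for n
    using H2_lincomb[OF H2_test_fun[OF \<phi>(1)] H20_H2[OF assms], of 1 n "-1"] by simp
  have "(\<lambda>n. tnorm \<Omega> (\<lambda>z. \<phi> n z - w z)) \<longlonglongrightarrow> 0"
  proof (rule tendsto_sandwich[OF _ _ tendsto_const])
    show "\<forall>\<^sub>F n in sequentially. 0 \<le> tnorm \<Omega> (\<lambda>z. \<phi> n z - w z)" by (simp add: tnorm_nonneg)
    show "\<forall>\<^sub>F n in sequentially. tnorm \<Omega> (\<lambda>z. \<phi> n z - w z) \<le> sqrt (h2norm2 \<Omega> (\<lambda>z. \<phi> n z - w z))"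
      using tnorm_le_h2norm2[OF H] by (simp add: real_le_rsqrt)
    show "(\<lambda>n. sqrt (h2norm2 \<Omega> (\<lambda>z. \<phi> n z - w z))) \<longlonglongrightarrow> 0" using tendsto_real_sqrt[OF \<phi>(2)] by simp
  qed
  with \<phi>(1) show ?thesis by (rule that)
qed

lemma vk_bracket_integrable:
  assumes "H2 \<Omega> u" "H2 \<Omega> v"
  shows "si (vk_bracket \<Omega> u v)"
proof -
  have m: "si (\<lambda>z. wd \<Omega> bs u z * wd \<Omega> cs v z)" if "length bs \<le> 2" "length cs \<le> 2" for bs cs
    by (rule L2_mult_integrable[OF wd_weak_deriv(1)[OF assms(1) that(1)] wd_weak_deriv(1)[OF assms(2) that(2)]])
  show ?thesis unfolding vk_bracket_def mult.assoc
    by (rule set_integral_diff(1)[OF set_integral_add(1)[OF m m] set_integrable_mult_right[OF m]]) simp_all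
qed

lemma vk_bracket_abs_le:
  assumes "t > 0"
  shows "\<bar>vk_bracket \<Omega> u v z\<bar> \<le>
    t * (dxx \<Omega> u z * dxx \<Omega> u z + dxy \<Omega> u z * dxy \<Omega> u z + dyx \<Omega> u z * dyx \<Omega> u z + dyy \<Omega> u z * dyy \<Omega> u z) +
    (1 / t) * (dxx \<Omega> v z * dxx \<Omega> v z + dxy \<Omega> v z * dxy \<Omega> v z + dyx \<Omega> v z * dyx \<Omega> v z + dyy \<Omega> v z * dyy \<Omega> v z)"
proof -
  have *: "2 * \<bar>a * b\<bar> \<le> t * (a * a) + (1 / t) * (b * b)" for a b :: real
  proof -
    have "0 \<le> (t * \<bar>a\<bar> - \<bar>b\<bar>)\<^sup>2 / t" using assms by simp
    also have "\<dots> = t * (a * a) + (1 / t) * (b * b) - 2 * \<bar>a * b\<bar>"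
      using assms by (simp add: power2_eq_square field_simps abs_mult)
    finally show ?thesis by simp
  qed
  have "0 \<le> t * (dyx \<Omega> u z * dyx \<Omega> u z)" "0 \<le> (1 / t) * (dyx \<Omega> v z * dyx \<Omega> v z)"
     "0 \<le> t * (dxx \<Omega> u z * dxx \<Omega> u z)" "0 \<le> (1 / t) * (dxx \<Omega> v z * dxx \<Omega> v z)"
     "0 \<le> t * (dyy \<Omega> u z * dyy \<Omega> u z)" "0 \<le> (1 / t) * (dyy \<Omega> v z * dyy \<Omega> v z)"
    using assms by simp_all
  then show ?thesis
    using *[of "dxx \<Omega> u z" "dyy \<Omega> v z"] *[of "dyy \<Omega> u z" "dxx \<Omega> v z"] *[of "dxy \<Omega> u z" "dxy \<Omega> v z"]
    unfolding vk_bracket_def distrib_left by (simp only: mult.assoc)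
qed

lemma bform_sym12: "bform \<Omega> u v w = bform \<Omega> v u w"
  by (simp add: bform_def l2ip_def vk_bracket_def algebra_simps)

end

section \<open>The trilinear form and the Sobolev constant\<close>

locale sobolev_domain = bounded_domain +
  fixes CS
  assumes CS: "sobolev_const \<Omega> CS"
begin

text \<open>\<open>sobolev_const\<close> fixes no sign of \<open>CS\<close>; the absolute value
  makes the bound monotone under products, and \<open>CS\<^sup>2\<close> in the smallness condition
  does not notice it.\<close>

lemma sobolev_bound:
  assumes "H20 \<Omega> w"
  shows "AE z in lebesgue. z \<in> \<Omega> \<longrightarrow> \<bar>w z\<bar> \<le> \<bar>CS\<bar> * tnorm \<Omega> w"
proof -
  have "CS * tnorm \<Omega> w \<le> \<bar>CS\<bar> * tnorm \<Omega> w" by (rule mult_right_mono[OF abs_ge_self tnorm_nonneg])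
  moreover have "AE z in lebesgue. z \<in> \<Omega> \<longrightarrow> \<bar>w z\<bar> \<le> CS * tnorm \<Omega> w" using CS assms by (simp add: sobolev_const_def)
  ultimately show ?thesis by (auto elim!: eventually_mono intro: order_trans)
qed

text \<open>The bracket is a sum of products of square integrable functions, hence only integrable;
  the third factor has to be essentially bounded, and this is where the Sobolev constant
  enters.\<close>

lemma bform_integrable:
  assumes "H2 \<Omega> u" "H2 \<Omega> v" "H20 \<Omega> w"
  shows "si (\<lambda>z. vk_bracket \<Omega> u v z * w z)"
  unfolding set_integrable_def
proof (rule Bochner_Integration.integrable_bound)
  show "integrable lebesgue (\<lambda>z. (\<bar>CS\<bar> * tnorm \<Omega> w) * (indicator \<Omega> z *\<^sub>R vk_bracket \<Omega> u v z))"
    using vk_bracket_integrable[OF assms(1,2)] by (simp add: set_integrable_def)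
  have "(\<lambda>z. (indicator \<Omega> z *\<^sub>R vk_bracket \<Omega> u v z) * (indicator \<Omega> z *\<^sub>R w z)) \<in> borel_measurable lebesgue"
    using vk_bracket_integrable[OF assms(1,2)] H2_L2[OF H20_H2[OF assms(3)]]
    by (intro borel_measurable_times) (auto simp: set_integrable_def L2_def set_borel_measurable_def borel_measurable_integrable)
  then show "(\<lambda>z. indicator \<Omega> z *\<^sub>R (vk_bracket \<Omega> u v z * w z)) \<in> borel_measurable lebesgue"
    by (rule measurable_cong[THEN iffD1, rotated]) (auto simp: indicator_def)
  show "AE z in lebesgue. norm (indicator \<Omega> z *\<^sub>R (vk_bracket \<Omega> u v z * w z)) \<le>
    norm ((\<bar>CS\<bar> * tnorm \<Omega> w) * (indicator \<Omega> z *\<^sub>R vk_bracket \<Omega> u v z))"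
    using sobolev_bound[OF assms(3)] 
  proof eventually_elim
    case (elim z)
    then have "z \<in> \<Omega> \<Longrightarrow> \<bar>vk_bracket \<Omega> u v z\<bar> * \<bar>w z\<bar> \<le> \<bar>vk_bracket \<Omega> u v z\<bar> * (\<bar>CS\<bar> * tnorm \<Omega> w)"
      by (intro mult_left_mono) auto
    then show ?case using tnorm_nonneg[of w] by (auto simp: indicator_def abs_mult mult.commute)
  qed
qed

text \<open>The constant is exactly |CS|: the factor 1/2 in b cancels the factor 2 in the L1 bound
  of the bracket. The uniqueness threshold depends on this.\<close>

lemma bform_bound:
  assumes "H2 \<Omega> u" "H2 \<Omega> v" "H20 \<Omega> w"
  shows "\<bar>bform \<Omega> u v w\<bar> \<le> \<bar>CS\<bar> * tnorm \<Omega> u * tnorm \<Omega> v * tnorm \<Omega> w"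
proof -
  let ?B = "\<bar>CS\<bar> * tnorm \<Omega> w"
  have B: "?B \<ge> 0" by (simp add: tnorm_nonneg)
  note bi = bform_integrable[OF assms]
  have bb: "II (\<lambda>z. \<bar>vk_bracket \<Omega> u v z\<bar>) \<le> 2 * tnorm \<Omega> u * tnorm \<Omega> v"
  proof (rule mult_le_if_weighted)
    fix t :: real assume t: "t > 0"
    note i = set_integrable_mult_right[of t lebesgue \<Omega>, OF aform_integrable[OF assms(1,1)]]
      set_integrable_mult_right[of "1/t" lebesgue \<Omega>, OF aform_integrable[OF assms(2,2)]]
    have "II (\<lambda>z. \<bar>vk_bracket \<Omega> u v z\<bar>) \<le> t * aform \<Omega> u u + (1 / t) * aform \<Omega> v v"
      unfolding aform_def set_integral_mult_right[symmetric] set_integral_add(2)[OF i, symmetric]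
      by (intro II_mono_AE set_integrable_abs vk_bracket_integrable assms set_integral_add(1) i)
        (use vk_bracket_abs_le[OF t, of u v] in auto)
    then show "II (\<lambda>z. \<bar>vk_bracket \<Omega> u v z\<bar>) \<le> t * (tnorm \<Omega> u)\<^sup>2 + (tnorm \<Omega> v)\<^sup>2 / t"
      by (simp add: tnorm_sq)
  qed (simp_all add: tnorm_nonneg)
  have "\<bar>II (\<lambda>z. vk_bracket \<Omega> u v z * w z)\<bar> \<le> II (\<lambda>z. \<bar>vk_bracket \<Omega> u v z * w z\<bar>)"
    using integral_norm_bound[of lebesgue "\<lambda>z. indicator \<Omega> z *\<^sub>R (vk_bracket \<Omega> u v z * w z)"]
    by (simp add: set_lebesgue_integral_def abs_mult)
  also have "\<dots> \<le> II (\<lambda>z. ?B * \<bar>vk_bracket \<Omega> u v z\<bar>)"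
  proof (rule II_mono_AE)
    show "AE z in lebesgue. z \<in> \<Omega> \<longrightarrow> \<bar>vk_bracket \<Omega> u v z * w z\<bar> \<le> ?B * \<bar>vk_bracket \<Omega> u v z\<bar>"
      using sobolev_bound[OF assms(3)]
      by (auto elim!: eventually_mono simp: abs_mult mult.commute[of "\<bar>vk_bracket \<Omega> u v _\<bar>"] intro!: mult_right_mono)
  qed (use bi vk_bracket_integrable[OF assms(1,2)] in \<open>auto intro!: set_integrable_abs set_integrable_mult_right\<close>)
  also have "\<dots> = ?B * II (\<lambda>z. \<bar>vk_bracket \<Omega> u v z\<bar>)" by simp
  also have "\<dots> \<le> ?B * (2 * tnorm \<Omega> u * tnorm \<Omega> v)" by (intro mult_left_mono bb B)
  finally show ?thesis by (simp add: bform_def l2ip_def abs_mult algebra_simps)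
qed

lemma bform_lincomb1:
  assumes "H2 \<Omega> u" "H2 \<Omega> v" "H2 \<Omega> u'" "H20 \<Omega> w"
  shows "bform \<Omega> (\<lambda>z. c * u z + d * v z) u' w = c * bform \<Omega> u u' w + d * bform \<Omega> v u' w"
proof -
  note i = set_integrable_mult_right[of c lebesgue \<Omega>, OF bform_integrable[OF assms(1,3,4)]]
    set_integrable_mult_right[of d lebesgue \<Omega>, OF bform_integrable[OF assms(2,3,4)]]
  have "II (\<lambda>z. vk_bracket \<Omega> (\<lambda>z. c * u z + d * v z) u' z * w z) =
    II (\<lambda>z. c * (vk_bracket \<Omega> u u' z * w z) + d * (vk_bracket \<Omega> v u' z * w z))"
    by (rule set_integral_cong_AE'[OF bform_integrable[OF H2_lincomb[OF assms(1,2)] assms(3,4)] set_integral_add(1)[OF i]],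
      use wd2_lincomb[OF assms(1,2), of c d] in \<open>eventually_elim, simp add: vk_bracket_def algebra_simps\<close>)
  then show ?thesis using set_integral_add(2)[OF i] by (simp add: bform_def l2ip_def algebra_simps)
qed

lemma bform_lincomb2:
  assumes "H2 \<Omega> u" "H2 \<Omega> v" "H2 \<Omega> u'" "H20 \<Omega> w"
  shows "bform \<Omega> u' (\<lambda>z. c * u z + d * v z) w = c * bform \<Omega> u' u w + d * bform \<Omega> u' v w"
  using bform_lincomb1[OF assms, of c d] by (simp add: bform_sym12)

lemma bform_lincomb3:
  assumes "H2 \<Omega> u" "H2 \<Omega> v" "H20 \<Omega> w" "H20 \<Omega> w'"
  shows "bform \<Omega> u v (\<lambda>z. c * w z + d * w' z) = c * bform \<Omega> u v w + d * bform \<Omega> u v w'"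
proof -
  note i = set_integrable_mult_right[of c lebesgue \<Omega>, OF bform_integrable[OF assms(1,2,3)]]
    set_integrable_mult_right[of d lebesgue \<Omega>, OF bform_integrable[OF assms(1,2,4)]]
  show ?thesis using set_integral_add(2)[OF i] by (simp add: bform_def l2ip_def algebra_simps)
qed

lemma bform_diff:
  assumes "H2 \<Omega> u" "H2 \<Omega> v" "H2 \<Omega> u'" "H20 \<Omega> w" "H20 \<Omega> w'"
  shows "bform \<Omega> (\<lambda>z. u z - v z) u' w = bform \<Omega> u u' w - bform \<Omega> v u' w"
    and "bform \<Omega> u' (\<lambda>z. u z - v z) w = bform \<Omega> u' u w - bform \<Omega> u' v w"
    and "bform \<Omega> u v (\<lambda>z. w z - w' z) = bform \<Omega> u v w - bform \<Omega> u v w'"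
  using bform_lincomb1[OF assms(1-4), of 1 "-1"] bform_lincomb2[OF assms(1-4), of 1 "-1"]
    bform_lincomb3[OF assms(1,2,4,5), of 1 "-1"] by simp_all

end

section \<open>Symmetry and continuity of \<open>b\<close>\<close>

lemma smooth2_pds: "smooth2 f \<Longrightarrow> smooth2 (pds bs f)"
  unfolding smooth2_def
proof (intro allI)
  fix cs x y
  assume a: "\<forall>bs. continuous_on UNIV (pds bs f) \<and> (\<forall>x y. (\<lambda>t. pds bs f (t, y)) differentiable (at x) \<and> (\<lambda>t. pds bs f (x, t)) differentiable (at y))"
  have "pds cs (pds bs f) = pds (cs @ bs) f" by (induction cs) auto
  then show "continuous_on UNIV (pds cs (pds bs f)) \<and> (\<forall>x y. (\<lambda>t. pds cs (pds bs f) (t, y)) differentiable (at x) \<and> (\<lambda>t. pds cs (pds bs f) (x, t)) differentiable (at y))"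
    using a by simp
qed

text \<open>The difference of the two integrands is the divergence of
  \<open>\<phi> (f\<^sub>y\<^sub>y g\<^sub>x - f\<^sub>x\<^sub>y g\<^sub>y, f\<^sub>x\<^sub>x g\<^sub>y - f\<^sub>x\<^sub>y g\<^sub>x)\<close>; the right-hand side is symmetric in \<open>g\<close> and \<open>\<phi>\<close>.\<close>

lemma bracket_by_parts:
  assumes f: "smooth2 f" and g: "smooth2 g" and \<phi>: "test_fun \<Omega> \<phi>"
  shows "(\<integral>z. (px (px f) z * py (py g) z + py (py f) z * px (px g) z - 2 * px (py f) z * px (py g) z) * \<phi> z \<partial>lborel) =
    - (\<integral>z. px (px f) z * (py \<phi> z * py g z) + py (py f) z * (px \<phi> z * px g z)
         - px (py f) z * (px \<phi> z * py g z + py \<phi> z * px g z) \<partial>lborel)"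
    (is "integral\<^sup>L _ ?B = - integral\<^sup>L _ ?T")
proof -
  note c = smooth2_C1
  have Cf: "C1 (px (px f))" "C1 (py (py f))" "C1 (px (py f))"
    using c[OF f, of "[True,True]"] c[OF f, of "[False,False]"] c[OF f, of "[True,False]"] by simp_all
  have Cg: "C1 (px g)" "C1 (py g)" using c[OF g, of "[True]"] c[OF g, of "[False]"] by simp_all
  have C\<phi>: "C1 \<phi>" using test_fun_C1[OF \<phi>, of "[]"] by simp
  have xy: "py (px h) = px (py h)" if "smooth2 h" for h using mixed_partials[OF that] by auto
  define P where "P = (\<lambda>z. \<phi> z * (1 * (py (py f) z * px g z) + (-1) * (px (py f) z * py g z)))"
  define Q where "Q = (\<lambda>z. \<phi> z * (1 * (px (px f) z * py g z) + (-1) * (px (py f) z * px g z)))"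
  have C: "C1 P" "C1 Q" unfolding P_def Q_def by (intro C1_mult(1) C1_lincomb(1) Cf Cg C\<phi>)+
  have b: "bounded {z. P z \<noteq> 0}" "bounded {z. Q z \<noteq> 0}"
    unfolding P_def Q_def using test_fun_pds_bounded_support[OF \<phi>, of "[]"]
    by (intro bounded_support_mult disjI1; simp)+
  note i = integral_partials_zero[OF C(1) b(1)] integral_partials_zero[OF C(2) b(2)]
  have pP: "px P = (\<lambda>z. \<phi> z * (1 * (py (py f) z * px (px g) z + px (py (py f)) z * px g z) + (-1) * (px (py f) z * px (py g) z + px (px (py f)) z * py g z))
      + px \<phi> z * (1 * (py (py f) z * px g z) + (-1) * (px (py f) z * py g z)))"
    unfolding P_def by (simp only: px_mult px_lincomb C1_mult(1) C1_lincomb(1) Cf Cg C\<phi>)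
  have pQ: "py Q = (\<lambda>z. \<phi> z * (1 * (px (px f) z * py (py g) z + py (px (px f)) z * py g z) + (-1) * (px (py f) z * py (px g) z + py (px (py f)) z * px g z))
      + py \<phi> z * (1 * (px (px f) z * py g z) + (-1) * (px (py f) z * px g z)))"
    unfolding Q_def by (simp only: py_mult py_lincomb C1_mult(1) C1_lincomb(1) Cf Cg C\<phi>)
  have sp: "smooth2 (px f)" "smooth2 (py f)" using smooth2_pds[OF f, of "[True]"] smooth2_pds[OF f, of "[False]"] by simp_all
  \<comment> \<open>With mixed derivatives in one normal form, the third derivatives of f cancel
    between \<open>px P\<close> and \<open>py Q\<close>.\<close>
  have k: "py (px (py f)) = px (py (py f))" "py (px (px f)) = px (px (py f))" "py (px g) = px (py g)"
    using xy[OF sp(2)] xy[OF sp(1)] xy[OF f] xy[OF g] by simp_all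
  have eq: "px P z + py Q z = ?B z + ?T z" for z
    unfolding pP pQ k by (simp add: algebra_simps)
  have cont: "continuous_on UNIV F" if "C1 F" for F using that by (simp add: C1_def)
  have c\<phi>: "continuous_on UNIV (px \<phi>)" "continuous_on UNIV (py \<phi>)" using C\<phi> by (simp_all add: C1_def)
  have cg2: "continuous_on UNIV (px (px g))" "continuous_on UNIV (py (py g))" "continuous_on UNIV (px (py g))"
    using c[OF g, of "[True,True]"] c[OF g, of "[False,False]"] c[OF g, of "[True,False]"] by (simp_all add: C1_def)
  have bs: "bounded {z. \<phi> z \<noteq> 0}" using test_fun_pds_bounded_support[OF \<phi>, of "[]"] by simp
  have iB: "integrable lborel ?B"
    by (rule bounded_support_integrable[OF _ bounded_support_mult[OF disjI2[OF bs]]])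
      (intro continuous_intros cont Cf C\<phi> cg2)
  have "integrable lborel (\<lambda>z. px P z + py Q z)" by (rule Bochner_Integration.integrable_add[OF i(1) i(6)])
  then have "integrable lborel (\<lambda>z. ?B z + ?T z)" unfolding eq .
  from Bochner_Integration.integrable_diff[OF this iB] have iT: "integrable lborel ?T" by simp
  have "(\<integral>z. px P z + py Q z \<partial>lborel) = 0" using i by simp
  then show ?thesis unfolding eq using iB iT by simp
qed

context bounded_domain
begin

lemma wd2_test_fun:
  assumes "test_fun \<Omega> \<phi>"
  shows "AE z in lebesgue. z \<in> \<Omega> \<longrightarrow> dxx \<Omega> \<phi> z = px (px \<phi>) z \<and> dxy \<Omega> \<phi> z = px (py \<phi>) z \<and>
     dyx \<Omega> \<phi> z = py (px \<phi>) z \<and> dyy \<Omega> \<phi> z = py (py \<phi>) z"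
proof -
  have l: "length [b, b'] \<le> 2" for b b' :: bool by simp
  show ?thesis
    using wd_test_fun[OF assms l, of True True] wd_test_fun[OF assms l, of True False]
      wd_test_fun[OF assms l, of False True] wd_test_fun[OF assms l, of False False]
    by eventually_elim simp
qed

lemma test_fun_continuous2:
  assumes "test_fun \<Omega> \<phi>"
  shows "continuous_on UNIV \<phi>" "continuous_on UNIV (px \<phi>)" "continuous_on UNIV (py \<phi>)"
    "continuous_on UNIV (px (px \<phi>))" "continuous_on UNIV (px (py \<phi>))" "continuous_on UNIV (py (px \<phi>))" "continuous_on UNIV (py (py \<phi>))"
  using test_fun_pds_continuous[OF assms, of "[]"] test_fun_pds_continuous[OF assms, of "[True]"] test_fun_pds_continuous[OF assms, of "[False]"]
    test_fun_pds_continuous[OF assms, of "[True,True]"] test_fun_pds_continuous[OF assms, of "[True,False]"]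
    test_fun_pds_continuous[OF assms, of "[False,True]"] test_fun_pds_continuous[OF assms, of "[False,False]"]
  by simp_all

lemma test_fun_outside2:
  assumes "test_fun \<Omega> \<phi>" "z \<notin> \<Omega>"
  shows "\<phi> z = 0" "px \<phi> z = 0" "py \<phi> z = 0" "px (px \<phi>) z = 0" "px (py \<phi>) z = 0" "py (px \<phi>) z = 0" "py (py \<phi>) z = 0"
  using test_fun_pds_outside[OF assms, of "[]"] test_fun_pds_outside[OF assms, of "[True]"] test_fun_pds_outside[OF assms, of "[False]"]
    test_fun_pds_outside[OF assms, of "[True,True]"] test_fun_pds_outside[OF assms, of "[True,False]"]
    test_fun_pds_outside[OF assms, of "[False,True]"] test_fun_pds_outside[OF assms, of "[False,False]"]
  by simp_all

lemma integrable_in_\<Omega>: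
  fixes G :: "pt \<Rightarrow> real"
  assumes "continuous_on UNIV G" "\<And>z. z \<notin> \<Omega> \<Longrightarrow> G z = 0"
  shows "integrable lborel G" "si G" "II G = (\<integral>z. G z \<partial>lborel)"
proof -
  have b: "bounded {z. G z \<noteq> 0}" by (rule bounded_subset[OF bounded_\<Omega>]) (use assms(2) in auto)
  show "integrable lborel G" by (rule bounded_support_integrable[OF assms(1) b])
  show "si G" by (rule set_integrable_bounded_support[OF open_\<Omega> assms(1) b])
  show "II G = (\<integral>z. G z \<partial>lborel)"
    by (rule set_integral_lborel[OF borel_measurable_continuous_onI[OF assms(1)] assms(2)])
qed

lemma aform_test_fun:
  assumes u: "test_fun \<Omega> u"
  shows "aform \<Omega> u u = (\<integral>z. (px (px u) z)\<^sup>2 + (px (py u) z)\<^sup>2 + (py (px u) z)\<^sup>2 + (py (py u) z)\<^sup>2 \<partial>lborel)" (is "_ = integral\<^sup>L _ ?G")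
proof -
  have c: "continuous_on UNIV ?G" by (intro continuous_intros test_fun_continuous2[OF u])
  have z: "?G z = 0" if "z \<notin> \<Omega>" for z using test_fun_outside2[OF u that] by simp
  have "aform \<Omega> u u = II ?G" unfolding aform_def
    by (rule set_integral_cong_AE'[OF aform_integrable[OF H2_test_fun[OF u] H2_test_fun[OF u]] integrable_in_\<Omega>(2)[OF c z]])
      (simp, use wd2_test_fun[OF u] in \<open>eventually_elim, simp add: power2_eq_square\<close>)
  then show ?thesis using integrable_in_\<Omega>(3)[OF c z] by simp
qed

end

context sobolev_domain
begin

text \<open>Second derivatives survive on the first argument only, and the other two enter
  symmetrically through their gradients. The symmetry proves \<open>bform_sym23\<close>; the absence
  of second derivatives of v and w underlies the gradient estimates.\<close>

lemma bform_test_fun: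
  assumes u: "test_fun \<Omega> u" and v: "test_fun \<Omega> v" and w: "test_fun \<Omega> w"
  shows "bform \<Omega> u v w = (1/2) * (\<integral>z. px (px u) z * (py w z * py v z) + py (py u) z * (px w z * px v z)
         - px (py u) z * (px w z * py v z + py w z * px v z) \<partial>lborel)"
proof -
  let ?G = "\<lambda>z. (px (px u) z * py (py v) z + py (py u) z * px (px v) z - 2 * px (py u) z * px (py v) z) * w z"
  have c: "continuous_on UNIV ?G" by (intro continuous_intros test_fun_continuous2 u v w)
  have z: "?G z = 0" if "z \<notin> \<Omega>" for z using test_fun_outside2[OF w that] by simp
  have "II (\<lambda>z. vk_bracket \<Omega> u v z * w z) = II ?G"
    by (rule set_integral_cong_AE'[OF bform_integrable[OF H2_test_fun[OF u] H2_test_fun[OF v] H20_test_fun[OF w]] integrable_in_\<Omega>(2)[OF c z]])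
      (simp, use wd2_test_fun[OF u] wd2_test_fun[OF v] in \<open>eventually_elim, simp add: vk_bracket_def\<close>)
  then show ?thesis unfolding bform_def l2ip_def
    using integrable_in_\<Omega>(3)[OF c z] bracket_by_parts[OF test_fun_smooth2[OF u] test_fun_smooth2[OF v] w] by simp
qed

lemma tnorm_tendsto:
  assumes u: "H20 \<Omega> u" and \<phi>: "\<And>n. H20 \<Omega> (\<phi> n)" "(\<lambda>n. tnorm \<Omega> (\<lambda>z. \<phi> n z - u z)) \<longlonglongrightarrow> 0"
  shows "(\<lambda>n. tnorm \<Omega> (\<phi> n)) \<longlonglongrightarrow> tnorm \<Omega> u"
proof -
  have H: "H2 \<Omega> (\<lambda>z. \<phi> n z - u z)" "H2 \<Omega> (\<phi> n)" "H2 \<Omega> u" for n using u \<phi> H20_diff H20_H2 by blast+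
  have "aform \<Omega> (\<phi> n) (\<phi> n) = (tnorm \<Omega> (\<lambda>z. \<phi> n z - u z))\<^sup>2 + 2 * aform \<Omega> (\<lambda>z. \<phi> n z - u z) u + aform \<Omega> u u" for n
    using aform_diff[OF H(2) H(3) H(1), of n n] aform_diff[OF H(2) H(3) H(3), of n] aform_diff[OF H(2) H(3) H(2), of n n]
      aform_sym[of "\<phi> n" "\<lambda>z. \<phi> n z - u z"] aform_sym[of u "\<lambda>z. \<phi> n z - u z"] aform_sym[of u "\<phi> n"]
    unfolding tnorm_sq by linarith
  moreover have "(\<lambda>n. aform \<Omega> (\<lambda>z. \<phi> n z - u z) u) \<longlonglongrightarrow> 0"
  proof (rule Lim_null_comparison)
    show "\<forall>\<^sub>F n in sequentially. norm (aform \<Omega> (\<lambda>z. \<phi> n z - u z) u) \<le> tnorm \<Omega> (\<lambda>z. \<phi> n z - u z) * tnorm \<Omega> u"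
      using aform_Cauchy_Schwarz[OF H(1,3)] by simp
    show "(\<lambda>n. tnorm \<Omega> (\<lambda>z. \<phi> n z - u z) * tnorm \<Omega> u) \<longlonglongrightarrow> 0" using tendsto_mult_left_zero[OF \<phi>(2)] .
  qed
  moreover have "(\<lambda>n. (tnorm \<Omega> (\<lambda>z. \<phi> n z - u z))\<^sup>2) \<longlonglongrightarrow> 0" using tendsto_power[OF \<phi>(2), of 2] by simp
  ultimately have "(\<lambda>n. aform \<Omega> (\<phi> n) (\<phi> n)) \<longlonglongrightarrow> 0 + 2 * 0 + aform \<Omega> u u"
    by (simp only:) (intro tendsto_intros)
  then show ?thesis unfolding tnorm_def by (intro tendsto_real_sqrt) simp
qed

text \<open>The difference telescopes into three terms, each with one argument tending to zero in
  the energy norm and the others bounded because their norms converge.\<close>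

lemma bform_tendsto:
  assumes u: "H20 \<Omega> u" "\<And>n. H20 \<Omega> (u' n)" "(\<lambda>n. tnorm \<Omega> (\<lambda>z. u' n z - u z)) \<longlonglongrightarrow> 0"
    and v: "H20 \<Omega> v" "\<And>n. H20 \<Omega> (v' n)" "(\<lambda>n. tnorm \<Omega> (\<lambda>z. v' n z - v z)) \<longlonglongrightarrow> 0"
    and w: "H20 \<Omega> w" "\<And>n. H20 \<Omega> (w' n)" "(\<lambda>n. tnorm \<Omega> (\<lambda>z. w' n z - w z)) \<longlonglongrightarrow> 0"
  shows "(\<lambda>n. bform \<Omega> (u' n) (v' n) (w' n)) \<longlonglongrightarrow> bform \<Omega> u v w"
proof -
  let ?du = "\<lambda>n. tnorm \<Omega> (\<lambda>z. u' n z - u z)" and ?dv = "\<lambda>n. tnorm \<Omega> (\<lambda>z. v' n z - v z)" and ?dw = "\<lambda>n. tnorm \<Omega> (\<lambda>z. w' n z - w z)"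
  have H: "H2 \<Omega> u" "H2 \<Omega> v" "H2 \<Omega> (u' n)" "H2 \<Omega> (v' n)" "H2 \<Omega> (\<lambda>z. u' n z - u z)" "H2 \<Omega> (\<lambda>z. v' n z - v z)"
      "H20 \<Omega> (\<lambda>z. w' n z - w z)" for n
    using u v w H20_diff H20_H2 by blast+
  have eq: "bform \<Omega> (u' n) (v' n) (w' n) - bform \<Omega> u v w =
     bform \<Omega> (\<lambda>z. u' n z - u z) (v' n) (w' n) + bform \<Omega> u (\<lambda>z. v' n z - v z) (w' n) + bform \<Omega> u v (\<lambda>z. w' n z - w z)" for n
    using bform_diff(1)[OF H(3) H(1) H(4) w(2) w(1), of n n n] bform_diff(2)[OF H(4) H(2) H(1) w(2) w(1), of n n]
      bform_diff(3)[OF H(1) H(2) H(2) w(2) w(1), of n] by simp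
  have "(\<lambda>n. bform \<Omega> (u' n) (v' n) (w' n) - bform \<Omega> u v w) \<longlonglongrightarrow> 0"
  proof (rule Lim_null_comparison)
    show "\<forall>\<^sub>F n in sequentially. norm (bform \<Omega> (u' n) (v' n) (w' n) - bform \<Omega> u v w) \<le>
      \<bar>CS\<bar> * ?du n * tnorm \<Omega> (v' n) * tnorm \<Omega> (w' n) + \<bar>CS\<bar> * tnorm \<Omega> u * ?dv n * tnorm \<Omega> (w' n) + \<bar>CS\<bar> * tnorm \<Omega> u * tnorm \<Omega> v * ?dw n"
      using bform_bound[OF H(5) H(4) w(2)] bform_bound[OF H(1) H(6) w(2)] bform_bound[OF H(1) H(2) H(7)]
      unfolding eq real_norm_def by (intro always_eventually allI order_trans[OF abs_triangle_ineq] add_mono) auto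
    have "(\<lambda>n. \<bar>CS\<bar> * ?du n * tnorm \<Omega> (v' n) * tnorm \<Omega> (w' n) + \<bar>CS\<bar> * tnorm \<Omega> u * ?dv n * tnorm \<Omega> (w' n) + \<bar>CS\<bar> * tnorm \<Omega> u * tnorm \<Omega> v * ?dw n)
       \<longlonglongrightarrow> \<bar>CS\<bar> * 0 * tnorm \<Omega> v * tnorm \<Omega> w + \<bar>CS\<bar> * tnorm \<Omega> u * 0 * tnorm \<Omega> w + \<bar>CS\<bar> * tnorm \<Omega> u * tnorm \<Omega> v * 0"
      by (intro tendsto_intros u(3) v(3) w(3) tnorm_tendsto u v w)
    then show "(\<lambda>n. \<bar>CS\<bar> * ?du n * tnorm \<Omega> (v' n) * tnorm \<Omega> (w' n) + \<bar>CS\<bar> * tnorm \<Omega> u * ?dv n * tnorm \<Omega> (w' n) + \<bar>CS\<bar> * tnorm \<Omega> u * tnorm \<Omega> v * ?dw n)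
       \<longlonglongrightarrow> 0" by simp
  qed
  then show ?thesis using LIM_zero_iff by blast
qed

lemma bform_sym23:
  assumes "H20 \<Omega> u" "H20 \<Omega> v" "H20 \<Omega> w"
  shows "bform \<Omega> u v w = bform \<Omega> u w v"
proof -
  obtain u' where u': "\<And>n. test_fun \<Omega> (u' n)" "(\<lambda>n. tnorm \<Omega> (\<lambda>z. u' n z - u z)) \<longlonglongrightarrow> 0"
    using test_fun_approx[OF assms(1)] by blast
  obtain v' where v': "\<And>n. test_fun \<Omega> (v' n)" "(\<lambda>n. tnorm \<Omega> (\<lambda>z. v' n z - v z)) \<longlonglongrightarrow> 0"
    using test_fun_approx[OF assms(2)] by blast
  obtain w' where w': "\<And>n. test_fun \<Omega> (w' n)" "(\<lambda>n. tnorm \<Omega> (\<lambda>z. w' n z - w z)) \<longlonglongrightarrow> 0"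
    using test_fun_approx[OF assms(3)] by blast
  note t = H20_test_fun[OF u'(1)] H20_test_fun[OF v'(1)] H20_test_fun[OF w'(1)]
  have "bform \<Omega> (u' n) (v' n) (w' n) = bform \<Omega> (u' n) (w' n) (v' n)" for n
    unfolding bform_test_fun[OF u'(1) v'(1) w'(1)] bform_test_fun[OF u'(1) w'(1) v'(1)] by (simp add: algebra_simps)
  moreover have "(\<lambda>n. bform \<Omega> (u' n) (v' n) (w' n)) \<longlonglongrightarrow> bform \<Omega> u v w"
    by (intro bform_tendsto assms t u' v' w')
  moreover have "(\<lambda>n. bform \<Omega> (u' n) (w' n) (v' n)) \<longlonglongrightarrow> bform \<Omega> u w v"
    by (intro bform_tendsto assms t u' v' w')
  ultimately show ?thesis using LIMSEQ_unique by simp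
qed

end

section \<open>Hardy's inequality from a vector field\<close>

definition partials_on :: "pt set \<Rightarrow> (pt \<Rightarrow> real) \<Rightarrow> (pt \<Rightarrow> real) \<Rightarrow> (pt \<Rightarrow> real) \<Rightarrow> bool" where
  "partials_on U F G H \<longleftrightarrow> (\<forall>x y. (x, y) \<in> U \<longrightarrow>
     ((\<lambda>t. F (t, y)) has_field_derivative G (x, y)) (at x) \<and>
     ((\<lambda>t. F (x, t)) has_field_derivative H (x, y)) (at y))"

lemma partials_onI:
  assumes "\<And>x y. (x, y) \<in> U \<Longrightarrow> ((\<lambda>t. F (t, y)) has_field_derivative G (x, y)) (at x)"
    and "\<And>x y. (x, y) \<in> U \<Longrightarrow> ((\<lambda>t. F (x, t)) has_field_derivative H (x, y)) (at y)"
  shows "partials_on U F G H"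
  using assms by (simp add: partials_on_def)

lemma partials_onD:
  assumes "partials_on U F G H" "(x, y) \<in> U"
  shows "((\<lambda>t. F (t, y)) has_field_derivative G (x, y)) (at x)"
    and "((\<lambda>t. F (x, t)) has_field_derivative H (x, y)) (at y)"
  using assms by (auto simp: partials_on_def)

lemma partials_on_add:
  "partials_on U F G H \<Longrightarrow> partials_on U F' G' H' \<Longrightarrow>
    partials_on U (\<lambda>z. F z + F' z) (\<lambda>z. G z + G' z) (\<lambda>z. H z + H' z)"
  unfolding partials_on_def by (auto intro!: DERIV_add)

text \<open>The product is continuous on the open set and identically zero on the open complement of
  K, and these two sets cover the plane.\<close>

lemma continuous_on_localized:
  fixes q G :: "pt \<Rightarrow> real"
  assumes "open \<Omega>" "closed K" "K \<subseteq> \<Omega>" "continuous_on UNIV q" "\<And>z. z \<notin> K \<Longrightarrow> q z = 0" "continuous_on \<Omega> G"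
  shows "continuous_on UNIV (\<lambda>z. q z * G z)"
proof -
  have "continuous_on \<Omega> (\<lambda>z. q z * G z)"
    by (intro continuous_on_mult continuous_on_subset[OF assms(4)] assms(6)) simp
  moreover have "continuous_on (- K) (\<lambda>z. q z * G z)"
    by (rule continuous_on_eq[OF continuous_on_const[of _ 0]]) (simp add: assms(5))
  ultimately have "continuous_on (\<Omega> \<union> - K) (\<lambda>z. q z * G z)"
    using assms by (intro continuous_on_open_Un) auto
  moreover have "\<Omega> \<union> - K = UNIV" using assms by auto
  ultimately show ?thesis by simp
qed

lemma C1_localized:
  assumes \<Omega>: "open \<Omega>" and K: "closed K" "K \<subseteq> \<Omega>" and q: "C1 q" "\<And>z. z \<notin> K \<Longrightarrow> q z = 0"
    and G: "partials_on \<Omega> G G1 G2" "continuous_on \<Omega> G" "continuous_on \<Omega> G1" "continuous_on \<Omega> G2"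
  shows "C1 (\<lambda>z. q z * G z)" "px (\<lambda>z. q z * G z) = (\<lambda>z. q z * G1 z + px q z * G z)"
    "py (\<lambda>z. q z * G z) = (\<lambda>z. q z * G2 z + py q z * G z)"
proof -
  have K': "open (- K)" using K by auto
  have q0: "px q z = 0" "py q z = 0" if "z \<notin> K" for z
    using partials_zero_on_open(3,4)[OF K', of q z] q(2) that by auto
  have c: "continuous_on UNIV q" "continuous_on UNIV (px q)" "continuous_on UNIV (py q)" using q by (simp_all add: C1_def)
  have d: "((\<lambda>t. q (t, y) * G (t, y)) has_field_derivative q (x, y) * G1 (x, y) + px q (x, y) * G (x, y)) (at x) \<and>
     ((\<lambda>t. q (x, t) * G (x, t)) has_field_derivative q (x, y) * G2 (x, y) + py q (x, y) * G (x, y)) (at y)" for x y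
  proof (cases "(x, y) \<in> \<Omega>")
    case True
    then show ?thesis
      using DERIV_mult[OF DERIV_px[OF q(1)] partials_onD(1)[OF G(1) True]] DERIV_mult[OF DERIV_py[OF q(1)] partials_onD(2)[OF G(1) True]]
      by (simp add: algebra_simps)
  next
    case False
    then have "(x, y) \<in> - K" using K by auto
    then show ?thesis
      using partials_zero_on_open(1,2)[OF K', of "\<lambda>z. q z * G z" "(x, y)"] q0[of "(x, y)"] q(2) by simp
  qed
  note l = continuous_on_localized[OF \<Omega> K]
  have cc: "continuous_on UNIV (\<lambda>z. q z * G z)" "continuous_on UNIV (\<lambda>z. q z * G1 z + px q z * G z)"
    "continuous_on UNIV (\<lambda>z. q z * G2 z + py q z * G z)"
    using q0 by (intro continuous_on_add l c q(2) G(2-4); simp)+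
  show "C1 (\<lambda>z. q z * G z)" "px (\<lambda>z. q z * G z) = (\<lambda>z. q z * G1 z + px q z * G z)"
    "py (\<lambda>z. q z * G z) = (\<lambda>z. q z * G2 z + py q z * G z)"
    by (rule C1I[of "\<lambda>z. q z * G z"]; use d cc in blast)+
qed

text \<open>The support of \<open>p\<close> is kept away from the boundary, so the values of \<open>W\<close> outside \<open>\<Omega>\<close> are irrelevant.\<close>

definition hardy :: "pt set \<Rightarrow> (pt \<Rightarrow> real) \<Rightarrow> real \<Rightarrow> bool" where
  "hardy \<Omega> W C \<longleftrightarrow> (\<forall>p K. C1 p \<longrightarrow> compact K \<longrightarrow> K \<subseteq> \<Omega> \<longrightarrow> (\<forall>z. z \<notin> K \<longrightarrow> p z = 0) \<longrightarrow>
     (\<integral>z. (p z)\<^sup>2 * W z \<partial>lborel) \<le> C * (\<integral>z. (px p z)\<^sup>2 + (py p z)\<^sup>2 \<partial>lborel))"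

lemma integrable_localized:
  fixes q G :: "pt \<Rightarrow> real"
  assumes "open \<Omega>" "compact K" "K \<subseteq> \<Omega>" "continuous_on UNIV q" "\<And>z. z \<notin> K \<Longrightarrow> q z = 0" "continuous_on \<Omega> G"
  shows "integrable lborel (\<lambda>z. q z * G z)"
proof (rule bounded_support_integrable)
  show "continuous_on UNIV (\<lambda>z. q z * G z)"
    using assms compact_imp_closed by (intro continuous_on_localized[of \<Omega> K]) auto
  show "bounded {z. q z * G z \<noteq> 0}"
    using assms(5) by (intro bounded_subset[OF compact_imp_bounded[OF assms(2)]]) auto
qed

text \<open>The integral of the divergence of p^2 (F, H) is zero, which gives L times the weighted
  integral as twice the integral of p (F, H) . Dp. Young's inequality with |(F, H)|^2 bounded by D W
  absorbs half of the left-hand side.\<close>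

lemma hardy_from_field:
  assumes \<Omega>: "open \<Omega>" and L: "L > 0" and D: "D > 0"
    and F: "partials_on \<Omega> F F1 G" "partials_on \<Omega> H G' G2"
    and c: "continuous_on \<Omega> F" "continuous_on \<Omega> F1" "continuous_on \<Omega> G" "continuous_on \<Omega> H" "continuous_on \<Omega> G'" "continuous_on \<Omega> G2"
      "continuous_on \<Omega> W"
    and div: "\<And>z. z \<in> \<Omega> \<Longrightarrow> F1 z + G2 z = - L * W z"
    and sq: "\<And>z. z \<in> \<Omega> \<Longrightarrow> (F z)\<^sup>2 + (H z)\<^sup>2 \<le> D * W z"
  shows "hardy \<Omega> W (4 * D / L\<^sup>2)"
  unfolding hardy_def
proof (intro allI impI)
  fix p K assume p: "C1 p" and K: "compact K" "K \<subseteq> \<Omega>" and p0: "\<forall>z. z \<notin> K \<longrightarrow> p z = 0"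
  have K': "closed K" using K compact_imp_closed by blast
  define q where "q = (\<lambda>z. p z * p z)"
  have q: "C1 q" "px q = (\<lambda>z. 2 * p z * px p z)" "py q = (\<lambda>z. 2 * p z * py p z)" "\<And>z. z \<notin> K \<Longrightarrow> q z = 0"
    using C1_mult[OF p p] px_mult[OF p p] py_mult[OF p p] p0
    by (simp_all add: q_def algebra_simps del: split_paired_All)
  note 1 = C1_localized[OF \<Omega> K' K(2) q(1,4) F(1) c(1-3)]
  note 2 = C1_localized[OF \<Omega> K' K(2) q(1,4) F(2) c(4-6)]
  have b: "bounded {z. q z * F z \<noteq> 0}" "bounded {z. q z * H z \<noteq> 0}"
    by (intro bounded_subset[OF compact_imp_bounded[OF K(1)]]; use q(4) in auto)+
  note i1 = integral_partials_zero[OF 1(1) b(1)]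
  note i2 = integral_partials_zero[OF 2(1) b(2)]
  have cp: "continuous_on UNIV p" "continuous_on UNIV (px p)" "continuous_on UNIV (py p)" using p by (simp_all add: C1_def)
  have bp: "bounded {z. p z \<noteq> 0}" by (intro bounded_subset[OF compact_imp_bounded[OF K(1)]]) (use p0 in auto)
  have iW: "integrable lborel (\<lambda>z. (p z)\<^sup>2 * W z)"
    by (rule integrable_localized[OF \<Omega> K _ _ c(7)]) (use p0 cp in \<open>auto intro!: continuous_intros\<close>)
  have ig: "integrable lborel (\<lambda>z. (px p z)\<^sup>2 + (py p z)\<^sup>2)"
    using bounded_support_partials[OF bp]
    by (intro Bochner_Integration.integrable_add bounded_support_integrable) (auto intro!: continuous_intros cp)
  have "(\<integral>z. (L / 2) * ((p z)\<^sup>2 * W z) \<partial>lborel) \<le>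
     (\<integral>z. (2 * D / L) * ((px p z)\<^sup>2 + (py p z)\<^sup>2) - (px (\<lambda>z. q z * F z) z + py (\<lambda>z. q z * H z) z) \<partial>lborel)"
  proof (rule integral_mono)
    fix z
    show "(L / 2) * ((p z)\<^sup>2 * W z) \<le> (2 * D / L) * ((px p z)\<^sup>2 + (py p z)\<^sup>2) - (px (\<lambda>z. q z * F z) z + py (\<lambda>z. q z * H z) z)"
    proof (cases "z \<in> K")
      case False
      then have "p z = 0" using p0 by blast
      then show ?thesis using L D q(4)[OF False] by (simp add: 1(2) 2(3) q(2,3))
    next
      case True
      then have z: "z \<in> \<Omega>" using K by auto
      \<comment> \<open>The weight L / (2 D) turns the bound D W into exactly L W / 2, half of what
        the divergence supplies; the rest produces the constant 4 D / L^2.\<close>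
      have yng: "2 * (a * b) \<le> (L / (2 * D)) * a\<^sup>2 + (2 * D / L) * b\<^sup>2" for a b :: real
      proof -
        have "0 \<le> (L / (2 * D)) * (a - (2 * D / L) * b)\<^sup>2" using L D by simp
        also have "\<dots> = (L / (2 * D)) * a\<^sup>2 + (2 * D / L) * b\<^sup>2 - 2 * (a * b)"
          using L D by (simp add: power2_eq_square field_simps)
        finally show ?thesis by simp
      qed
      have "2 * (p z * F z * px p z) + 2 * (p z * H z * py p z) \<le>
        (L / (2 * D)) * ((p z)\<^sup>2 * ((F z)\<^sup>2 + (H z)\<^sup>2)) + (2 * D / L) * ((px p z)\<^sup>2 + (py p z)\<^sup>2)"
        using yng[of "p z * F z" "px p z"] yng[of "p z * H z" "py p z"] by (simp add: power_mult_distrib algebra_simps)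
      also have "(L / (2 * D)) * ((p z)\<^sup>2 * ((F z)\<^sup>2 + (H z)\<^sup>2)) \<le> (L / (2 * D)) * ((p z)\<^sup>2 * (D * W z))"
        using L D sq[OF z] by (intro mult_left_mono) auto
      also have "\<dots> = (L / 2) * ((p z)\<^sup>2 * W z)" using D by simp
      finally have "2 * (p z * F z * px p z) + 2 * (p z * H z * py p z) \<le> (L / 2) * ((p z)\<^sup>2 * W z) + (2 * D / L) * ((px p z)\<^sup>2 + (py p z)\<^sup>2)"
        by simp
      moreover have "px (\<lambda>z. q z * F z) z + py (\<lambda>z. q z * H z) z = (p z)\<^sup>2 * (F1 z + G2 z) + (2 * (p z * F z * px p z) + 2 * (p z * H z * py p z))"
      proof -
        have "px (\<lambda>z. q z * F z) z + py (\<lambda>z. q z * H z) z = (q z * F1 z + 2 * p z * px p z * F z) + (q z * G2 z + 2 * p z * py p z * H z)"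
          using 1 2 q by (metis (no_types))
        moreover have "q z = (p z)\<^sup>2" by (simp add: q_def power2_eq_square)
        ultimately show ?thesis by (simp add: algebra_simps)
      qed
      ultimately show ?thesis unfolding div[OF z] by (simp add: algebra_simps)
    qed
  qed (use iW ig i1 i2 in auto)
  also have "\<dots> = (2 * D / L) * (\<integral>z. (px p z)\<^sup>2 + (py p z)\<^sup>2 \<partial>lborel)"
    using ig i1 i2 by simp
  finally have "(L / 2) * (\<integral>z. (p z)\<^sup>2 * W z \<partial>lborel) \<le> (2 * D / L) * (\<integral>z. (px p z)\<^sup>2 + (py p z)\<^sup>2 \<partial>lborel)"
    by simp
  then show "(\<integral>z. (p z)\<^sup>2 * W z \<partial>lborel) \<le> 4 * D / L\<^sup>2 * (\<integral>z. (px p z)\<^sup>2 + (py p z)\<^sup>2 \<partial>lborel)"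
    using L by (simp add: power2_eq_square field_simps)
qed

section \<open>The distance to a point and its derivatives up to second order\<close>

definition rad :: "pt \<Rightarrow> pt \<Rightarrow> real" where "rad a z = sqrt ((fst z - fst a)\<^sup>2 + (snd z - snd a)\<^sup>2)"
definition rad_x :: "pt \<Rightarrow> pt \<Rightarrow> real" where "rad_x a z = (fst z - fst a) / rad a z"
definition rad_y :: "pt \<Rightarrow> pt \<Rightarrow> real" where "rad_y a z = (snd z - snd a) / rad a z"
definition rad_xx :: "pt \<Rightarrow> pt \<Rightarrow> real" where "rad_xx a z = (snd z - snd a)\<^sup>2 / (rad a z)^3"
definition rad_xy :: "pt \<Rightarrow> pt \<Rightarrow> real" where "rad_xy a z = - ((fst z - fst a) * (snd z - snd a)) / (rad a z)^3"
definition rad_yy :: "pt \<Rightarrow> pt \<Rightarrow> real" where "rad_yy a z = (fst z - fst a)\<^sup>2 / (rad a z)^3"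

lemma rad_dist: "rad a z = dist z a"
  by (simp add: rad_def dist_prod_def dist_real_def)

lemma rad_pos: "z \<noteq> a \<Longrightarrow> rad a z > 0" by (simp add: rad_dist)

lemma rad_sq: "(rad a z)\<^sup>2 = (fst z - fst a)\<^sup>2 + (snd z - snd a)\<^sup>2" by (simp add: rad_def)

lemma sq_deriv:
  fixes c d u :: real
  shows "((\<lambda>t. (t - c)\<^sup>2 + d) has_field_derivative 2 * (u - c)) (at u)"
    and "((\<lambda>t. d + (t - c)\<^sup>2) has_field_derivative 2 * (u - c)) (at u)"
  by (auto intro!: derivative_eq_intros)

lemma rad_partials:
  assumes "a \<notin> U"
  shows "partials_on U (rad a) (rad_x a) (rad_y a)" "partials_on U (rad_x a) (rad_xx a) (rad_xy a)" "partials_on U (rad_y a) (rad_xy a) (rad_yy a)"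
proof -
  have d1: "((\<lambda>t. rad a (t, y)) has_field_derivative rad_x a (x, y)) (at x)"
    and d2: "((\<lambda>t. rad a (x, t)) has_field_derivative rad_y a (x, y)) (at y)" if "(x, y) \<in> U" for x y
  proof -
    have pos: "(x - fst a)\<^sup>2 + (y - snd a)\<^sup>2 > 0"
      using that assms by (metis prod.collapse right_minus_eq sum_power2_gt_zero_iff)
    have e: "inverse s / 2 * (2 * d) = d / s" for s d :: real
      by (cases "s = 0") (simp_all add: field_simps)
    have g: "((\<lambda>t. (t - fst a)\<^sup>2 + (y - snd a)\<^sup>2) has_field_derivative 2 * (x - fst a)) (at x)"
      "((\<lambda>t. (x - fst a)\<^sup>2 + (t - snd a)\<^sup>2) has_field_derivative 2 * (y - snd a)) (at y)"
      by (rule sq_deriv)+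
    from DERIV_chain2[where f = sqrt and g = "\<lambda>t. (t - fst a)\<^sup>2 + (y - snd a)\<^sup>2", OF DERIV_real_sqrt[OF pos] g(1), unfolded e]
      DERIV_chain2[where f = sqrt and g = "\<lambda>t. (x - fst a)\<^sup>2 + (t - snd a)\<^sup>2", OF DERIV_real_sqrt[OF pos] g(2), unfolded e]
    show "((\<lambda>t. rad a (t, y)) has_field_derivative rad_x a (x, y)) (at x)" "((\<lambda>t. rad a (x, t)) has_field_derivative rad_y a (x, y)) (at y)"
      by (simp_all only: rad_def rad_x_def rad_y_def fst_conv snd_conv)
  qed
  show "partials_on U (rad a) (rad_x a) (rad_y a)" using d1 d2 by (rule partials_onI)
  have q: "((\<lambda>t. rad_x a (t, y)) has_field_derivative rad_xx a (x, y)) (at x)"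
     "((\<lambda>t. rad_x a (x, t)) has_field_derivative rad_xy a (x, y)) (at y)"
     "((\<lambda>t. rad_y a (t, y)) has_field_derivative rad_xy a (x, y)) (at x)"
     "((\<lambda>t. rad_y a (x, t)) has_field_derivative rad_yy a (x, y)) (at y)" if U: "(x, y) \<in> U" for x y
  proof -
    define R where "R = rad a (x, y)"
    have R: "R > 0" unfolding R_def using U assms by (intro rad_pos) auto
    have sq: "R * R = (x - fst a)\<^sup>2 + (y - snd a)\<^sup>2" using rad_sq[of a "(x, y)"] by (simp add: R_def power2_eq_square)
    have 1: "((\<lambda>t. (t - fst a) / rad a (t, y)) has_field_derivative (1 * R - (x - fst a) * rad_x a (x, y)) / (R * R)) (at x)"
      unfolding R_def by (rule DERIV_divide[OF _ d1[OF U]]) (use R in \<open>auto simp: R_def intro!: derivative_eq_intros\<close>)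
    have 2: "((\<lambda>t. (x - fst a) / rad a (x, t)) has_field_derivative (0 * R - (x - fst a) * rad_y a (x, y)) / (R * R)) (at y)"
      unfolding R_def by (rule DERIV_divide[OF _ d2[OF U]]) (use R in \<open>auto simp: R_def intro!: derivative_eq_intros\<close>)
    have 3: "((\<lambda>t. (y - snd a) / rad a (t, y)) has_field_derivative (0 * R - (y - snd a) * rad_x a (x, y)) / (R * R)) (at x)"
      unfolding R_def by (rule DERIV_divide[OF _ d1[OF U]]) (use R in \<open>auto simp: R_def intro!: derivative_eq_intros\<close>)
    have 4: "((\<lambda>t. (t - snd a) / rad a (x, t)) has_field_derivative (1 * R - (y - snd a) * rad_y a (x, y)) / (R * R)) (at y)"
      unfolding R_def by (rule DERIV_divide[OF _ d2[OF U]]) (use R in \<open>auto simp: R_def intro!: derivative_eq_intros\<close>)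
    have e: "(1 * R - X * (X / R)) / (R * R) = (R * R - X\<^sup>2) / R^3" for X
      using R by (simp add: field_simps power2_eq_square power3_eq_cube)
    have "(1 * R - (x - fst a) * rad_x a (x, y)) / (R * R) = rad_xx a (x, y)"
      using e[of "x - fst a"] by (simp add: rad_x_def rad_xx_def flip: R_def) (simp add: sq)
    moreover have "(1 * R - (y - snd a) * rad_y a (x, y)) / (R * R) = rad_yy a (x, y)"
      using e[of "y - snd a"] by (simp add: rad_y_def rad_yy_def flip: R_def) (simp add: sq)
    moreover have "(0 * R - (x - fst a) * rad_y a (x, y)) / (R * R) = rad_xy a (x, y)"
      "(0 * R - (y - snd a) * rad_x a (x, y)) / (R * R) = rad_xy a (x, y)"
      by (simp_all add: rad_x_def rad_y_def rad_xy_def power3_eq_cube ac_simps flip: R_def)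
    ultimately show "((\<lambda>t. rad_x a (t, y)) has_field_derivative rad_xx a (x, y)) (at x)"
     "((\<lambda>t. rad_x a (x, t)) has_field_derivative rad_xy a (x, y)) (at y)"
     "((\<lambda>t. rad_y a (t, y)) has_field_derivative rad_xy a (x, y)) (at x)"
     "((\<lambda>t. rad_y a (x, t)) has_field_derivative rad_yy a (x, y)) (at y)"
      using 1 2 3 4 by (simp_all add: rad_x_def rad_y_def)
  qed
  show "partials_on U (rad_x a) (rad_xx a) (rad_xy a)" using q(1,2) by (rule partials_onI)
  show "partials_on U (rad_y a) (rad_xy a) (rad_yy a)" using q(3,4) by (rule partials_onI)
qed

lemma rad_continuous:
  assumes "a \<notin> U"
  shows "continuous_on U (rad a)" "continuous_on U (rad_x a)" "continuous_on U (rad_y a)"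
     "continuous_on U (rad_xx a)" "continuous_on U (rad_xy a)" "continuous_on U (rad_yy a)"
proof -
  have ne: "\<forall>z\<in>U. rad a z \<noteq> 0" "\<forall>z\<in>U. rad a z ^ 3 \<noteq> 0" using rad_pos assms by (metis less_irrefl power_not_zero)+
  show c: "continuous_on U (rad a)" unfolding rad_def by (intro continuous_intros)
  show "continuous_on U (rad_x a)" "continuous_on U (rad_y a)"
     "continuous_on U (rad_xx a)" "continuous_on U (rad_xy a)" "continuous_on U (rad_yy a)"
    unfolding rad_x_def rad_y_def rad_xx_def rad_xy_def rad_yy_def
    by (intro continuous_intros c ne)+
qed

text \<open>In the plane the distance has a unit gradient and its Laplacian is the reciprocal
  distance; the Laplacian enters the divergence of the Hardy field, the entrywise bounds enter the
  Hessian of the logarithm.\<close>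

lemma rad_bounds:
  assumes "z \<noteq> a"
  shows "\<bar>rad_xx a z\<bar> \<le> 1 / rad a z" "\<bar>rad_xy a z\<bar> \<le> 1 / rad a z" "\<bar>rad_yy a z\<bar> \<le> 1 / rad a z"
    "rad_xx a z + rad_yy a z = 1 / rad a z" "(rad_x a z)\<^sup>2 + (rad_y a z)\<^sup>2 = 1"
proof -
  define R where "R = rad a z"
  define X where "X = fst z - fst a"
  define Y where "Y = snd z - snd a"
  have R: "R > 0" using rad_pos[OF assms] by (simp add: R_def)
  have sq: "X\<^sup>2 + Y\<^sup>2 = R\<^sup>2" using rad_sq[of a z] by (simp add: R_def X_def Y_def)
  have one: "1 / R = R\<^sup>2 / R^3" using R by (simp add: power2_eq_square power3_eq_cube)
  have "\<bar>X * Y\<bar> \<le> R\<^sup>2" 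
  proof -
    have "0 \<le> \<bar>X\<bar> * \<bar>Y\<bar>" by simp
    then show ?thesis using sum_squares_bound[of "\<bar>X\<bar>" "\<bar>Y\<bar>"] sq unfolding abs_mult power2_abs mult.assoc by linarith
  qed
  moreover have "X\<^sup>2 \<le> R\<^sup>2" "Y\<^sup>2 \<le> R\<^sup>2" using sq zero_le_power2[of X] zero_le_power2[of Y] by linarith+
  ultimately show "\<bar>rad_xx a z\<bar> \<le> 1 / rad a z" "\<bar>rad_xy a z\<bar> \<le> 1 / rad a z" "\<bar>rad_yy a z\<bar> \<le> 1 / rad a z"
    using R unfolding rad_xx_def rad_xy_def rad_yy_def R_def[symmetric] X_def[symmetric] Y_def[symmetric] one
    by (auto simp: abs_mult intro!: divide_right_mono)
  show "rad_xx a z + rad_yy a z = 1 / rad a z"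
    using sq unfolding rad_xx_def rad_yy_def R_def[symmetric] X_def[symmetric] Y_def[symmetric] one
    by (simp add: add_divide_distrib[symmetric] add.commute)
  show "(rad_x a z)\<^sup>2 + (rad_y a z)\<^sup>2 = 1"
    using sq R unfolding rad_x_def rad_y_def R_def[symmetric] X_def[symmetric] Y_def[symmetric]
    by (simp add: power_divide add_divide_distrib[symmetric])
qed

section \<open>Barriers at the boundary segments\<close>

text \<open>Here \<open>T\<close> tends to \<open>-\<infinity>\<close> at \<open>S\<close>, and \<open>W\<close> is a Hardy weight that dominates \<open>|T|\<close>,
  \<open>|DT|\<^sup>2\<close> and \<open>|D\<^sup>2T|\<close>. Hence cut-off functions built from \<open>\<epsilon> T\<close> have derivatives of order \<open>\<epsilon>\<close>
  relative to \<open>W\<close>: they are logarithmic cut-offs.\<close>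

definition barrier :: "pt set \<Rightarrow> pt set \<Rightarrow> (pt \<Rightarrow> real) \<Rightarrow> (pt \<Rightarrow> real) \<Rightarrow> real \<Rightarrow> bool" where
  "barrier \<Omega> S T W C \<longleftrightarrow> 0 < C \<and> smooth \<Omega> T \<and>
     (\<exists>T1 T2 T11 T12 T22. partials_on \<Omega> T T1 T2 \<and> partials_on \<Omega> T1 T11 T12 \<and> partials_on \<Omega> T2 T12 T22 \<and>
        (\<forall>z\<in>\<Omega>. (T1 z)\<^sup>2 + (T2 z)\<^sup>2 \<le> C * W z \<and> \<bar>T11 z\<bar> \<le> C * W z \<and> \<bar>T12 z\<bar> \<le> C * W z \<and> \<bar>T22 z\<bar> \<le> C * W z)) \<and>
     continuous_on \<Omega> W \<and> (\<forall>z\<in>\<Omega>. 0 \<le> W z \<and> 1 \<le> C * W z \<and> - T z \<le> C * W z \<and> T z \<le> 0) \<and>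
     hardy \<Omega> W C \<and> (\<forall>c. \<exists>G. closed G \<and> G \<inter> S = {} \<and> (\<forall>z\<in>\<Omega>. - c \<le> T z \<longrightarrow> z \<in> G))"

lemma hardy_mono:
  assumes "hardy \<Omega> W C" "C \<le> C'"
  shows "hardy \<Omega> W C'"
  unfolding hardy_def
proof (intro allI impI)
  fix p K assume a: "C1 p" "compact K" "K \<subseteq> \<Omega>" "\<forall>z. z \<notin> K \<longrightarrow> p z = 0"
  have "(\<integral>z. (p z)\<^sup>2 * W z \<partial>lborel) \<le> C * (\<integral>z. (px p z)\<^sup>2 + (py p z)\<^sup>2 \<partial>lborel)"
    using assms(1)[unfolded hardy_def] a by blast
  also have "\<dots> \<le> C' * (\<integral>z. (px p z)\<^sup>2 + (py p z)\<^sup>2 \<partial>lborel)"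
    by (intro mult_right_mono assms(2) Bochner_Integration.integral_nonneg) simp
  finally show "(\<integral>z. (p z)\<^sup>2 * W z \<partial>lborel) \<le> C' * (\<integral>z. (px p z)\<^sup>2 + (py p z)\<^sup>2 \<partial>lborel)" .
qed

lemma hardy_add:
  assumes "open \<Omega>" "hardy \<Omega> W C" "hardy \<Omega> W' C'" "continuous_on \<Omega> W" "continuous_on \<Omega> W'"
  shows "hardy \<Omega> (\<lambda>z. W z + W' z) (C + C')"
  unfolding hardy_def
proof (intro allI impI)
  fix p K assume a: "C1 p" "compact K" "K \<subseteq> \<Omega>" "\<forall>z. z \<notin> K \<longrightarrow> p z = 0"
  have cp: "continuous_on UNIV (\<lambda>z. (p z)\<^sup>2)" using a(1) by (auto simp: C1_def intro!: continuous_intros)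
  have p20: "(p z)\<^sup>2 = 0" if "z \<notin> K" for z using a(4) that by (simp del: split_paired_All)
  have i: "integrable lborel (\<lambda>z. (p z)\<^sup>2 * G z)" if "continuous_on \<Omega> G" for G
    by (rule integrable_localized[OF assms(1) a(2,3) cp _ that]) (rule p20)
  have "(\<integral>z. (p z)\<^sup>2 * (W z + W' z) \<partial>lborel) = (\<integral>z. (p z)\<^sup>2 * W z \<partial>lborel) + (\<integral>z. (p z)\<^sup>2 * W' z \<partial>lborel)"
    using i[OF assms(4)] i[OF assms(5)] by (simp add: distrib_left)
  also have "\<dots> \<le> C * (\<integral>z. (px p z)\<^sup>2 + (py p z)\<^sup>2 \<partial>lborel) + C' * (\<integral>z. (px p z)\<^sup>2 + (py p z)\<^sup>2 \<partial>lborel)"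
    by (intro add_mono assms(2,3)[unfolded hardy_def, rule_format, of p K]) (use a in blast)+
  finally show "(\<integral>z. (p z)\<^sup>2 * (W z + W' z) \<partial>lborel) \<le> (C + C') * (\<integral>z. (px p z)\<^sup>2 + (py p z)\<^sup>2 \<partial>lborel)"
    by (simp add: distrib_right)
qed

text \<open>Both logarithms are nonpositive, so a lower bound on their sum is a lower bound on each:
  the superlevel sets stay away from both pieces. The factor 2 comes from squaring the sum of two
  gradients.\<close>

lemma barrier_add:
  assumes \<Omega>: "open \<Omega>" and "barrier \<Omega> S T W C" "barrier \<Omega> S' T' W' C'"
  shows "barrier \<Omega> (S \<union> S') (\<lambda>z. T z + T' z) (\<lambda>z. W z + W' z) (2 * (C + C'))"
proof -
  obtain T1 T2 T11 T12 T22 where T: "partials_on \<Omega> T T1 T2" "partials_on \<Omega> T1 T11 T12" "partials_on \<Omega> T2 T12 T22"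
    "\<forall>z\<in>\<Omega>. (T1 z)\<^sup>2 + (T2 z)\<^sup>2 \<le> C * W z \<and> \<bar>T11 z\<bar> \<le> C * W z \<and> \<bar>T12 z\<bar> \<le> C * W z \<and> \<bar>T22 z\<bar> \<le> C * W z"
    using assms(2) unfolding barrier_def by blast
  obtain T1' T2' T11' T12' T22' where T': "partials_on \<Omega> T' T1' T2'" "partials_on \<Omega> T1' T11' T12'" "partials_on \<Omega> T2' T12' T22'"
    "\<forall>z\<in>\<Omega>. (T1' z)\<^sup>2 + (T2' z)\<^sup>2 \<le> C' * W' z \<and> \<bar>T11' z\<bar> \<le> C' * W' z \<and> \<bar>T12' z\<bar> \<le> C' * W' z \<and> \<bar>T22' z\<bar> \<le> C' * W' z"
    using assms(3) unfolding barrier_def by blast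
  have C: "C > 0" "C' > 0" and sm: "smooth \<Omega> T" "smooth \<Omega> T'" and cW: "continuous_on \<Omega> W" "continuous_on \<Omega> W'"
    and h: "hardy \<Omega> W C" "hardy \<Omega> W' C'"
    using assms(2,3) by (simp_all add: barrier_def)
  have B: "0 \<le> W z" "1 \<le> C * W z" "- T z \<le> C * W z" "T z \<le> 0" "0 \<le> W' z" "1 \<le> C' * W' z" "- T' z \<le> C' * W' z" "T' z \<le> 0" if "z \<in> \<Omega>" for z
    using assms(2,3) that unfolding barrier_def by blast+
  have prod: "C * W z + C' * W' z \<le> (C + C') * (W z + W' z)" "0 \<le> C * W z" "0 \<le> C' * W' z" if "z \<in> \<Omega>" for z
    using B[OF that] C by (simp_all add: algebra_simps)
  have sq: "(a + b)\<^sup>2 \<le> 2 * a\<^sup>2 + 2 * b\<^sup>2" for a b :: real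
    using sum_squares_bound[of a b] by (simp add: power2_sum)
  show ?thesis unfolding barrier_def
  proof (intro conjI exI)
    show "0 < 2 * (C + C')" using C by simp
    show "smooth \<Omega> (\<lambda>z. T z + T' z)" using sm by (rule smooth_add)
    show "partials_on \<Omega> (\<lambda>z. T z + T' z) (\<lambda>z. T1 z + T1' z) (\<lambda>z. T2 z + T2' z)" using T(1) T'(1) by (rule partials_on_add)
    show "partials_on \<Omega> (\<lambda>z. T1 z + T1' z) (\<lambda>z. T11 z + T11' z) (\<lambda>z. T12 z + T12' z)" using T(2) T'(2) by (rule partials_on_add)
    show "partials_on \<Omega> (\<lambda>z. T2 z + T2' z) (\<lambda>z. T12 z + T12' z) (\<lambda>z. T22 z + T22' z)" using T(3) T'(3) by (rule partials_on_add)
    show "continuous_on \<Omega> (\<lambda>z. W z + W' z)" using cW by (rule continuous_on_add)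
    show "hardy \<Omega> (\<lambda>z. W z + W' z) (2 * (C + C'))"
      by (rule hardy_mono[OF hardy_add[OF \<Omega> h cW]]) (use C in simp)
    show "\<forall>z\<in>\<Omega>. (T1 z + T1' z)\<^sup>2 + (T2 z + T2' z)\<^sup>2 \<le> 2 * (C + C') * (W z + W' z) \<and> \<bar>T11 z + T11' z\<bar> \<le> 2 * (C + C') * (W z + W' z) \<and>
       \<bar>T12 z + T12' z\<bar> \<le> 2 * (C + C') * (W z + W' z) \<and> \<bar>T22 z + T22' z\<bar> \<le> 2 * (C + C') * (W z + W' z)"
    proof
      fix z assume z: "z \<in> \<Omega>"
      have t: "(T1 z)\<^sup>2 + (T2 z)\<^sup>2 \<le> C * W z" "\<bar>T11 z\<bar> \<le> C * W z" "\<bar>T12 z\<bar> \<le> C * W z" "\<bar>T22 z\<bar> \<le> C * W z"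
        "(T1' z)\<^sup>2 + (T2' z)\<^sup>2 \<le> C' * W' z" "\<bar>T11' z\<bar> \<le> C' * W' z" "\<bar>T12' z\<bar> \<le> C' * W' z" "\<bar>T22' z\<bar> \<le> C' * W' z"
        using T(4) T'(4) z by blast+
      define P where "P = (C + C') * (W z + W' z)"
      show "(T1 z + T1' z)\<^sup>2 + (T2 z + T2' z)\<^sup>2 \<le> 2 * (C + C') * (W z + W' z) \<and> \<bar>T11 z + T11' z\<bar> \<le> 2 * (C + C') * (W z + W' z) \<and>
       \<bar>T12 z + T12' z\<bar> \<le> 2 * (C + C') * (W z + W' z) \<and> \<bar>T22 z + T22' z\<bar> \<le> 2 * (C + C') * (W z + W' z)"
        unfolding mult.assoc P_def[symmetric]
      proof (intro conjI)
        have p: "C * W z + C' * W' z \<le> P" "0 \<le> P" using prod[OF z] by (simp_all add: P_def)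
        have tri: "\<bar>x + y\<bar> \<le> 2 * P" if "\<bar>x\<bar> \<le> C * W z" "\<bar>y\<bar> \<le> C' * W' z" for x y
          using abs_triangle_ineq[of x y] that p by linarith
        show "(T1 z + T1' z)\<^sup>2 + (T2 z + T2' z)\<^sup>2 \<le> 2 * P"
          using sq[of "T1 z" "T1' z"] sq[of "T2 z" "T2' z"] t(1,5) p by linarith
        show "\<bar>T11 z + T11' z\<bar> \<le> 2 * P" "\<bar>T12 z + T12' z\<bar> \<le> 2 * P" "\<bar>T22 z + T22' z\<bar> \<le> 2 * P"
          by (rule tri[OF t(2) t(6)], rule tri[OF t(3) t(7)], rule tri[OF t(4) t(8)])
      qed
    qed
    show "\<forall>z\<in>\<Omega>. 0 \<le> W z + W' z \<and> 1 \<le> 2 * (C + C') * (W z + W' z) \<and> - (T z + T' z) \<le> 2 * (C + C') * (W z + W' z) \<and> T z + T' z \<le> 0"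
    proof
      fix z assume z: "z \<in> \<Omega>"
      define P where "P = (C + C') * (W z + W' z)"
      show "0 \<le> W z + W' z \<and> 1 \<le> 2 * (C + C') * (W z + W' z) \<and> - (T z + T' z) \<le> 2 * (C + C') * (W z + W' z) \<and> T z + T' z \<le> 0"
        using B[OF z] prod[OF z] unfolding mult.assoc P_def[symmetric] by linarith
    qed
    show "\<forall>c. \<exists>G. closed G \<and> G \<inter> (S \<union> S') = {} \<and> (\<forall>z\<in>\<Omega>. - c \<le> T z + T' z \<longrightarrow> z \<in> G)"
    proof
      fix c
      obtain G where G: "closed G" "G \<inter> S = {}" "\<forall>z\<in>\<Omega>. - c \<le> T z \<longrightarrow> z \<in> G"
        using assms(2) unfolding barrier_def by blast
      obtain G' where G': "closed G'" "G' \<inter> S' = {}" "\<forall>z\<in>\<Omega>. - c \<le> T' z \<longrightarrow> z \<in> G'"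
        using assms(3) unfolding barrier_def by blast
      have "\<forall>z\<in>\<Omega>. - c \<le> T z + T' z \<longrightarrow> z \<in> G \<inter> G'"
      proof (intro ballI impI)
        fix z assume z: "z \<in> \<Omega>" "- c \<le> T z + T' z"
        then have "- c \<le> T z" "- c \<le> T' z" using B[OF z(1)] by linarith+
        then show "z \<in> G \<inter> G'" using G(3) G'(3) z(1) by blast
      qed
      then show "\<exists>G. closed G \<and> G \<inter> (S \<union> S') = {} \<and> (\<forall>z\<in>\<Omega>. - c \<le> T z + T' z \<longrightarrow> z \<in> G)"
        using G G' by (intro exI[of _ "G \<inter> G'"]) auto
    qed
  qed
qed

text \<open>The function \<open>\<sigma> = |z - a| + |z - b| - |a - b|\<close> vanishes exactly on the segment. With
  \<open>L = |a - b|\<close>, the law of cosines gives \<open>|D\<sigma>|\<^sup>2 / \<sigma>\<^sup>2 = (\<sigma> + 2 L) W\<close> and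
  \<open>div (D\<sigma> / \<sigma>) = - L W\<close> for \<open>W = 1 / (\<sigma> |z - a| |z - b|)\<close>, so no polar coordinates are needed
  at the end points.\<close>

lemma segment_barrier:
  assumes \<Omega>: "open \<Omega>" "bounded \<Omega>" and ab: "a \<noteq> b" and dis: "closed_segment a b \<inter> \<Omega> = {}"
  shows "\<exists>T W C. barrier \<Omega> (closed_segment a b) T W C"
proof -
  define L where "L = dist a b"
  have L: "L > 0" using ab by (simp add: L_def)
  have ab\<Omega>: "a \<notin> \<Omega>" "b \<notin> \<Omega>" using dis by auto
  define \<sigma> where "\<sigma> = (\<lambda>z. rad a z + rad b z - L)"
  obtain R where R: "\<And>z. z \<in> \<Omega> \<Longrightarrow> norm z \<le> R" using \<Omega>(2) by (auto simp: bounded_iff)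
  \<comment> \<open>On the bounded domain \<open>D\<close> dominates |z - a| + |z - b| + L, which is
    \<open>\<sigma>\<close> + 2 L. In particular \<open>\<sigma>\<close> is at most
    \<open>D\<close>, so that ln \<open>\<sigma>\<close> - ln \<open>D\<close> is nonpositive; the
    summand 1 secures D \<ge> 1.\<close>
  define D where "D = 2 * \<bar>R\<bar> + norm a + norm b + L + 1"
  have rpos: "rad a z > 0" "rad b z > 0" if "z \<in> \<Omega>" for z using that ab\<Omega> rad_pos by metis+
  have \<sigma>pos: "\<sigma> z > 0" if "z \<in> \<Omega>" for z
  proof -
    have "z \<notin> closed_segment a b" using that dis by auto
    then have "dist a b \<noteq> dist a z + dist z b" using between[of a b z] between_mem_segment[of a b z] by simp
    then show ?thesis using dist_triangle[of a b z] by (simp add: \<sigma>_def L_def rad_dist dist_commute)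
  qed
  have \<sigma>0: "\<sigma> z = 0" if "z \<in> closed_segment a b" for z
    using that between[of a b z] between_mem_segment[of a b z] by (simp add: \<sigma>_def L_def rad_dist dist_commute)
  have D1: "D \<ge> 1" using L by (simp add: D_def)
  have Db: "rad a z + rad b z + L \<le> D" if "z \<in> \<Omega>" for z
    using R[OF that] norm_triangle_ineq4[of z a] norm_triangle_ineq4[of z b] by (simp add: D_def rad_dist dist_norm)
  define W where "W = (\<lambda>z. 1 / (\<sigma> z * rad a z * rad b z))"
  \<comment> \<open>(F, H) is the gradient of ln \<open>\<sigma>\<close>: the vector field of the
    Hardy inequality and the gradient of the barrier are the same object, so one weight controls
    both.\<close>
  define F where "F = (\<lambda>z. (rad_x a z + rad_x b z) / \<sigma> z)"
  define H where "H = (\<lambda>z. (rad_y a z + rad_y b z) / \<sigma> z)"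
  define F1 where "F1 = (\<lambda>z. (rad_xx a z + rad_xx b z) / \<sigma> z - F z * F z)"
  define F2 where "F2 = (\<lambda>z. (rad_xy a z + rad_xy b z) / \<sigma> z - F z * H z)"
  define Hy where "Hy = (\<lambda>z. (rad_yy a z + rad_yy b z) / \<sigma> z - H z * H z)"
  define T where "T = (\<lambda>z. ln (\<sigma> z) - ln D)"
  note rp = rad_partials[OF ab\<Omega>(1)] rad_partials[OF ab\<Omega>(2)]
  have p\<sigma>: "partials_on \<Omega> \<sigma> (\<lambda>z. rad_x a z + rad_x b z) (\<lambda>z. rad_y a z + rad_y b z)"
  proof (rule partials_onI)
    fix x y assume z: "(x, y) \<in> \<Omega>"
    note s = partials_on_add[OF rp(1) rp(4)]
    show "((\<lambda>t. \<sigma> (t, y)) has_field_derivative rad_x a (x, y) + rad_x b (x, y)) (at x)"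
      unfolding \<sigma>_def by (rule DERIV_cong[OF DERIV_diff[OF partials_onD(1)[OF s z] DERIV_const]]) simp
    show "((\<lambda>t. \<sigma> (x, t)) has_field_derivative rad_y a (x, y) + rad_y b (x, y)) (at y)"
      unfolding \<sigma>_def by (rule DERIV_cong[OF DERIV_diff[OF partials_onD(2)[OF s z] DERIV_const]]) simp
  qed
  have pT: "partials_on \<Omega> T F H"
  proof (rule partials_onI)
    fix x y assume z: "(x, y) \<in> \<Omega>"
    show "((\<lambda>t. T (t, y)) has_field_derivative F (x, y)) (at x)"
      unfolding T_def F_def
      by (rule DERIV_cong[OF DERIV_diff[OF DERIV_chain2[where f = ln, OF DERIV_ln partials_onD(1)[OF p\<sigma> z]] DERIV_const]])
        (use \<sigma>pos[OF z] in \<open>simp_all add: inverse_eq_divide\<close>)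
    show "((\<lambda>t. T (x, t)) has_field_derivative H (x, y)) (at y)"
      unfolding T_def H_def
      by (rule DERIV_cong[OF DERIV_diff[OF DERIV_chain2[where f = ln, OF DERIV_ln partials_onD(2)[OF p\<sigma> z]] DERIV_const]])
        (use \<sigma>pos[OF z] in \<open>simp_all add: inverse_eq_divide\<close>)
  qed
  have quot: "(A * s - B * E) / (s * s) = A / s - (B / s) * (E / s)" if "s > 0" for A s B E :: real
    using that by (simp add: field_simps)
  have pF: "partials_on \<Omega> F F1 F2"
  proof (rule partials_onI)
    fix x y assume z: "(x, y) \<in> \<Omega>"
    have n: "\<sigma> (x, y) \<noteq> 0" using \<sigma>pos[OF z] by simp
    note s = partials_on_add[OF rp(2) rp(5)]
    show "((\<lambda>t. F (t, y)) has_field_derivative F1 (x, y)) (at x)"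
      unfolding F_def F1_def
      by (rule DERIV_cong[OF DERIV_divide[OF partials_onD(1)[OF s z] partials_onD(1)[OF p\<sigma> z] n]]) (rule quot[OF \<sigma>pos[OF z]])
    show "((\<lambda>t. F (x, t)) has_field_derivative F2 (x, y)) (at y)"
      unfolding F_def F2_def H_def
      by (rule DERIV_cong[OF DERIV_divide[OF partials_onD(2)[OF s z] partials_onD(2)[OF p\<sigma> z] n]]) (rule quot[OF \<sigma>pos[OF z]])
  qed
  have pH: "partials_on \<Omega> H F2 Hy"
  proof (rule partials_onI)
    fix x y assume z: "(x, y) \<in> \<Omega>"
    have n: "\<sigma> (x, y) \<noteq> 0" using \<sigma>pos[OF z] by simp
    note s = partials_on_add[OF rp(3) rp(6)]
    show "((\<lambda>t. H (t, y)) has_field_derivative F2 (x, y)) (at x)"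
      unfolding F_def F2_def H_def mult.commute[of "(rad_x a (x, y) + rad_x b (x, y)) / \<sigma> (x, y)"]
      by (rule DERIV_cong[OF DERIV_divide[OF partials_onD(1)[OF s z] partials_onD(1)[OF p\<sigma> z] n]]) (rule quot[OF \<sigma>pos[OF z]])
    show "((\<lambda>t. H (x, t)) has_field_derivative Hy (x, y)) (at y)"
      unfolding Hy_def H_def
      by (rule DERIV_cong[OF DERIV_divide[OF partials_onD(2)[OF s z] partials_onD(2)[OF p\<sigma> z] n]]) (rule quot[OF \<sigma>pos[OF z]])
  qed
  note rc = rad_continuous[OF ab\<Omega>(1)] rad_continuous[OF ab\<Omega>(2)]
  have c\<sigma>: "continuous_on \<Omega> \<sigma>" unfolding \<sigma>_def by (intro continuous_intros rc)
  have n\<sigma>: "\<forall>z\<in>\<Omega>. \<sigma> z \<noteq> 0" "\<forall>z\<in>\<Omega>. \<sigma> z * rad a z * rad b z \<noteq> 0" using \<sigma>pos rpos by (metis less_irrefl mult_eq_0_iff)+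
  have cW: "continuous_on \<Omega> W" unfolding W_def by (intro continuous_intros c\<sigma> rc n\<sigma>)
  have cF: "continuous_on \<Omega> F" "continuous_on \<Omega> H" unfolding F_def H_def by (intro continuous_intros c\<sigma> rc n\<sigma>)+
  have cF2: "continuous_on \<Omega> F1" "continuous_on \<Omega> F2" "continuous_on \<Omega> Hy"
    unfolding F1_def F2_def Hy_def by (intro continuous_intros c\<sigma> rc n\<sigma> cF)+
  have Wpos: "W z > 0" if "z \<in> \<Omega>" for z using \<sigma>pos[OF that] rpos[OF that] by (simp add: W_def)
  have inv: "(1 / rad a z + 1 / rad b z) / \<sigma> z = (rad a z + rad b z) * W z" if "z \<in> \<Omega>" for z
    using \<sigma>pos[OF that] rpos[OF that] by (simp add: W_def field_simps)
  have sq: "(F z)\<^sup>2 + (H z)\<^sup>2 = (\<sigma> z + 2 * L) * W z" if z: "z \<in> \<Omega>" for z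
  proof -
    define A B X Y X' Y' where "A = rad a z" "B = rad b z" "X = fst z - fst a" "Y = snd z - snd a" "X' = fst z - fst b" "Y' = snd z - snd b"
    note d = this
    have A: "A > 0" "B > 0" using rpos[OF z] by (simp_all add: d)
    have sA: "A\<^sup>2 = X\<^sup>2 + Y\<^sup>2" and sB: "B\<^sup>2 = X'\<^sup>2 + Y'\<^sup>2" by (simp_all add: d rad_sq)
    have sL: "L\<^sup>2 = (X - X')\<^sup>2 + (Y - Y')\<^sup>2"
      using rad_sq[of a b] by (simp add: d L_def rad_dist dist_commute power2_commute)
    have "(rad_x a z + rad_x b z)\<^sup>2 + (rad_y a z + rad_y b z)\<^sup>2 = (X / A + X' / B)\<^sup>2 + (Y / A + Y' / B)\<^sup>2"
      by (simp add: rad_x_def rad_y_def d)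
    also have "\<dots> = (X\<^sup>2 + Y\<^sup>2) / A\<^sup>2 + (X'\<^sup>2 + Y'\<^sup>2) / B\<^sup>2 + 2 * (X * X' + Y * Y') / (A * B)"
      using A by (simp add: power2_sum power_divide add_divide_distrib algebra_simps)
    also have "\<dots> = 2 + 2 * (X * X' + Y * Y') / (A * B)"
      using A unfolding sA[symmetric] sB[symmetric] by simp
    also have "2 * (X * X' + Y * Y') = A\<^sup>2 + B\<^sup>2 - L\<^sup>2"
      unfolding sA sB sL by (simp add: power2_eq_square algebra_simps)
    also have "2 + (A\<^sup>2 + B\<^sup>2 - L\<^sup>2) / (A * B) = (A + B - L) * (A + B + L) / (A * B)"
      using A by (simp add: power2_eq_square field_simps)
    also have "\<dots> = \<sigma> z * (\<sigma> z + 2 * L) / (A * B)" by (simp add: \<sigma>_def d)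
    finally have e: "(rad_x a z + rad_x b z)\<^sup>2 + (rad_y a z + rad_y b z)\<^sup>2 = \<sigma> z * (\<sigma> z + 2 * L) / (A * B)" .
    have "(F z)\<^sup>2 + (H z)\<^sup>2 = ((rad_x a z + rad_x b z)\<^sup>2 + (rad_y a z + rad_y b z)\<^sup>2) / (\<sigma> z)\<^sup>2"
      by (simp add: F_def H_def power_divide flip: add_divide_distrib)
    also have "\<dots> = (\<sigma> z + 2 * L) * W z"
      unfolding e W_def d(1,2)[symmetric] using \<sigma>pos[OF z] A by (simp add: power2_eq_square)
    finally show ?thesis .
  qed
  have bW: "\<sigma> z + 2 * L \<le> D" "rad a z + rad b z \<le> D" "rad a z \<le> D" "rad b z \<le> D" "\<sigma> z \<le> D" if "z \<in> \<Omega>" for z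
    using Db[OF that] rpos[OF that] L by (auto simp: \<sigma>_def)
  have sqD: "(F z)\<^sup>2 + (H z)\<^sup>2 \<le> D * W z" if "z \<in> \<Omega>" for z
    unfolding sq[OF that] using bW[OF that] Wpos[OF that] by (intro mult_right_mono) auto
  have dv: "F1 z + Hy z = - L * W z" if z: "z \<in> \<Omega>" for z
  proof -
    have ne: "z \<noteq> a" "z \<noteq> b" using z ab\<Omega> by auto
    have "F1 z + Hy z = ((rad_xx a z + rad_yy a z) + (rad_xx b z + rad_yy b z)) / \<sigma> z - ((F z)\<^sup>2 + (H z)\<^sup>2)"
      by (simp add: F1_def Hy_def power2_eq_square add_divide_distrib)
    also have "\<dots> = (rad a z + rad b z) * W z - (\<sigma> z + 2 * L) * W z"
      unfolding rad_bounds(4)[OF ne(1)] rad_bounds(4)[OF ne(2)] inv[OF z] sq[OF z] ..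
    also have "\<dots> = - L * W z" by (simp add: \<sigma>_def algebra_simps)
    finally show ?thesis .
  qed
  have hd: "hardy \<Omega> W (4 * D / L\<^sup>2)"
    by (rule hardy_from_field[OF \<Omega>(1) L _ pF pH cF(1) cF2(1,2) cF(2) cF2(2,3) cW dv sqD]) (use D1 in auto)
  have second: "\<bar>F1 z\<bar> \<le> 2 * D * W z" "\<bar>F2 z\<bar> \<le> 2 * D * W z" "\<bar>Hy z\<bar> \<le> 2 * D * W z" if z: "z \<in> \<Omega>" for z
  proof -
    have ne: "z \<noteq> a" "z \<noteq> b" using z ab\<Omega> by auto
    have q: "\<bar>(s + t) / \<sigma> z\<bar> \<le> D * W z" if "\<bar>s\<bar> \<le> 1 / rad a z" "\<bar>t\<bar> \<le> 1 / rad b z" for s t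
    proof -
      have "\<bar>(s + t) / \<sigma> z\<bar> \<le> (1 / rad a z + 1 / rad b z) / \<sigma> z"
        using that \<sigma>pos[OF z] by (auto simp: abs_divide intro!: divide_right_mono)
      also have "\<dots> \<le> D * W z" unfolding inv[OF z] using bW[OF z] Wpos[OF z] by (intro mult_right_mono) auto
      finally show ?thesis .
    qed
    have FH: "\<bar>F z * H z\<bar> \<le> D * W z" "\<bar>F z * F z\<bar> \<le> D * W z" "\<bar>H z * H z\<bar> \<le> D * W z"
    proof -
      have "0 \<le> \<bar>F z\<bar> * \<bar>H z\<bar>" by simp
      then have "\<bar>F z * H z\<bar> \<le> (F z)\<^sup>2 + (H z)\<^sup>2"
        using sum_squares_bound[of "\<bar>F z\<bar>" "\<bar>H z\<bar>"] unfolding abs_mult power2_abs mult.assoc by linarith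
      then show "\<bar>F z * H z\<bar> \<le> D * W z" using sqD[OF z] by linarith
      show "\<bar>F z * F z\<bar> \<le> D * W z" "\<bar>H z * H z\<bar> \<le> D * W z"
        using sqD[OF z] zero_le_power2[of "F z"] zero_le_power2[of "H z"] unfolding power2_eq_square by linarith+
    qed
    show "\<bar>F1 z\<bar> \<le> 2 * D * W z" unfolding F1_def mult.assoc
      using q[OF rad_bounds(1)[OF ne(1)] rad_bounds(1)[OF ne(2)]] FH(2) by linarith
    show "\<bar>F2 z\<bar> \<le> 2 * D * W z" unfolding F2_def mult.assoc
      using q[OF rad_bounds(2)[OF ne(1)] rad_bounds(2)[OF ne(2)]] FH(1) by linarith
    show "\<bar>Hy z\<bar> \<le> 2 * D * W z" unfolding Hy_def mult.assoc
      using q[OF rad_bounds(3)[OF ne(1)] rad_bounds(3)[OF ne(2)]] FH(3) by linarith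
  qed
  \<comment> \<open>1 / \<open>\<sigma>\<close> is W times the product of the two distances, each at
    most D. Hence W dominates 1 / \<open>\<sigma>\<close> and with it constants and the
    logarithm.\<close>
  have D\<sigma>: "D / \<sigma> z \<le> D^3 * W z" if z: "z \<in> \<Omega>" for z
  proof -
    have "D / \<sigma> z = D * (rad a z * rad b z) * W z" using rpos[OF z] by (simp add: W_def)
    also have "\<dots> \<le> D * (D * D) * W z"
      using bW[OF z] rpos[OF z] Wpos[OF z] D1 by (intro mult_right_mono mult_left_mono mult_mono) auto
    finally show ?thesis by (simp add: power3_eq_cube mult.assoc)
  qed
  have lnb: "- T z \<le> D / \<sigma> z" "T z \<le> 0" "1 \<le> D / \<sigma> z" if z: "z \<in> \<Omega>" for z
  proof -
    have "ln (D / \<sigma> z) \<le> D / \<sigma> z" using \<sigma>pos[OF z] D1 ln_bound[of "D / \<sigma> z"] by simp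
    then show "- T z \<le> D / \<sigma> z" using \<sigma>pos[OF z] D1 by (simp add: T_def ln_div)
    show "T z \<le> 0" "1 \<le> D / \<sigma> z" using \<sigma>pos[OF z] D1 bW[OF z] by (simp_all add: T_def)
  qed
  define C where "C = 2 * D + D^3 + 4 * D / L\<^sup>2"
  have Cb: "D \<le> C" "2 * D \<le> C" "D^3 \<le> C" "4 * D / L\<^sup>2 \<le> C" "C > 0"
    using D1 L by (auto simp: C_def add_pos_pos add_increasing add_increasing2)
  have up: "x \<le> C * W z" if "x \<le> e * W z" "e \<le> C" "z \<in> \<Omega>" for x e z
    using that Wpos[OF that(3)] by (meson mult_right_mono less_imp_le order_trans)
  have smr: "smooth \<Omega> (rad c)" if "c \<notin> \<Omega>" for c
    unfolding rad_def power2_eq_square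
  proof (rule smooth_compose[OF smooth_sqrt])
    show "smooth \<Omega> (\<lambda>z. (fst z - fst c) * (fst z - fst c) + (snd z - snd c) * (snd z - snd c))"
      by (intro smooth_add smooth_mult smooth_diff smooth_const smooth_bounded_linear bounded_linear_fst bounded_linear_snd)
    show "(\<lambda>z. (fst z - fst c) * (fst z - fst c) + (snd z - snd c) * (snd z - snd c)) ` \<Omega> \<subseteq> {0<..}"
    proof (rule image_subsetI)
      fix z assume "z \<in> \<Omega>"
      then have "rad c z > 0" using that rad_pos by metis
      then have "(rad c z)\<^sup>2 > 0" by simp
      then show "(fst z - fst c) * (fst z - fst c) + (snd z - snd c) * (snd z - snd c) \<in> {0<..}"
        unfolding rad_sq by (simp add: power2_eq_square)
    qed
  qed
  have smT: "smooth \<Omega> T" unfolding T_def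
  proof (intro smooth_diff smooth_const)
    show "smooth \<Omega> (\<lambda>z. ln (\<sigma> z))"
      by (rule smooth_compose[OF smooth_ln])
        (use \<sigma>pos in \<open>auto simp: \<sigma>_def intro!: smooth_diff smooth_add smr ab\<Omega>\<close>)
  qed
  have "barrier \<Omega> (closed_segment a b) T W C"
    unfolding barrier_def
  proof (intro conjI exI)
    show "partials_on \<Omega> T F H" "partials_on \<Omega> F F1 F2" "partials_on \<Omega> H F2 Hy" by fact+
    show "hardy \<Omega> W C" by (rule hardy_mono[OF hd Cb(4)])
    show "\<forall>z\<in>\<Omega>. (F z)\<^sup>2 + (H z)\<^sup>2 \<le> C * W z \<and> \<bar>F1 z\<bar> \<le> C * W z \<and> \<bar>F2 z\<bar> \<le> C * W z \<and> \<bar>Hy z\<bar> \<le> C * W z"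
      using up[OF sqD Cb(1)] up[OF second(1) Cb(2)] up[OF second(2) Cb(2)] up[OF second(3) Cb(2)] by blast
    show "\<forall>z\<in>\<Omega>. 0 \<le> W z \<and> 1 \<le> C * W z \<and> - T z \<le> C * W z \<and> T z \<le> 0"
      using up[OF order_trans[OF lnb(3) D\<sigma>] Cb(3)] up[OF order_trans[OF lnb(1) D\<sigma>] Cb(3)] lnb(2) Wpos by (meson less_imp_le)
    show "\<forall>c. \<exists>G. closed G \<and> G \<inter> closed_segment a b = {} \<and> (\<forall>z\<in>\<Omega>. - c \<le> T z \<longrightarrow> z \<in> G)"
    proof
      fix c
      \<comment> \<open>T \<ge> -c says precisely that \<open>\<sigma>\<close> is at least D
        exp(-c), a closed condition that fails on the segment, where \<open>\<sigma>\<close> is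
        zero.\<close>
      define G where "G = {z. D * exp (- c) \<le> \<sigma> z}"
      have "continuous_on UNIV \<sigma>" unfolding \<sigma>_def rad_def by (intro continuous_intros)
      then have "closed G" unfolding G_def by (intro closed_Collect_le continuous_on_const)
      moreover have "G \<inter> closed_segment a b = {}"
      proof -
        have "D * exp (- c) > 0" using D1 by simp
        then show ?thesis using \<sigma>0 by (force simp: G_def)
      qed
      moreover have "z \<in> G" if z: "z \<in> \<Omega>" "- c \<le> T z" for z
      proof -
        have "exp (ln D - c) \<le> exp (ln (\<sigma> z))" using z(2) by (simp add: T_def)
        then show ?thesis using \<sigma>pos[OF z(1)] D1 by (simp add: G_def exp_diff exp_minus divide_inverse)
      qed
      ultimately show "\<exists>G. closed G \<and> G \<inter> closed_segment a b = {} \<and> (\<forall>z\<in>\<Omega>. - c \<le> T z \<longrightarrow> z \<in> G)" by blast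
    qed
  qed (fact Cb smT cW)+
  then show ?thesis by blast
qed

section \<open>Control of the gradient\<close>

text \<open>Degenerate segments can be dropped: an isolated boundary point would be interior to the closure.\<close>

lemma polygonal_frontier_nondegenerate:
  assumes "polygonal_domain \<Omega>"
  obtains I :: "(pt \<times> pt) set" where "finite I" "I \<noteq> {}" "\<And>a b. (a, b) \<in> I \<Longrightarrow> a \<noteq> b"
    "frontier \<Omega> = (\<Union>(a, b)\<in>I. closed_segment a b)"
proof -
  have \<Omega>: "open \<Omega>" "bounded \<Omega>" "\<Omega> \<noteq> {}" "interior (closure \<Omega>) = \<Omega>" using assms by (simp_all add: polygonal_domain_def)
  obtain S :: "(pt \<times> pt) set" where S: "finite S" "frontier \<Omega> = (\<Union>(a, b)\<in>S. closed_segment a b)"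
    using assms unfolding polygonal_domain_def by blast
  define I where "I = {(a, b) \<in> S. a \<noteq> b}"
  define N where "N = (\<Union>(a, b)\<in>I. closed_segment a b)"
  define P where "P = fst ` S"
  have fin: "finite I" "finite P" using S(1) by (auto simp: I_def P_def intro: finite_subset[of _ S])
  have "closed N" unfolding N_def using fin by (intro closed_UN) auto
  have sub: "frontier \<Omega> \<subseteq> N \<union> P"
  proof
    fix p assume "p \<in> frontier \<Omega>"
    then obtain a b where ab: "(a, b) \<in> S" "p \<in> closed_segment a b" using S(2) by auto
    show "p \<in> N \<union> P"
    proof (cases "a = b")
      case True
      then show ?thesis using ab by (force simp: P_def)
    next
      case False
      then have "(a, b) \<in> I" using ab by (simp add: I_def)
      then show ?thesis using ab by (auto simp: N_def)
    qed
  qed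
  have "p \<in> N" if p: "p \<in> frontier \<Omega>" for p
  proof (rule ccontr)
    assume pN: "p \<notin> N"
    obtain e1 where e1: "e1 > 0" "ball p e1 \<subseteq> - N"
      using \<open>closed N\<close> pN open_contains_ball[of "- N"] by auto
    obtain e2 where e2: "e2 > 0" "\<And>x. x \<in> P \<Longrightarrow> x \<noteq> p \<Longrightarrow> e2 \<le> dist p x"
      using finite_set_avoid[OF fin(2)] by blast
    define e where "e = min e1 e2"
    have e: "e > 0" using e1 e2 by (simp add: e_def)
    have nofr: "(ball p e - {p}) \<inter> frontier \<Omega> = {}"
    proof -
      have "x \<notin> frontier \<Omega>" if "x \<in> ball p e" "x \<noteq> p" for x
      proof
        assume "x \<in> frontier \<Omega>"
        then have "x \<in> N \<union> P" using sub by blast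
        moreover have "x \<notin> N" using e1 that by (auto simp: e_def)
        moreover have "x \<notin> P" using e2(2)[of x] that by (auto simp: e_def)
        ultimately show False by blast
      qed
      then show ?thesis by blast
    qed
    \<comment> \<open>A punctured disc in the plane is connected, so without frontier points it lies
      inside the domain or misses it. Since p is a limit of domain points it lies inside, and then p
      is interior to the closure.\<close>
    have "connected (ball p e - {p})" by (rule connected_punctured_ball) simp
    then have dich: "(ball p e - {p}) \<inter> \<Omega> = {} \<or> ball p e - {p} \<subseteq> \<Omega>"
      using connected_Int_frontier[of "ball p e - {p}" \<Omega>] nofr by blast
    have p\<Omega>: "p \<notin> \<Omega>" using p \<Omega>(1) by (simp add: frontier_def interior_open)
    have pcl: "p \<in> closure \<Omega>" using p by (simp add: frontier_def)
    then obtain q where "q \<in> \<Omega>" "dist q p < e" using e closure_approachable by metis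
    then have "q \<in> (ball p e - {p}) \<inter> \<Omega>" using p\<Omega> by (auto simp: dist_commute)
    with dich have "ball p e - {p} \<subseteq> \<Omega>" by blast
    then have "ball p e \<subseteq> closure \<Omega>" using pcl closure_subset by blast
    then have "p \<in> interior (closure \<Omega>)" using e by (meson centre_in_ball interior_maximal open_ball subsetD)
    then show False using \<Omega>(4) p\<Omega> by simp
  qed
  then have "frontier \<Omega> \<subseteq> N" by (rule subsetI)
  moreover have "N \<subseteq> frontier \<Omega>" unfolding N_def S(2) by (rule UN_mono) (auto simp: I_def)
  ultimately have fr: "frontier \<Omega> = N" by (rule equalityI)
  have "frontier \<Omega> \<noteq> {}" using \<Omega> frontier_eq_empty[of \<Omega>] not_bounded_UNIV by blast
  then have "I \<noteq> {}" using fr by (auto simp: N_def)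
  moreover have "a \<noteq> b" if "(a, b) \<in> I" for a b using that by (simp add: I_def)
  ultimately show ?thesis using that[OF fin(1)] fr unfolding N_def by blast
qed

lemma polygonal_barrier:
  assumes "polygonal_domain \<Omega>"
  shows "\<exists>T W C. barrier \<Omega> (frontier \<Omega>) T W C"
proof -
  have \<Omega>: "open \<Omega>" "bounded \<Omega>" using assms by (simp_all add: polygonal_domain_def)
  obtain I :: "(pt \<times> pt) set" where I: "finite I" "I \<noteq> {}" "\<And>a b. (a, b) \<in> I \<Longrightarrow> a \<noteq> b"
    "frontier \<Omega> = (\<Union>(a, b)\<in>I. closed_segment a b)"
    using polygonal_frontier_nondegenerate[OF assms] by blast
  have "\<exists>T W C. barrier \<Omega> (\<Union>(a, b)\<in>J. closed_segment a b) T W C" if "J \<subseteq> I" "J \<noteq> {}" "finite J" for J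
    using that(3,2,1)
  proof (induction J rule: finite_ne_induct)
    case (singleton s)
    obtain a b where s: "s = (a, b)" using surj_pair[of s] by blast
    have "closed_segment a b \<subseteq> frontier \<Omega>" using I(4) singleton s by auto
    then have "closed_segment a b \<inter> \<Omega> = {}" using \<Omega> by (auto simp: frontier_def interior_open)
    then have "\<exists>T W C. barrier \<Omega> (closed_segment a b) T W C" using segment_barrier[OF \<Omega> I(3)] singleton s by simp
    then show ?case by (simp add: s)
  next
    case (insert s J)
    obtain a b where s: "s = (a, b)" using surj_pair[of s] by blast
    have "closed_segment a b \<subseteq> frontier \<Omega>" using I(4) insert s by auto
    then have "closed_segment a b \<inter> \<Omega> = {}" using \<Omega> by (auto simp: frontier_def interior_open)
    then have "\<exists>T W C. barrier \<Omega> (closed_segment a b) T W C" using segment_barrier[OF \<Omega> I(3)] insert.prems s by simp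
    then obtain T W C where 1: "barrier \<Omega> (closed_segment a b) T W C" by (elim exE)
    have "J \<subseteq> I" using insert.prems by simp
    from insert.IH[OF this] obtain T' W' C' where 2: "barrier \<Omega> (\<Union>(a, b)\<in>J. closed_segment a b) T' W' C'" by (elim exE)
    have "(\<Union>(a, b)\<in>insert s J. closed_segment a b) = closed_segment a b \<union> (\<Union>(a, b)\<in>J. closed_segment a b)" by (simp add: s)
    then show ?case using barrier_add[OF \<Omega>(1) 1 2] by metis
  qed
  from this[of I] I show ?thesis by auto
qed

lemma partials_on_local:
  assumes "open U" "partials_on U F G H" "\<And>z. z \<in> U \<Longrightarrow> F' z = F z" "z \<in> U"
  shows "px F' z = G z" "py F' z = H z"
proof -
  obtain x y where z: "z = (x, y)" by fastforce
  have o: "open ((\<lambda>t. (t, y)) -` U)" "open ((\<lambda>t. (x, t)) -` U)"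
    using assms(1) by (auto intro!: open_vimage continuous_intros)
  have "((\<lambda>t. F' (t, y)) has_field_derivative G (x, y)) (at x)"
    by (rule has_field_derivative_transform_within_open[OF partials_onD(1)[OF assms(2)] o(1)]) (use assms z in auto)
  moreover have "((\<lambda>t. F' (x, t)) has_field_derivative H (x, y)) (at y)"
    by (rule has_field_derivative_transform_within_open[OF partials_onD(2)[OF assms(2)] o(2)]) (use assms z in auto)
  ultimately show "px F' z = G z" "py F' z = H z" using z px_eqI[of F'] py_eqI[of F'] by auto
qed

lemma partials_on_mult:
  "partials_on U F G H \<Longrightarrow> partials_on U F' G' H' \<Longrightarrow>
    partials_on U (\<lambda>z. F z * F' z) (\<lambda>z. G z * F' z + F z * G' z) (\<lambda>z. H z * F' z + F z * H' z)"
  unfolding partials_on_def using DERIV_mult by (fastforce simp: algebra_simps)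

lemma partials_on_compose:
  assumes "\<And>t. (h has_field_derivative h' t) (at t)" "partials_on U F G H"
  shows "partials_on U (\<lambda>z. h (F z)) (\<lambda>z. h' (F z) * G z) (\<lambda>z. h' (F z) * H z)"
  using assms(2) unfolding partials_on_def
  by (auto intro!: DERIV_chain2[where f = h] assms(1))

context sobolev_domain
begin

text \<open>The test function is \<open>\<psi> = \<eta> |z|\<^sup>2 / 2\<close> with a logarithmic cut-off \<open>\<eta>\<close>: its Hessian is the
  identity up to \<open>O(\<epsilon> W)\<close>, and the error is absorbed by Hardy's inequality for \<open>Du\<close>.\<close>

lemma gradient_control:
  assumes bar: "barrier \<Omega> (frontier \<Omega>) T W C" and \<delta>: "\<delta> > 0"
  obtains \<psi> where "test_fun \<Omega> \<psi>"
    "\<And>u. test_fun \<Omega> u \<Longrightarrow> (\<integral>z. (px u z)\<^sup>2 + (py u z)\<^sup>2 \<partial>lborel) \<le> 2 * bform \<Omega> u u \<psi> + \<delta> * aform \<Omega> u u"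
proof -
  obtain T1 T2 T11 T12 T22 where T: "partials_on \<Omega> T T1 T2" "partials_on \<Omega> T1 T11 T12" "partials_on \<Omega> T2 T12 T22"
    "\<And>z. z \<in> \<Omega> \<Longrightarrow> (T1 z)\<^sup>2 + (T2 z)\<^sup>2 \<le> C * W z \<and> \<bar>T11 z\<bar> \<le> C * W z \<and> \<bar>T12 z\<bar> \<le> C * W z \<and> \<bar>T22 z\<bar> \<le> C * W z"
    using bar unfolding barrier_def by blast
  have C: "C > 0" and smT: "smooth \<Omega> T" and cW: "continuous_on \<Omega> W" and hd: "hardy \<Omega> W C"
    using bar by (simp_all add: barrier_def)
  have B: "0 \<le> W z" "1 \<le> C * W z" "- T z \<le> C * W z" if "z \<in> \<Omega>" for z
    using bar that unfolding barrier_def by blast+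
  obtain h h1 h2 :: "real \<Rightarrow> real" and Ch where h: "smooth UNIV h"
    "\<And>t. t \<le> 0 \<Longrightarrow> h t = 0" "\<And>t. t \<ge> 1 \<Longrightarrow> h t = 1" "\<And>t. 0 \<le> h t" "\<And>t. h t \<le> 1"
    "\<And>t. (h has_field_derivative h1 t) (at t)" "\<And>t. (h1 has_field_derivative h2 t) (at t)"
    "\<And>t. \<bar>h1 t\<bar> \<le> Ch" "\<And>t. \<bar>h2 t\<bar> \<le> Ch"
    using smooth_step_exists by blast
  have Ch: "Ch \<ge> 0" using h(8)[of 0] by linarith
  obtain R0 where R0: "\<And>z. z \<in> \<Omega> \<Longrightarrow> norm z \<le> R0" using bounded_\<Omega> by (auto simp: bounded_iff)
  define R where "R = \<bar>R0\<bar>"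
  have R: "\<bar>fst z\<bar> \<le> R" "\<bar>snd z\<bar> \<le> R" if "z \<in> \<Omega>" for z
    using R0[OF that] norm_fst_le[of "fst z" "snd z"] norm_snd_le[of "snd z" "fst z"] by (auto simp: R_def)
  have R0': "R \<ge> 0" by (simp add: R_def)
  \<comment> \<open>Collects the later error terms: derivatives of the cut-off of either order are
    at most 2 Ch \<epsilon> C W, they are multiplied by q (at most R^2) or twice by a coordinate (at
    most R), and the defect of \<open>\<eta>\<close> from 1 adds \<epsilon> C W.\<close>
  define m where "m = C * (2 * Ch * R\<^sup>2 + 4 * Ch * R + 1)"
  have m: "m > 0" unfolding m_def using C Ch R0' by (intro mult_pos_pos add_nonneg_pos) auto
  \<comment> \<open>After Hardy's inequality the total error is 2 \<epsilon> m C times the energy,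
    to be at most \<delta>. The bound by 1 lets \<epsilon>^2 be replaced by \<epsilon> in the terms
    quadratic in DT.\<close>
  define \<epsilon> where "\<epsilon> = min 1 (\<delta> / (2 * m * C))"
  have \<epsilon>: "0 < \<epsilon>" "\<epsilon> \<le> 1" "\<epsilon> * (2 * m * C) \<le> \<delta>"
  proof -
    have p: "2 * m * C > 0" using m C by simp
    show "0 < \<epsilon>" "\<epsilon> \<le> 1" using p \<delta> by (simp_all add: \<epsilon>_def)
    have "\<epsilon> \<le> \<delta> / (2 * m * C)" by (simp add: \<epsilon>_def)
    then show "\<epsilon> * (2 * m * C) \<le> \<delta>" using p by (simp only: pos_le_divide_eq)
  qed
  \<comment> \<open>Thus \<open>\<eta>\<close> vanishes where T \<le> -2/\<epsilon>, near the
    boundary, and equals 1 where T \<ge> -1/\<epsilon>.\<close>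
  define s where "s = (\<lambda>z. \<epsilon> * T z + 2)"
  define \<eta> where "\<eta> = (\<lambda>z. h (s z))"
  define q where "q = (\<lambda>z::pt. ((fst z)\<^sup>2 + (snd z)\<^sup>2) / 2)"
  define \<psi> where "\<psi> = (\<lambda>z. if z \<in> \<Omega> then \<eta> z * q z else 0)"
  obtain G where G: "closed G" "G \<inter> frontier \<Omega> = {}" "\<And>z. z \<in> \<Omega> \<Longrightarrow> - (2 / \<epsilon>) \<le> T z \<Longrightarrow> z \<in> G"
    using bar unfolding barrier_def by blast
  \<comment> \<open>The barrier only supplies a closed set off the frontier; intersected with the
    bounded closure of the domain it becomes a compact subset that carries the support of
    \<open>\<psi>\<close>.\<close>
  define K where "K = closure \<Omega> \<inter> G"
  have K: "compact K" "K \<subseteq> \<Omega>"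
  proof -
    show "compact K" unfolding K_def using bounded_\<Omega> G(1) by (simp add: compact_Int_closed)
    show "K \<subseteq> \<Omega>" using G(2) open_\<Omega> by (auto simp: K_def frontier_def interior_open)
  qed
  have \<psi>0: "\<psi> z = 0" if "z \<notin> K" for z
  proof (cases "z \<in> \<Omega>")
    case True
    then have "z \<notin> G" using that closure_subset by (auto simp: K_def)
    then have "T z < - (2 / \<epsilon>)" using G(3)[OF True] by force
    then have "\<epsilon> * T z < \<epsilon> * - (2 / \<epsilon>)" using \<epsilon>(1) by (rule mult_strict_left_mono)
    then have "s z \<le> 0" using \<epsilon> by (simp add: s_def)
    then show ?thesis by (simp add: \<psi>_def \<eta>_def h(2))
  qed (simp add: \<psi>_def)
  have sm\<psi>: "smooth UNIV \<psi>"
  proof -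
    have "smooth \<Omega> (\<lambda>z. \<eta> z * q z)"
      unfolding \<eta>_def s_def q_def power2_eq_square divide_inverse
      by (intro smooth_mult smooth_compose[OF h(1)] smooth_add smooth_const smT smooth_bounded_linear bounded_linear_fst bounded_linear_snd) auto
    then have 1: "smooth \<Omega> \<psi>" by (rule smooth_cong[OF open_\<Omega>]) (simp add: \<psi>_def)
    have o: "open (- K)" using K compact_imp_closed by blast
    have 2: "smooth (- K) \<psi>" by (rule smooth_cong[OF o smooth_const[of _ 0]]) (simp add: \<psi>0)
    have "\<Omega> \<union> - K = UNIV" using K by auto
    then show ?thesis using smooth_Un[OF open_\<Omega> o 1 2] by simp
  qed
  have tf: "test_fun \<Omega> \<psi>"
  proof -
    have sub: "{z. \<psi> z \<noteq> 0} \<subseteq> K" using \<psi>0 by blast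
    have c: "closure {z. \<psi> z \<noteq> 0} \<subseteq> K" by (rule closure_minimal[OF sub compact_imp_closed[OF K(1)]])
    have "compact (closure {z. \<psi> z \<noteq> 0})"
      using bounded_subset[OF compact_imp_bounded[OF K(1)] sub] by (simp only: compact_closure)
    then show ?thesis using c K smooth_imp_smooth2[OF sm\<psi>] by (auto simp: test_fun_def)
  qed
  define E1 where "E1 = (\<lambda>z. h1 (s z) * (\<epsilon> * T1 z))"
  define E2 where "E2 = (\<lambda>z. h1 (s z) * (\<epsilon> * T2 z))"
  define E11 where "E11 = (\<lambda>z. h2 (s z) * (\<epsilon> * T1 z) * (\<epsilon> * T1 z) + h1 (s z) * (\<epsilon> * T11 z))"
  define E12 where "E12 = (\<lambda>z. h2 (s z) * (\<epsilon> * T2 z) * (\<epsilon> * T1 z) + h1 (s z) * (\<epsilon> * T12 z))"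
  define E22 where "E22 = (\<lambda>z. h2 (s z) * (\<epsilon> * T2 z) * (\<epsilon> * T2 z) + h1 (s z) * (\<epsilon> * T22 z))"
  have cst: "partials_on \<Omega> (\<lambda>z. c * F z + d) (\<lambda>z. c * Gx z) (\<lambda>z. c * Gy z)" if "partials_on \<Omega> F Gx Gy" for F Gx Gy c d
  proof (rule partials_onI)
    fix x y assume z: "(x, y) \<in> \<Omega>"
    show "((\<lambda>t. c * F (t, y) + d) has_field_derivative c * Gx (x, y)) (at x)"
      using DERIV_add[OF DERIV_cmult[OF partials_onD(1)[OF that z], of c] DERIV_const[of d]] by simp
    show "((\<lambda>t. c * F (x, t) + d) has_field_derivative c * Gy (x, y)) (at y)"
      using DERIV_add[OF DERIV_cmult[OF partials_onD(2)[OF that z], of c] DERIV_const[of d]] by simp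
  qed
  have ps: "partials_on \<Omega> s (\<lambda>z. \<epsilon> * T1 z) (\<lambda>z. \<epsilon> * T2 z)" unfolding s_def by (rule cst[OF T(1)])
  have pT1: "partials_on \<Omega> (\<lambda>z. \<epsilon> * T1 z) (\<lambda>z. \<epsilon> * T11 z) (\<lambda>z. \<epsilon> * T12 z)" using cst[OF T(2), of \<epsilon> 0] by simp
  have pT2: "partials_on \<Omega> (\<lambda>z. \<epsilon> * T2 z) (\<lambda>z. \<epsilon> * T12 z) (\<lambda>z. \<epsilon> * T22 z)" using cst[OF T(3), of \<epsilon> 0] by simp
  have p\<eta>: "partials_on \<Omega> \<eta> E1 E2" unfolding \<eta>_def E1_def E2_def by (rule partials_on_compose[OF h(6) ps])
  have pE1: "partials_on \<Omega> E1 E11 E12"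
    unfolding E1_def E11_def E12_def by (rule partials_on_mult[OF partials_on_compose[OF h(7) ps] pT1])
  have "partials_on \<Omega> E2 (\<lambda>z. h2 (s z) * (\<epsilon> * T1 z) * (\<epsilon> * T2 z) + h1 (s z) * (\<epsilon> * T12 z)) E22"
    unfolding E2_def E22_def by (rule partials_on_mult[OF partials_on_compose[OF h(7) ps] pT2])
  moreover have "(\<lambda>z. h2 (s z) * (\<epsilon> * T1 z) * (\<epsilon> * T2 z) + h1 (s z) * (\<epsilon> * T12 z)) = E12"
    by (simp add: E12_def fun_eq_iff)
  ultimately have pE2: "partials_on \<Omega> E2 E12 E22" by simp
  have pf: "partials_on \<Omega> fst (\<lambda>_. 1) (\<lambda>_. 0)" "partials_on \<Omega> snd (\<lambda>_. 0) (\<lambda>_. 1)"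
    by (simp_all add: partials_on_def)
  have pq: "partials_on \<Omega> q fst snd" unfolding q_def partials_on_def by (auto intro!: derivative_eq_intros)
  define \<psi>1 where "\<psi>1 = (\<lambda>z. E1 z * q z + \<eta> z * fst z)"
  define \<psi>2 where "\<psi>2 = (\<lambda>z. E2 z * q z + \<eta> z * snd z)"
  have p0: "partials_on \<Omega> (\<lambda>z. \<eta> z * q z) \<psi>1 \<psi>2" unfolding \<psi>1_def \<psi>2_def by (rule partials_on_mult[OF p\<eta> pq])
  note p1 = partials_on_add[OF partials_on_mult[OF pE1 pq] partials_on_mult[OF p\<eta> pf(1)], folded \<psi>1_def]
  note p2 = partials_on_add[OF partials_on_mult[OF pE2 pq] partials_on_mult[OF p\<eta> pf(2)], folded \<psi>2_def]
  have d1: "px \<psi> z = \<psi>1 z" "py \<psi> z = \<psi>2 z" if "z \<in> \<Omega>" for z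
    by (rule partials_on_local[OF open_\<Omega> p0 _ that]; simp add: \<psi>_def)+
  have d2: "px (px \<psi>) z - 1 = E11 z * q z + 2 * (E1 z * fst z) + (\<eta> z - 1)"
     "px (py \<psi>) z = E12 z * q z + E1 z * snd z + E2 z * fst z"
     "py (py \<psi>) z - 1 = E22 z * q z + 2 * (E2 z * snd z) + (\<eta> z - 1)" if "z \<in> \<Omega>" for z
    using partials_on_local(1)[OF open_\<Omega> p1 d1(1) that] partials_on_local[OF open_\<Omega> p2 d1(2) that] by simp_all
  have near: "\<bar>px (px \<psi>) z - 1\<bar> \<le> \<epsilon> * m * W z" "\<bar>px (py \<psi>) z\<bar> \<le> \<epsilon> * m * W z" "\<bar>py (py \<psi>) z - 1\<bar> \<le> \<epsilon> * m * W z" if z: "z \<in> \<Omega>" for z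
  proof -
    define w where "w = C * W z"
    note t = T(4)[OF z, folded w_def]
    note b = B[OF z, folded w_def]
    \<comment> \<open>Even the undifferentiated defect is paid for by the weight: where the cut-off
      is not yet 1, the logarithm is at least 1/\<epsilon> in size and W dominates it.\<close>
    have a1: "\<bar>\<eta> z - 1\<bar> \<le> \<epsilon> * w"
    proof (cases "s z \<ge> 1")
      case True
      then show ?thesis using h(3) b(2) \<epsilon>(1) by (simp add: \<eta>_def)
    next
      case False
      then have "1 \<le> \<epsilon> * (- T z)" by (simp add: s_def)
      also have "\<dots> \<le> \<epsilon> * w" using \<epsilon>(1) b(3) by (intro mult_left_mono) auto
      finally show ?thesis using h(4)[of "s z"] h(5)[of "s z"] unfolding \<eta>_def by linarith
    qed
    have lin: "\<bar>h1 (s z) * (\<epsilon> * x)\<bar> \<le> Ch * \<epsilon> * c" if "\<bar>x\<bar> \<le> c" for x c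
    proof -
      have "\<bar>h1 (s z) * (\<epsilon> * x)\<bar> = \<bar>h1 (s z)\<bar> * (\<epsilon> * \<bar>x\<bar>)" using \<epsilon>(1) by (simp add: abs_mult)
      also have "\<dots> \<le> Ch * (\<epsilon> * c)" using h(8) Ch \<epsilon>(1) that by (intro mult_mono) auto
      finally show ?thesis by simp
    qed
    have qd: "\<bar>h2 (s z) * (\<epsilon> * x) * (\<epsilon> * y)\<bar> \<le> Ch * \<epsilon> * w" if "\<bar>x * y\<bar> \<le> w" for x y
    proof -
      have "\<bar>h2 (s z) * (\<epsilon> * x) * (\<epsilon> * y)\<bar> = \<bar>h2 (s z)\<bar> * (\<epsilon> * (\<epsilon> * \<bar>x * y\<bar>))" using \<epsilon>(1) by (simp add: abs_mult)
      also have "\<dots> \<le> Ch * (\<epsilon> * (1 * w))" using h(9) Ch \<epsilon> that b by (intro mult_mono) auto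
      finally show ?thesis by simp
    qed
    have xy: "\<bar>T1 z * T1 z\<bar> \<le> w" "\<bar>T2 z * T2 z\<bar> \<le> w" "\<bar>T2 z * T1 z\<bar> \<le> w"
    proof -
      show "\<bar>T1 z * T1 z\<bar> \<le> w" "\<bar>T2 z * T2 z\<bar> \<le> w"
        using t zero_le_power2[of "T1 z"] zero_le_power2[of "T2 z"] unfolding power2_eq_square by linarith+
      have "0 \<le> \<bar>T2 z\<bar> * \<bar>T1 z\<bar>" by simp
      then show "\<bar>T2 z * T1 z\<bar> \<le> w"
        using t sum_squares_bound[of "\<bar>T2 z\<bar>" "\<bar>T1 z\<bar>"] unfolding abs_mult power2_abs mult.assoc by linarith
    qed
    \<comment> \<open>The barrier bounds only the square of the gradient; since w \<ge> 1, the first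
      power is bounded by a multiple of w as well.\<close>
    have one: "\<bar>x\<bar> \<le> 2 * w" if "x\<^sup>2 \<le> w" for x
      using sum_squares_bound[of "\<bar>x\<bar>" 1] that b(2) by simp
    have E1b: "\<bar>E1 z\<bar> \<le> Ch * \<epsilon> * (2 * w)" "\<bar>E2 z\<bar> \<le> Ch * \<epsilon> * (2 * w)"
      unfolding E1_def E2_def using t zero_le_power2[of "T1 z"] zero_le_power2[of "T2 z"] by (intro lin one; linarith)+
    have E2b: "\<bar>E11 z\<bar> \<le> Ch * \<epsilon> * (2 * w)" "\<bar>E12 z\<bar> \<le> Ch * \<epsilon> * (2 * w)" "\<bar>E22 z\<bar> \<le> Ch * \<epsilon> * (2 * w)"
    proof -
      have sum2: "\<bar>x + y\<bar> \<le> Ch * \<epsilon> * (2 * w)" if "\<bar>x\<bar> \<le> Ch * \<epsilon> * w" "\<bar>y\<bar> \<le> Ch * \<epsilon> * w" for x y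
        using order_trans[OF abs_triangle_ineq add_mono[OF that]] by simp
      show "\<bar>E11 z\<bar> \<le> Ch * \<epsilon> * (2 * w)" unfolding E11_def by (rule sum2[OF qd[OF xy(1)] lin]) (use t in blast)
      show "\<bar>E12 z\<bar> \<le> Ch * \<epsilon> * (2 * w)" unfolding E12_def by (rule sum2[OF qd[OF xy(3)] lin]) (use t in blast)
      show "\<bar>E22 z\<bar> \<le> Ch * \<epsilon> * (2 * w)" unfolding E22_def by (rule sum2[OF qd[OF xy(2)] lin]) (use t in blast)
    qed
    have qb: "\<bar>q z\<bar> \<le> R\<^sup>2"
    proof -
      have "(fst z)\<^sup>2 \<le> R\<^sup>2" "(snd z)\<^sup>2 \<le> R\<^sup>2" using R[OF z] R0' by (simp_all add: abs_le_square_iff[symmetric])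
      then show ?thesis by (simp add: q_def)
    qed
    define k where "k = Ch * \<epsilon> * (2 * w)"
    have k: "k \<ge> 0" using Ch \<epsilon> b by (simp add: k_def)
    have pr: "\<bar>E * x\<bar> \<le> k * c" if "\<bar>E\<bar> \<le> k" "\<bar>x\<bar> \<le> c" for E x c
      unfolding abs_mult using that k by (intro mult_mono) auto
    have "k * R\<^sup>2 + 2 * (k * R) + \<epsilon> * w = \<epsilon> * m * W z" unfolding k_def w_def m_def by algebra
    moreover have "0 \<le> \<epsilon> * w" using \<epsilon>(1) b(2) by simp
    ultimately have fin: "k * R\<^sup>2 + 2 * (k * R) + \<epsilon> * w = \<epsilon> * m * W z" "0 \<le> \<epsilon> * w" .
    note E = E1b[folded k_def] E2b[folded k_def]
    show "\<bar>px (px \<psi>) z - 1\<bar> \<le> \<epsilon> * m * W z" unfolding d2[OF z] fin(1)[symmetric]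
      using pr[OF E(3) qb] pr[OF E(1) R(1)[OF z]] a1 by linarith
    show "\<bar>px (py \<psi>) z\<bar> \<le> \<epsilon> * m * W z" unfolding d2[OF z] fin(1)[symmetric]
      using pr[OF E(4) qb] pr[OF E(1) R(2)[OF z]] pr[OF E(2) R(1)[OF z]] fin(2) by linarith
    show "\<bar>py (py \<psi>) z - 1\<bar> \<le> \<epsilon> * m * W z" unfolding d2[OF z] fin(1)[symmetric]
      using pr[OF E(5) qb] pr[OF E(2) R(2)[OF z]] a1 by linarith
  qed
  show ?thesis
  proof (rule that[OF tf])
    fix u assume u: "test_fun \<Omega> u"
    note cu = test_fun_continuous2[OF u] and c\<psi> = test_fun_continuous2[OF tf]
    let ?B = "\<lambda>z. px (px \<psi>) z * (py u z * py u z) + py (py \<psi>) z * (px u z * px u z) - px (py \<psi>) z * (px u z * py u z + py u z * px u z)"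
    let ?g = "\<lambda>z. (px u z)\<^sup>2 + (py u z)\<^sup>2"
    define Ku where "Ku = closure {z. u z \<noteq> 0}"
    have Ku: "compact Ku" "Ku \<subseteq> \<Omega>" using u by (simp_all add: test_fun_def Ku_def)
    have u0: "px u z = 0" "py u z = 0" if "z \<notin> Ku" for z
      using test_fun_pds_support[OF u, of "[True]" z] test_fun_pds_support[OF u, of "[False]" z] that by (auto simp: Ku_def)
    \<comment> \<open>Symmetry puts the second derivatives on \<open>\<psi>\<close>. Where its
      Hessian is the identity, the integrand of \<open>2 b(\<psi>,u,u)\<close> is |Du|^2.\<close>
    have "bform \<Omega> u u \<psi> = bform \<Omega> \<psi> u u"
      using bform_sym23[OF H20_test_fun[OF u] H20_test_fun[OF u] H20_test_fun[OF tf]] bform_sym12[of u \<psi> u] by simp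
    then have b: "2 * bform \<Omega> u u \<psi> = integral\<^sup>L lborel ?B" using bform_test_fun[OF tf u u] by simp
    have iB: "integrable lborel ?B"
      by (rule integrable_in_\<Omega>(1)) (intro continuous_intros cu c\<psi>, use test_fun_outside2[OF u] in simp)
    have ig: "integrable lborel ?g"
      by (rule integrable_in_\<Omega>(1)) (intro continuous_intros cu, use test_fun_outside2[OF u] in simp)
    have iW: "integrable lborel (\<lambda>z. (px u z)\<^sup>2 * W z)" "integrable lborel (\<lambda>z. (py u z)\<^sup>2 * W z)"
      by (rule integrable_localized[OF open_\<Omega> Ku _ _ cW]; use u0 cu in \<open>auto intro!: continuous_intros\<close>)+
    have "integral\<^sup>L lborel ?g \<le> (\<integral>z. ?B z + 2 * \<epsilon> * m * ((px u z)\<^sup>2 * W z + (py u z)\<^sup>2 * W z) \<partial>lborel)"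
    proof (rule integral_mono[OF ig])
      show "integrable lborel (\<lambda>z. ?B z + 2 * \<epsilon> * m * ((px u z)\<^sup>2 * W z + (py u z)\<^sup>2 * W z))"
        using iB iW by simp
      fix z
      show "?g z \<le> ?B z + 2 * \<epsilon> * m * ((px u z)\<^sup>2 * W z + (py u z)\<^sup>2 * W z)"
      proof (cases "z \<in> \<Omega>")
        case False
        then show ?thesis using test_fun_outside2[OF u] by simp
      next
        case True
        define X Y k where "X = px u z" "Y = py u z" "k = \<epsilon> * m * W z"
        note d = this
        have k: "\<bar>px (px \<psi>) z - 1\<bar> \<le> k" "\<bar>px (py \<psi>) z\<bar> \<le> k" "\<bar>py (py \<psi>) z - 1\<bar> \<le> k" using near[OF True] by (simp_all add: d)
        have "(1 - k) * Y\<^sup>2 \<le> px (px \<psi>) z * Y\<^sup>2" "(1 - k) * X\<^sup>2 \<le> py (py \<psi>) z * X\<^sup>2"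
          using k by (intro mult_right_mono; simp)+
        moreover have "px (py \<psi>) z * (2 * X * Y) \<le> k * (X\<^sup>2 + Y\<^sup>2)"
        proof -
          have "px (py \<psi>) z * (2 * X * Y) \<le> \<bar>px (py \<psi>) z\<bar> * \<bar>2 * X * Y\<bar>" by (metis abs_ge_self abs_mult)
          also have "\<dots> \<le> k * (X\<^sup>2 + Y\<^sup>2)"
            using k(2) sum_squares_bound[of "\<bar>X\<bar>" "\<bar>Y\<bar>"] by (intro mult_mono) (auto simp: abs_mult)
          finally show ?thesis .
        qed
        ultimately have "X\<^sup>2 + Y\<^sup>2 \<le> (px (px \<psi>) z * Y\<^sup>2 + py (py \<psi>) z * X\<^sup>2 - px (py \<psi>) z * (2 * X * Y)) + 2 * (k * X\<^sup>2 + k * Y\<^sup>2)"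
          by (simp add: algebra_simps)
        then show ?thesis by (simp add: d power2_eq_square algebra_simps)
      qed
    qed
    also have "\<dots> = 2 * bform \<Omega> u u \<psi> + 2 * \<epsilon> * m * ((\<integral>z. (px u z)\<^sup>2 * W z \<partial>lborel) + (\<integral>z. (py u z)\<^sup>2 * W z \<partial>lborel))"
      unfolding b using iB iW by simp
    also have "\<dots> \<le> 2 * bform \<Omega> u u \<psi> + 2 * \<epsilon> * m * (C * aform \<Omega> u u)"
    proof -
      have C1u: "C1 (px u)" "C1 (py u)" using test_fun_C1[OF u, of "[True]"] test_fun_C1[OF u, of "[False]"] by simp_all
      have i2: "integrable lborel (\<lambda>z. (px (px u) z)\<^sup>2 + (py (px u) z)\<^sup>2)"
        by (rule integrable_in_\<Omega>(1)) (intro continuous_intros cu, use test_fun_outside2[OF u] in simp)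
      have i3: "integrable lborel (\<lambda>z. (px (py u) z)\<^sup>2 + (py (py u) z)\<^sup>2)"
        by (rule integrable_in_\<Omega>(1)) (intro continuous_intros cu, use test_fun_outside2[OF u] in simp)
      \<comment> \<open>Hardy's inequality is applied to each component of Du rather than to u, so
        that the right-hand side is the second-order energy.\<close>
      have "(\<integral>z. (px u z)\<^sup>2 * W z \<partial>lborel) \<le> C * (\<integral>z. (px (px u) z)\<^sup>2 + (py (px u) z)\<^sup>2 \<partial>lborel)"
        "(\<integral>z. (py u z)\<^sup>2 * W z \<partial>lborel) \<le> C * (\<integral>z. (px (py u) z)\<^sup>2 + (py (py u) z)\<^sup>2 \<partial>lborel)"
        using hd[unfolded hardy_def, rule_format, OF C1u(1) Ku u0(1)] hd[unfolded hardy_def, rule_format, OF C1u(2) Ku u0(2)] by simp_all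
      moreover have "aform \<Omega> u u = (\<integral>z. (px (px u) z)\<^sup>2 + (py (px u) z)\<^sup>2 \<partial>lborel) + (\<integral>z. (px (py u) z)\<^sup>2 + (py (py u) z)\<^sup>2 \<partial>lborel)"
        unfolding aform_test_fun[OF u] Bochner_Integration.integral_add[OF i2 i3, symmetric] by (simp add: algebra_simps)
      ultimately have "(\<integral>z. (px u z)\<^sup>2 * W z \<partial>lborel) + (\<integral>z. (py u z)\<^sup>2 * W z \<partial>lborel) \<le> C * aform \<Omega> u u"
        by (simp add: distrib_left)
      then show ?thesis using \<epsilon> m by (intro add_left_mono mult_left_mono) auto
    qed
    also have "\<dots> \<le> 2 * bform \<Omega> u u \<psi> + \<delta> * aform \<Omega> u u"
    proof -
      have "\<epsilon> * (2 * m * C) * aform \<Omega> u u \<le> \<delta> * aform \<Omega> u u" using \<epsilon>(3) aform_nonneg by (rule mult_right_mono)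
      then show ?thesis by (simp add: algebra_simps)
    qed
    finally show "integral\<^sup>L lborel ?g \<le> 2 * bform \<Omega> u u \<psi> + \<delta> * aform \<Omega> u u" .
  qed
qed

end

section \<open>Solutions of the obstacle problem\<close>

context bounded_domain
begin

section \<open>The pairing with f and the Friedrichs constant\<close>

lemma l2norm_nonneg: "l2norm \<Omega> f \<ge> 0"
  unfolding l2norm_def by (intro real_sqrt_ge_zero II_nonneg) simp

lemma l2norm_sq: "(l2norm \<Omega> f)\<^sup>2 = II (\<lambda>z. (f z)\<^sup>2)"
  unfolding l2norm_def by (intro real_sqrt_pow2 II_nonneg) simp

lemma l2ip_Cauchy_Schwarz:
  assumes "L2 \<Omega> f" "L2 \<Omega> g"
  shows "\<bar>l2ip \<Omega> f g\<bar> \<le> l2norm \<Omega> f * l2norm \<Omega> g"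
proof -
  have "2 * \<bar>l2ip \<Omega> f g\<bar> \<le> 2 * l2norm \<Omega> f * l2norm \<Omega> g"
  proof (rule mult_le_if_weighted)
    fix t :: real assume t: "t > 0"
    note i = set_integrable_mult_right[of t lebesgue \<Omega>, OF L2_sq[OF assms(1)]]
      set_integrable_mult_right[of "1 / t" lebesgue \<Omega>, OF L2_sq[OF assms(2)]]
    have yng: "2 * \<bar>a * b\<bar> \<le> t * a\<^sup>2 + (1 / t) * b\<^sup>2" for a b :: real
    proof -
      have "0 \<le> (t * \<bar>a\<bar> - \<bar>b\<bar>)\<^sup>2 / t" using t by simp
      also have "\<dots> = t * a\<^sup>2 + (1 / t) * b\<^sup>2 - 2 * \<bar>a * b\<bar>"
        using t by (simp add: power2_eq_square field_simps abs_mult)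
      finally show ?thesis by simp
    qed
    have "2 * \<bar>II (\<lambda>z. f z * g z)\<bar> \<le> 2 * II (\<lambda>z. \<bar>f z * g z\<bar>)"
      using integral_norm_bound[of lebesgue "\<lambda>z. indicator \<Omega> z *\<^sub>R (f z * g z)"]
      by (simp add: set_lebesgue_integral_def abs_mult)
    also have "\<dots> = II (\<lambda>z. 2 * \<bar>f z * g z\<bar>)" by simp
    also have "\<dots> \<le> II (\<lambda>z. t * (f z)\<^sup>2 + (1 / t) * (g z)\<^sup>2)"
      by (rule II_mono_AE[OF _ set_integral_add(1)[OF i]])
        (use L2_mult_integrable[OF assms] yng in \<open>auto intro!: set_integrable_mult_right set_integrable_abs\<close>)
    also have "\<dots> = t * II (\<lambda>z. (f z)\<^sup>2) + (1 / t) * II (\<lambda>z. (g z)\<^sup>2)"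
      using set_integral_add(2)[OF i] by simp
    finally show "2 * \<bar>l2ip \<Omega> f g\<bar> \<le> t * (l2norm \<Omega> f)\<^sup>2 + (l2norm \<Omega> g)\<^sup>2 / t"
      by (simp add: l2ip_def l2norm_sq)
  qed (simp_all add: l2norm_nonneg)
  then show ?thesis by simp
qed

lemma l2ip_diff:
  assumes "L2 \<Omega> f" "L2 \<Omega> u" "L2 \<Omega> v"
  shows "l2ip \<Omega> f (\<lambda>z. u z - v z) = l2ip \<Omega> f u - l2ip \<Omega> f v"
  using set_integral_diff(2)[OF L2_mult_integrable[OF assms(1,2)] L2_mult_integrable[OF assms(1,3)]]
  by (simp add: l2ip_def algebra_simps)

lemma friedrichs_bound:
  assumes "friedrichs_const \<Omega> CF" "L2 \<Omega> f" "H20 \<Omega> w"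
  shows "\<bar>l2ip \<Omega> f w\<bar> \<le> l2norm \<Omega> f * (CF * tnorm \<Omega> w)"
proof -
  have "l2norm \<Omega> f * l2norm \<Omega> w \<le> l2norm \<Omega> f * (CF * tnorm \<Omega> w)"
    using assms(1,3) l2norm_nonneg unfolding friedrichs_const_def by (intro mult_left_mono) auto
  then show ?thesis using l2ip_Cauchy_Schwarz[OF assms(2) H2_L2[OF H20_H2[OF assms(3)]]] by linarith
qed

text \<open>The Dirichlet integral is minus the integral of u times its Laplacian; Young's
  inequality leaves half the squared norm of u, bounded by the Friedrichs constant, plus the
  energy.\<close>

lemma gradient_le_aform:
  assumes CF: "friedrichs_const \<Omega> CF" and u: "test_fun \<Omega> u"
  shows "(\<integral>z. (px u z)\<^sup>2 + (py u z)\<^sup>2 \<partial>lborel) \<le> (CF\<^sup>2 / 2 + 1) * aform \<Omega> u u"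
proof -
  note cu = test_fun_continuous2[OF u] and zu = test_fun_outside2[OF u]
  have C: "C1 u" "C1 (px u)" "C1 (py u)"
    using test_fun_C1[OF u, of "[]"] test_fun_C1[OF u, of "[True]"] test_fun_C1[OF u, of "[False]"] by simp_all
  have b: "bounded {z. u z \<noteq> 0}" using test_fun_pds_bounded_support[OF u, of "[]"] by simp
  have i: "integrable lborel (\<lambda>z. (px u z)\<^sup>2)" "integrable lborel (\<lambda>z. (py u z)\<^sup>2)" "integrable lborel (\<lambda>z. u z * px (px u) z)"
    "integrable lborel (\<lambda>z. u z * py (py u) z)" "integrable lborel (\<lambda>z. (u z)\<^sup>2)"
    by (rule integrable_in_\<Omega>(1); (intro continuous_intros cu | simp add: zu))+
  have ia: "integrable lborel (\<lambda>z. (px (px u) z)\<^sup>2 + (px (py u) z)\<^sup>2 + (py (px u) z)\<^sup>2 + (py (py u) z)\<^sup>2)"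
    by (rule integrable_in_\<Omega>(1); (intro continuous_intros cu | simp add: zu))
  have "(\<integral>z. (px u z)\<^sup>2 + (py u z)\<^sup>2 \<partial>lborel) = (\<integral>z. px u z * px u z \<partial>lborel) + (\<integral>z. py u z * py u z \<partial>lborel)"
    using i(1,2) by (simp add: power2_eq_square)
  also have "\<dots> = (\<integral>z. - (u z * px (px u) z) - u z * py (py u) z \<partial>lborel)"
    using integration_by_parts(1)[OF C(1,2) disjI1[OF b]] integration_by_parts(2)[OF C(1,3) disjI1[OF b]] i(3,4) by simp
  also have "\<dots> \<le> (\<integral>z. (1/2) * (u z)\<^sup>2 + ((px (px u) z)\<^sup>2 + (px (py u) z)\<^sup>2 + (py (px u) z)\<^sup>2 + (py (py u) z)\<^sup>2) \<partial>lborel)"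
  proof (rule integral_mono)
    fix z
    have "- (c * a) - c * b \<le> (1/2) * c\<^sup>2 + (a\<^sup>2 + b\<^sup>2)" for a b c :: real
    proof -
      have "0 \<le> (c / 2 + a)\<^sup>2 + (c / 2 + b)\<^sup>2" by simp
      also have "\<dots> = (1/2) * c\<^sup>2 + (a\<^sup>2 + b\<^sup>2) + c * a + c * b" by (simp add: power2_eq_square field_simps)
      finally show ?thesis by simp
    qed
    from this[of "u z" "px (px u) z" "py (py u) z"]
    show "- (u z * px (px u) z) - u z * py (py u) z \<le> (1/2) * (u z)\<^sup>2 + ((px (px u) z)\<^sup>2 + (px (py u) z)\<^sup>2 + (py (px u) z)\<^sup>2 + (py (py u) z)\<^sup>2)"
      using zero_le_power2[of "px (py u) z"] zero_le_power2[of "py (px u) z"] by linarith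
  qed (use i ia in auto)
  also have "\<dots> = (1/2) * (\<integral>z. (u z)\<^sup>2 \<partial>lborel) + aform \<Omega> u u"
    unfolding aform_test_fun[OF u] using i(5) ia by simp
  also have "(\<integral>z. (u z)\<^sup>2 \<partial>lborel) = (l2norm \<Omega> u)\<^sup>2"
    unfolding l2norm_sq by (rule integrable_in_\<Omega>(3)[symmetric]) (intro continuous_intros cu, simp add: zu)
  also have "(l2norm \<Omega> u)\<^sup>2 \<le> (CF * tnorm \<Omega> u)\<^sup>2"
    using CF H20_test_fun[OF u] l2norm_nonneg unfolding friedrichs_const_def by (intro power_mono) auto
  finally show ?thesis by (simp add: power_mult_distrib tnorm_sq algebra_simps)
qed

end

text \<open>The square of the right-hand side minus c V^3 is a sum of two squares, (V^2 - c V / 2)^2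
  + (c^2 / 8)^2. It absorbs growth of order V^(3/2) into V^2.\<close>

lemma cubic_bound:
  assumes "c \<ge> 0" "V \<ge> (0::real)"
  shows "sqrt (c * V^3) \<le> V\<^sup>2 + c\<^sup>2 / 8"
proof (rule real_le_lsqrt)
  have "0 \<le> (V\<^sup>2 - c * V / 2)\<^sup>2 + (c\<^sup>2 / 8)\<^sup>2" by simp
  then show "c * V^3 \<le> (V\<^sup>2 + c\<^sup>2 / 8)\<^sup>2" by (simp add: power2_eq_square power3_eq_cube field_simps)
qed (use assms in auto)

context sobolev_domain
begin

text \<open>By symmetry the second derivatives fall on the smooth \<open>\<phi>\<close>, where they
  are bounded by some M, and Cauchy-Schwarz leaves the gradients of u and v.\<close>

lemma mixed_bound_test:
  assumes CF: "friedrichs_const \<Omega> CF" and \<phi>: "test_fun \<Omega> \<phi>"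
  obtains \<kappa> where "\<kappa> \<ge> 0"
    "\<And>u v. test_fun \<Omega> u \<Longrightarrow> test_fun \<Omega> v \<Longrightarrow>
       (bform \<Omega> u v \<phi>)\<^sup>2 \<le> \<kappa> * aform \<Omega> v v * (\<integral>z. (px u z)\<^sup>2 + (py u z)\<^sup>2 \<partial>lborel)"
proof -
  have bd: "\<exists>M. \<forall>z. \<bar>pds bs \<phi> z\<bar> \<le> M" for bs
  proof -
    let ?K = "closure {z. \<phi> z \<noteq> 0}"
    have "compact (pds bs \<phi> ` ?K)"
      by (rule compact_continuous_image[OF continuous_on_subset[OF test_fun_pds_continuous[OF \<phi>] subset_UNIV]])
        (use \<phi> in \<open>simp add: test_fun_def\<close>)
    then obtain M where M: "\<And>z. z \<in> ?K \<Longrightarrow> \<bar>pds bs \<phi> z\<bar> \<le> M"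
      using compact_imp_bounded[of "pds bs \<phi> ` ?K"] by (auto simp: bounded_iff)
    have "\<bar>pds bs \<phi> z\<bar> \<le> \<bar>M\<bar>" for z
      using M[of z] test_fun_pds_support[OF \<phi>, of bs z] by (cases "pds bs \<phi> z = 0") auto
    then show ?thesis by blast
  qed
  obtain M1 where M1: "\<And>z. \<bar>px (px \<phi>) z\<bar> \<le> M1" using bd[of "[True,True]"] by auto
  obtain M2 where M2: "\<And>z. \<bar>px (py \<phi>) z\<bar> \<le> M2" using bd[of "[True,False]"] by auto
  obtain M3 where M3: "\<And>z. \<bar>py (py \<phi>) z\<bar> \<le> M3" using bd[of "[False,False]"] by auto
  define M where "M = \<bar>M1\<bar> + \<bar>M2\<bar> + \<bar>M3\<bar>"
  have M: "\<bar>px (px \<phi>) z\<bar> \<le> M" "\<bar>px (py \<phi>) z\<bar> \<le> M" "\<bar>py (py \<phi>) z\<bar> \<le> M" for z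
    using M1[of z] M2[of z] M3[of z] by (auto simp: M_def)
  have M0: "M \<ge> 0" by (simp add: M_def)
  show ?thesis
  proof (rule that[of "M\<^sup>2 * (CF\<^sup>2 / 2 + 1)"])
    show "0 \<le> M\<^sup>2 * (CF\<^sup>2 / 2 + 1)" by simp
    fix u v assume u: "test_fun \<Omega> u" and v: "test_fun \<Omega> v"
    note cu = test_fun_continuous2[OF u] and zu = test_fun_outside2[OF u] and cv = test_fun_continuous2[OF v] and zv = test_fun_outside2[OF v]
      and c\<phi> = test_fun_continuous2[OF \<phi>]
    define A where "A = (\<integral>z. (px u z)\<^sup>2 + (py u z)\<^sup>2 \<partial>lborel)"
    define B where "B = (\<integral>z. (px v z)\<^sup>2 + (py v z)\<^sup>2 \<partial>lborel)"
    have AB: "A \<ge> 0" "B \<ge> 0" unfolding A_def B_def by (intro Bochner_Integration.integral_nonneg; simp)+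
    let ?G = "\<lambda>z. px (px \<phi>) z * (py v z * py u z) + py (py \<phi>) z * (px v z * px u z) - px (py \<phi>) z * (px v z * py u z + py v z * px u z)"
    have iG: "integrable lborel ?G" by (rule integrable_in_\<Omega>(1); (intro continuous_intros cu cv c\<phi> | simp add: zu))
    have iu: "integrable lborel (\<lambda>z. (px u z)\<^sup>2 + (py u z)\<^sup>2)" by (rule integrable_in_\<Omega>(1); (intro continuous_intros cu | simp add: zu))
    have iv: "integrable lborel (\<lambda>z. (px v z)\<^sup>2 + (py v z)\<^sup>2)" by (rule integrable_in_\<Omega>(1); (intro continuous_intros cv | simp add: zv))
    have "bform \<Omega> u v \<phi> = bform \<Omega> \<phi> u v"
      using bform_sym23[OF H20_test_fun[OF u] H20_test_fun[OF v] H20_test_fun[OF \<phi>]] bform_sym12[of u \<phi> v]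
      by simp
    then have b: "2 * bform \<Omega> u v \<phi> = integral\<^sup>L lborel ?G" using bform_test_fun[OF \<phi> u v] by simp
    have "\<bar>2 * bform \<Omega> u v \<phi>\<bar> \<le> 2 * (M * sqrt A) * sqrt B"
    proof (rule mult_le_if_weighted)
      fix t :: real assume t: "t > 0"
      have t': "t * M\<^sup>2 \<ge> 0" using t by simp
      have "\<bar>integral\<^sup>L lborel ?G\<bar> \<le> integral\<^sup>L lborel (\<lambda>z. \<bar>?G z\<bar>)"
        using integral_norm_bound[of lborel ?G] by simp
      also have "\<dots> \<le> (\<integral>z. (t * M\<^sup>2) * ((px u z)\<^sup>2 + (py u z)\<^sup>2) + (1 / t) * ((px v z)\<^sup>2 + (py v z)\<^sup>2) \<partial>lborel)"
      proof (rule integral_mono)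
        fix z
        define X Y X' Y' where "X = \<bar>px u z\<bar>" "Y = \<bar>py u z\<bar>" "X' = \<bar>px v z\<bar>" "Y' = \<bar>py v z\<bar>"
        note d = this
        have n: "X \<ge> 0" "Y \<ge> 0" "X' \<ge> 0" "Y' \<ge> 0" by (simp_all add: d)
        have pr: "\<bar>p * q\<bar> \<le> M * Q" if "\<bar>p\<bar> \<le> M" "\<bar>q\<bar> \<le> Q" for p q Q
          unfolding abs_mult using that M0 by (intro mult_mono) auto
        have "\<bar>px (px \<phi>) z * (py v z * py u z)\<bar> \<le> M * (Y' * Y)" by (rule pr[OF M(1)]) (simp add: d abs_mult)
        moreover have "\<bar>py (py \<phi>) z * (px v z * px u z)\<bar> \<le> M * (X' * X)" by (rule pr[OF M(3)]) (simp add: d abs_mult)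
        moreover have "\<bar>px (py \<phi>) z * (px v z * py u z + py v z * px u z)\<bar> \<le> M * (X' * Y + Y' * X)"
          by (rule pr[OF M(2)]) (simp add: d flip: abs_mult)
        ultimately have "\<bar>?G z\<bar> \<le> M * (Y' * Y) + M * (X' * X) + M * (X' * Y + Y' * X)" by linarith
        also have "\<dots> = M * (X + Y) * (X' + Y')" by (simp add: algebra_simps)
        also have "\<dots> \<le> (t * (M * (X + Y))\<^sup>2 + (1 / t) * (X' + Y')\<^sup>2) / 2"
        proof -
          have "0 \<le> (t * (M * (X + Y)) - (X' + Y'))\<^sup>2 / t" using t by simp
          also have "\<dots> = t * (M * (X + Y))\<^sup>2 + (1 / t) * (X' + Y')\<^sup>2 - 2 * (M * (X + Y) * (X' + Y'))"
          proof -
            have "(t * P - Q)\<^sup>2 / t = t * P\<^sup>2 + (1 / t) * Q\<^sup>2 - 2 * (P * Q)" for P Q :: real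
              using t by (simp add: power2_eq_square field_simps)
            then show ?thesis .
          qed
          finally show ?thesis by simp
        qed
        also have "\<dots> \<le> (t * M\<^sup>2) * (X\<^sup>2 + Y\<^sup>2) + (1 / t) * (X'\<^sup>2 + Y'\<^sup>2)"
        proof -
          have sq: "(x + y)\<^sup>2 \<le> 2 * (x\<^sup>2 + y\<^sup>2)" for x y :: real
            using sum_squares_bound[of x y] by (simp add: power2_sum)
          have "t * (M * (X + Y))\<^sup>2 \<le> (t * M\<^sup>2) * (2 * (X\<^sup>2 + Y\<^sup>2))"
            using mult_left_mono[OF sq[of X Y] t'] by (simp add: power_mult_distrib mult.assoc)
          moreover have "(1 / t) * (X' + Y')\<^sup>2 \<le> (1 / t) * (2 * (X'\<^sup>2 + Y'\<^sup>2))"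
            using t by (intro mult_left_mono sq) simp
          moreover have "(a + b) / 2 \<le> p * Q + r * S" if "a \<le> p * (2 * Q)" "b \<le> r * (2 * S)" for a b p Q r S :: real
            using that by simp
          ultimately show ?thesis by blast
        qed
        finally show "\<bar>?G z\<bar> \<le> (t * M\<^sup>2) * ((px u z)\<^sup>2 + (py u z)\<^sup>2) + (1 / t) * ((px v z)\<^sup>2 + (py v z)\<^sup>2)"
          by (simp only: d power2_abs)
      qed (use iG iu iv in \<open>auto intro!: Bochner_Integration.integrable_add integrable_mult_right\<close>)
      also have "\<dots> = (t * M\<^sup>2) * A + (1 / t) * B" unfolding A_def B_def using iu iv by simp
      finally show "\<bar>2 * bform \<Omega> u v \<phi>\<bar> \<le> t * (M * sqrt A)\<^sup>2 + (sqrt B)\<^sup>2 / t"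
        unfolding b using AB by (simp add: power_mult_distrib)
    qed (use M0 AB in auto)
    then have "\<bar>bform \<Omega> u v \<phi>\<bar> \<le> M * sqrt A * sqrt B" by (simp add: abs_mult)
    then have "\<bar>bform \<Omega> u v \<phi>\<bar>\<^sup>2 \<le> (M * sqrt A * sqrt B)\<^sup>2" by (rule power_mono) simp
    then have "(bform \<Omega> u v \<phi>)\<^sup>2 \<le> M\<^sup>2 * A * B" using AB by (simp add: power_mult_distrib)
    \<comment> \<open>Only the gradient of v is traded for energy. The gradient of u is kept, since
      this is the factor that \<open>gradient_control\<close> makes small.\<close>
    also have "\<dots> \<le> M\<^sup>2 * A * ((CF\<^sup>2 / 2 + 1) * aform \<Omega> v v)"
      unfolding B_def using AB by (intro mult_left_mono gradient_le_aform CF v) auto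
    finally show "(bform \<Omega> u v \<phi>)\<^sup>2 \<le> M\<^sup>2 * (CF\<^sup>2 / 2 + 1) * aform \<Omega> v v * (\<integral>z. (px u z)\<^sup>2 + (py u z)\<^sup>2 \<partial>lborel)"
      by (simp add: A_def mult.assoc mult.left_commute mult.commute)
  qed
qed

text \<open>Here \<open>\<kappa>\<close> is fixed before \<delta>, so their product can be made
  small afterwards, while \<open>\<psi>\<close> may depend on \<delta>. Since the gradient integral
  has been replaced by \<open>b(u,u,\<psi>)\<close>, both sides are continuous in the energy norm
  and the inequality passes from test functions to all of \<open>H20\<close>.\<close>

lemma mixed_bound:
  assumes bar: "barrier \<Omega> (frontier \<Omega>) T W C" and CF: "friedrichs_const \<Omega> CF" and \<phi>: "test_fun \<Omega> \<phi>"
  obtains \<kappa> where "\<kappa> \<ge> 0" "\<And>\<delta>. \<delta> > 0 \<Longrightarrow> \<exists>\<psi>. H20 \<Omega> \<psi> \<and> (\<forall>u v. H20 \<Omega> u \<longrightarrow> H20 \<Omega> v \<longrightarrow>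
       (bform \<Omega> u v \<phi>)\<^sup>2 \<le> \<kappa> * (tnorm \<Omega> v)\<^sup>2 * (2 * bform \<Omega> u u \<psi> + \<delta> * (tnorm \<Omega> u)\<^sup>2))"
proof -
  obtain \<kappa> where \<kappa>: "\<kappa> \<ge> 0"
    "\<And>u v. test_fun \<Omega> u \<Longrightarrow> test_fun \<Omega> v \<Longrightarrow>
       (bform \<Omega> u v \<phi>)\<^sup>2 \<le> \<kappa> * aform \<Omega> v v * (\<integral>z. (px u z)\<^sup>2 + (py u z)\<^sup>2 \<partial>lborel)"
    using mixed_bound_test[OF CF \<phi>] by blast
  show ?thesis
  proof (rule that[OF \<kappa>(1)])
    fix \<delta> :: real assume \<delta>: "\<delta> > 0"
    obtain \<psi> where \<psi>: "test_fun \<Omega> \<psi>"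
      "\<And>u. test_fun \<Omega> u \<Longrightarrow> (\<integral>z. (px u z)\<^sup>2 + (py u z)\<^sup>2 \<partial>lborel) \<le> 2 * bform \<Omega> u u \<psi> + \<delta> * aform \<Omega> u u"
      using gradient_control[OF bar \<delta>] by blast
    have test: "(bform \<Omega> u v \<phi>)\<^sup>2 \<le> \<kappa> * (tnorm \<Omega> v)\<^sup>2 * (2 * bform \<Omega> u u \<psi> + \<delta> * (tnorm \<Omega> u)\<^sup>2)"
      if "test_fun \<Omega> u" "test_fun \<Omega> v" for u v
      unfolding tnorm_sq
      by (rule order_trans[OF \<kappa>(2)[OF that] mult_left_mono[OF \<psi>(2)[OF that(1)]]]) (simp add: \<kappa> aform_nonneg)
    have "(bform \<Omega> u v \<phi>)\<^sup>2 \<le> \<kappa> * (tnorm \<Omega> v)\<^sup>2 * (2 * bform \<Omega> u u \<psi> + \<delta> * (tnorm \<Omega> u)\<^sup>2)"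
      if u: "H20 \<Omega> u" and v: "H20 \<Omega> v" for u v
    proof -
      obtain u' where u': "\<And>n. test_fun \<Omega> (u' n)" "(\<lambda>n. tnorm \<Omega> (\<lambda>z. u' n z - u z)) \<longlonglongrightarrow> 0"
        using test_fun_approx[OF u] by blast
      obtain v' where v': "\<And>n. test_fun \<Omega> (v' n)" "(\<lambda>n. tnorm \<Omega> (\<lambda>z. v' n z - v z)) \<longlonglongrightarrow> 0"
        using test_fun_approx[OF v] by blast
      \<comment> \<open>The arguments \<open>\<phi>\<close> and \<open>\<psi>\<close> stay fixed and
        are treated as constant sequences; the energy norm of zero vanishes by linearity with
        coefficients 0.\<close>
      have cst: "(\<lambda>n. tnorm \<Omega> (\<lambda>z. w z - w z)) \<longlonglongrightarrow> 0" if "test_fun \<Omega> w" for w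
        using aform_lincomb[OF H2_test_fun[OF that] H2_test_fun[OF that], of "\<lambda>z. 0 * w z + 0 * w z" 0 0]
          H2_lincomb[OF H2_test_fun[OF that] H2_test_fun[OF that], of 0 0] by (simp add: tnorm_def)
      note t = H20_test_fun[OF u'(1)] H20_test_fun[OF v'(1)] H20_test_fun[OF \<psi>(1)] H20_test_fun[OF \<phi>]
      have 1: "(\<lambda>n. (bform \<Omega> (u' n) (v' n) \<phi>)\<^sup>2) \<longlonglongrightarrow> (bform \<Omega> u v \<phi>)\<^sup>2"
        by (intro tendsto_power bform_tendsto u v t u' v' cst \<phi>)
      have 2: "(\<lambda>n. \<kappa> * (tnorm \<Omega> (v' n))\<^sup>2 * (2 * bform \<Omega> (u' n) (u' n) \<psi> + \<delta> * (tnorm \<Omega> (u' n))\<^sup>2))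
         \<longlonglongrightarrow> \<kappa> * (tnorm \<Omega> v)\<^sup>2 * (2 * bform \<Omega> u u \<psi> + \<delta> * (tnorm \<Omega> u)\<^sup>2)"
        by (intro tendsto_intros bform_tendsto tnorm_tendsto u v t u' v' cst \<psi>)
      show ?thesis by (rule LIMSEQ_le[OF 1 2]) (use test[OF u'(1) v'(1)] in blast)
    qed
    then show "\<exists>\<psi>. H20 \<Omega> \<psi> \<and> (\<forall>u v. H20 \<Omega> u \<longrightarrow> H20 \<Omega> v \<longrightarrow>
       (bform \<Omega> u v \<phi>)\<^sup>2 \<le> \<kappa> * (tnorm \<Omega> v)\<^sup>2 * (2 * bform \<Omega> u u \<psi> + \<delta> * (tnorm \<Omega> u)\<^sup>2))"
      using H20_test_fun[OF \<psi>(1)] by blast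
  qed
qed

text \<open>After replacing \<open>\<phi>\<close> by a nearby test function, \<open>mixed_bound\<close> and \<open>b(u,u,\<psi>) = a(v,\<psi>)\<close> bound
  \<open>b(u,v,\<phi>)\<close> by a small multiple of \<open>|u| |v|\<close> plus a multiple of \<open>|v|\<close> to the power \<open>3/2\<close>.\<close>

lemma coercivity:
  assumes bar: "barrier \<Omega> (frontier \<Omega>) T W C" and CF: "friedrichs_const \<Omega> CF" and \<phi>: "H20 \<Omega> \<phi>"
  obtains B where "B \<ge> 0" "\<And>u v. H20 \<Omega> u \<Longrightarrow> H20 \<Omega> v \<Longrightarrow> (\<And>\<psi>. H20 \<Omega> \<psi> \<Longrightarrow> aform \<Omega> v \<psi> = bform \<Omega> u u \<psi>) \<Longrightarrow>
    2 * aform \<Omega> u \<phi> + 4 * bform \<Omega> u v \<phi> - (tnorm \<Omega> u)\<^sup>2 - 3 * (tnorm \<Omega> v)\<^sup>2 \<le> B"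
proof -
  obtain \<phi>s where \<phi>s: "\<And>n. test_fun \<Omega> (\<phi>s n)" "(\<lambda>n. tnorm \<Omega> (\<lambda>z. \<phi>s n z - \<phi> z)) \<longlonglongrightarrow> 0"
    using test_fun_approx[OF \<phi>] by blast
  \<comment> \<open>Bounded second derivatives require a test function in place of
    \<open>\<phi>\<close>. An error of 1/16 costs (1/4) U V in four times b, which the energies can
    afford.\<close>
  have "(\<lambda>n. \<bar>CS\<bar> * tnorm \<Omega> (\<lambda>z. \<phi>s n z - \<phi> z)) \<longlonglongrightarrow> \<bar>CS\<bar> * 0" by (intro tendsto_intros \<phi>s)
  then have "eventually (\<lambda>n. \<bar>CS\<bar> * tnorm \<Omega> (\<lambda>z. \<phi>s n z - \<phi> z) < 1 / 16) sequentially"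
    by (rule order_tendstoD(2)) simp
  then obtain n where n: "\<bar>CS\<bar> * tnorm \<Omega> (\<lambda>z. \<phi>s n z - \<phi> z) < 1 / 16" by (auto simp: eventually_sequentially)
  define \<theta> where "\<theta> = \<phi>s n"
  have \<theta>: "test_fun \<Omega> \<theta>" "\<bar>CS\<bar> * tnorm \<Omega> (\<lambda>z. \<theta> z - \<phi> z) \<le> 1 / 16" using n \<phi>s by (simp_all add: \<theta>_def)
  note H\<theta> = H20_test_fun[OF \<theta>(1)]
  obtain \<kappa> where \<kappa>: "\<kappa> \<ge> 0" "\<And>\<delta>. \<delta> > 0 \<Longrightarrow> \<exists>\<psi>. H20 \<Omega> \<psi> \<and> (\<forall>u v. H20 \<Omega> u \<longrightarrow> H20 \<Omega> v \<longrightarrow>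
       (bform \<Omega> u v \<theta>)\<^sup>2 \<le> \<kappa> * (tnorm \<Omega> v)\<^sup>2 * (2 * bform \<Omega> u u \<psi> + \<delta> * (tnorm \<Omega> u)\<^sup>2))"
    using mixed_bound[OF bar CF \<theta>(1)] by blast
  \<comment> \<open>Then \<kappa> \<delta> is at most 1/64, whose square root contributes U V / 8 to
    the bound on b.\<close>
  define \<delta> where "\<delta> = 1 / (64 * (\<kappa> + 1))"
  have \<delta>: "\<delta> > 0" "\<kappa> * \<delta> \<le> 1 / 64" using \<kappa>(1) by (simp_all add: \<delta>_def field_simps)
  obtain \<psi> where \<psi>: "H20 \<Omega> \<psi>" "\<And>u v. H20 \<Omega> u \<Longrightarrow> H20 \<Omega> v \<Longrightarrow>
       (bform \<Omega> u v \<theta>)\<^sup>2 \<le> \<kappa> * (tnorm \<Omega> v)\<^sup>2 * (2 * bform \<Omega> u u \<psi> + \<delta> * (tnorm \<Omega> u)\<^sup>2)"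
    using \<kappa>(2)[OF \<delta>(1)] by metis
  \<comment> \<open>Normalised so that 2 \<kappa> V^3 |\<psi>| is c V^3 / 16; after the square root
    and the factor 4 this is exactly the left-hand side of \<open>cubic_bound\<close>.\<close>
  define c where "c = 32 * \<kappa> * tnorm \<Omega> \<psi>"
  have c: "c \<ge> 0" using \<kappa> tnorm_nonneg by (simp add: c_def)
  show ?thesis
  proof (rule that[of "c\<^sup>2 / 8 + 2 * (tnorm \<Omega> \<phi>)\<^sup>2"])
    show "0 \<le> c\<^sup>2 / 8 + 2 * (tnorm \<Omega> \<phi>)\<^sup>2" by simp
    fix u v assume u: "H20 \<Omega> u" and v: "H20 \<Omega> v" and G: "\<And>\<psi>. H20 \<Omega> \<psi> \<Longrightarrow> aform \<Omega> v \<psi> = bform \<Omega> u u \<psi>"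
    define U V P where "U = tnorm \<Omega> u" "V = tnorm \<Omega> v" "P = tnorm \<Omega> \<phi>"
    note d = this
    have n: "U \<ge> 0" "V \<ge> 0" "P \<ge> 0" by (simp_all add: d tnorm_nonneg)
    note H = H20_H2[OF u] H20_H2[OF v]
    have e1: "bform \<Omega> u v \<phi> = bform \<Omega> u v \<theta> - bform \<Omega> u v (\<lambda>z. \<theta> z - \<phi> z)"
      using bform_diff(3)[OF H H(1) H\<theta> \<phi>] by simp
    have "\<bar>bform \<Omega> u v (\<lambda>z. \<theta> z - \<phi> z)\<bar> \<le> (\<bar>CS\<bar> * tnorm \<Omega> (\<lambda>z. \<theta> z - \<phi> z)) * (U * V)"
      using bform_bound[OF H H20_diff[OF H\<theta> \<phi>]] by (simp add: d algebra_simps)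
    also have "\<dots> \<le> (1 / 16) * (U * V)" using \<theta>(2) n by (intro mult_right_mono) auto
    finally have e2: "\<bar>bform \<Omega> u v (\<lambda>z. \<theta> z - \<phi> z)\<bar> \<le> (1 / 16) * (U * V)" .
    have "bform \<Omega> u u \<psi> \<le> V * tnorm \<Omega> \<psi>"
      using G[OF \<psi>(1)] aform_Cauchy_Schwarz[OF H(2) H20_H2[OF \<psi>(1)]] by (simp add: d)
    then have "(bform \<Omega> u v \<theta>)\<^sup>2 \<le> \<kappa> * V\<^sup>2 * (2 * (V * tnorm \<Omega> \<psi>) + \<delta> * U\<^sup>2)"
      using \<psi>(2)[OF u v] \<kappa>(1) unfolding d(1,2)[symmetric]
      by (elim order_trans) (intro mult_left_mono add_right_mono, auto)
    also have "\<dots> = (c * V^3) / 16 + (\<kappa> * \<delta>) * (U\<^sup>2 * V\<^sup>2)"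
      by (simp add: c_def power2_eq_square power3_eq_cube algebra_simps)
    also have "\<dots> \<le> (c * V^3) / 16 + (1 / 64) * (U\<^sup>2 * V\<^sup>2)" using \<delta>(2) by (intro add_left_mono mult_right_mono) auto
    also have "\<dots> \<le> (sqrt (c * V^3) / 4 + U * V / 8)\<^sup>2"
    proof -
      have "0 \<le> sqrt (c * V^3) * (U * V)" using c n by simp
      then show ?thesis using c n by (simp add: power2_sum power_divide power_mult_distrib)
    qed
    finally have "bform \<Omega> u v \<theta> \<le> sqrt (c * V^3) / 4 + U * V / 8"
      by (rule power2_le_imp_le) (use c n in simp)
    then have "4 * bform \<Omega> u v \<theta> \<le> (V\<^sup>2 + c\<^sup>2 / 8) + U * V / 2" using cubic_bound[OF c n(2)] by simp
    then have 4: "4 * bform \<Omega> u v \<phi> \<le> V\<^sup>2 + c\<^sup>2 / 8 + (3 / 4) * (U * V)" using e1 e2 by linarith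
    have 5: "aform \<Omega> u \<phi> \<le> U * P" using aform_Cauchy_Schwarz[OF H(1) H20_H2[OF \<phi>]] by (simp add: d)
    have 6: "2 * (U * V) \<le> U\<^sup>2 + V\<^sup>2" using sum_squares_bound[of U V] by simp
    have 7: "2 * (U * P) \<le> U\<^sup>2 / 2 + 2 * P\<^sup>2" using sum_squares_bound[of "U / 2" P] by (simp add: power_divide)
    \<comment> \<open>The budget: the terms in U V add up to 3/4, which costs 3/8 of each square.
      The linear term costs U^2 / 2 and \<open>cubic_bound\<close> costs V^2. In total this is 7/8
      of U^2 and 11/8 of V^2, within the available 1 and 3.\<close>
    show "2 * aform \<Omega> u \<phi> + 4 * bform \<Omega> u v \<phi> - (tnorm \<Omega> u)\<^sup>2 - 3 * (tnorm \<Omega> v)\<^sup>2 \<le> c\<^sup>2 / 8 + 2 * (tnorm \<Omega> \<phi>)\<^sup>2"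
      unfolding d[symmetric] using 4 5 6 7 zero_le_power2[of U] zero_le_power2[of V] by linarith
  qed
qed

section \<open>Energy identities and uniqueness of solutions\<close>

lemma vk_solution_props:
  assumes "vk_solution \<Omega> obs f u v"
  shows "H20 \<Omega> u" "H20 \<Omega> v" "\<And>\<psi>. H20 \<Omega> \<psi> \<Longrightarrow> aform \<Omega> v \<psi> = bform \<Omega> u u \<psi>"
  using assms by (auto simp: vk_solution_def Kset_def)

text \<open>\<open>Gop\<close> is a choice among functions that solve the equation satisfied by v.
  Testing both equations with both functions shows equal energies, and the energy is all that
  \<open>jfun\<close> sees.\<close>

lemma tnorm_Gop:
  assumes "vk_solution \<Omega> obs f u v"
  shows "tnorm \<Omega> (Gop \<Omega> u) = tnorm \<Omega> v"
proof -
  note s = vk_solution_props[OF assms]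
  have "\<exists>g. H20 \<Omega> g \<and> (\<forall>\<psi>. H20 \<Omega> \<psi> \<longrightarrow> aform \<Omega> g \<psi> = bform \<Omega> u u \<psi>)" using s by blast
  from someI_ex[OF this] have g: "H20 \<Omega> (Gop \<Omega> u)" "\<And>\<psi>. H20 \<Omega> \<psi> \<Longrightarrow> aform \<Omega> (Gop \<Omega> u) \<psi> = bform \<Omega> u u \<psi>"
    by (simp_all add: Gop_def)
  have "aform \<Omega> (Gop \<Omega> u) (Gop \<Omega> u) = aform \<Omega> v v"
    using g(2)[OF g(1)] s(3)[OF g(1)] g(2)[OF s(2)] s(3)[OF s(2)] aform_sym[of v "Gop \<Omega> u"] by simp
  then show ?thesis by (simp add: tnorm_def)
qed

text \<open>Serves twice: with a fixed element of K for the a priori bound, and with a second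
  solution as the competitor for uniqueness.\<close>

lemma vk_solution_estimate:
  assumes sol: "vk_solution \<Omega> obs f u v" and \<phi>: "\<phi> \<in> Kset \<Omega> obs" and f: "L2 \<Omega> f"
  shows "(tnorm \<Omega> u)\<^sup>2 + 2 * (tnorm \<Omega> v)\<^sup>2 - l2ip \<Omega> f u \<le> aform \<Omega> u \<phi> + 2 * bform \<Omega> u v \<phi> - l2ip \<Omega> f \<phi>"
proof -
  note s = vk_solution_props[OF sol]
  have H\<phi>: "H20 \<Omega> \<phi>" using \<phi> by (simp add: Kset_def)
  note H = H20_H2[OF s(1)] H20_H2[OF s(2)] H20_H2[OF H\<phi>]
  have "aform \<Omega> u (\<lambda>z. u z - \<phi> z) + 2 * bform \<Omega> u v (\<lambda>z. u z - \<phi> z) \<le> l2ip \<Omega> f (\<lambda>z. u z - \<phi> z)"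
    using sol \<phi> by (simp add: vk_solution_def)
  moreover have "aform \<Omega> u (\<lambda>z. u z - \<phi> z) = (tnorm \<Omega> u)\<^sup>2 - aform \<Omega> u \<phi>"
    using aform_diff[OF H(1,3,1)] aform_sym[of u "\<lambda>z. u z - \<phi> z"] aform_sym[of u \<phi>] by (simp add: tnorm_sq)
  moreover have "bform \<Omega> u v (\<lambda>z. u z - \<phi> z) = bform \<Omega> u v u - bform \<Omega> u v \<phi>"
    by (rule bform_diff(3)[OF H(1,2,1) s(1) H\<phi>])
  moreover have "bform \<Omega> u v u = (tnorm \<Omega> v)\<^sup>2"
    using bform_sym23[OF s(1,2,1)] s(3)[OF s(2)] by (simp add: tnorm_sq)
  moreover have "l2ip \<Omega> f (\<lambda>z. u z - \<phi> z) = l2ip \<Omega> f u - l2ip \<Omega> f \<phi>"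
    by (rule l2ip_diff[OF f H2_L2[OF H(1)] H2_L2[OF H(3)]])
  ultimately show ?thesis by linarith
qed

lemma vk_solution_unique:
  assumes sol: "vk_solution \<Omega> obs f u v" and sol': "vk_solution \<Omega> obs f u' v'" and f: "L2 \<Omega> f"
    and small: "CS\<^sup>2 * ((1/2) * (tnorm \<Omega> u)\<^sup>2 + (tnorm \<Omega> v)\<^sup>2) < (sqrt 2 - 1)\<^sup>2"
  shows "AE z in lebesgue. z \<in> \<Omega> \<longrightarrow> u' z = u z" "AE z in lebesgue. z \<in> \<Omega> \<longrightarrow> v' z = v z"
proof -
  note s = vk_solution_props[OF sol] and s' = vk_solution_props[OF sol']
  have K: "u \<in> Kset \<Omega> obs" "u' \<in> Kset \<Omega> obs" using sol sol' by (simp_all add: vk_solution_def)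
  define e where "e = (\<lambda>z. u z - u' z)"
  define d where "d = (\<lambda>z. v z - v' z)"
  have He: "H20 \<Omega> e" "H20 \<Omega> d" unfolding e_def d_def by (intro H20_diff s s')+
  note H = H20_H2[OF s(1)] H20_H2[OF s(2)] H20_H2[OF s'(1)] H20_H2[OF s'(2)] H20_H2[OF He(1)] H20_H2[OF He(2)]
  \<comment> \<open>Each solution is the competitor in the inequality of the other; in the sum of
    the two the terms with f cancel.\<close>
  note est = vk_solution_estimate[OF sol K(2) f] vk_solution_estimate[OF sol' K(1) f]
  have ee: "(tnorm \<Omega> e)\<^sup>2 = aform \<Omega> u u - 2 * aform \<Omega> u u' + aform \<Omega> u' u'"
    using aform_diff[OF H(1,3,5)] aform_diff[OF H(1,3,1)] aform_diff[OF H(1,3,3)]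
      aform_sym[of u e] aform_sym[of u' e] aform_sym[of u' u] unfolding e_def tnorm_sq by linarith
  have dd: "(tnorm \<Omega> d)\<^sup>2 = aform \<Omega> v v - 2 * aform \<Omega> v v' + aform \<Omega> v' v'"
    using aform_diff[OF H(2,4,6)] aform_diff[OF H(2,4,2)] aform_diff[OF H(2,4,4)]
      aform_sym[of v d] aform_sym[of v' d] aform_sym[of v' v] unfolding d_def tnorm_sq by linarith
  have av: "aform \<Omega> v v = bform \<Omega> u u v" "aform \<Omega> v v' = bform \<Omega> u u v'" "aform \<Omega> v v' = bform \<Omega> u' u' v"
    "aform \<Omega> v' v' = bform \<Omega> u' u' v'"
    using s(3)[OF s(2)] s(3)[OF s'(2)] s'(3)[OF s(2)] s'(3)[OF s'(2)] aform_sym[of v' v] by simp_all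
  have b1: "bform \<Omega> e e v = bform \<Omega> u u v - 2 * bform \<Omega> u u' v + bform \<Omega> u' u' v"
    using bform_diff(1)[OF H(1,3,5) s(2) s(2)] bform_diff(2)[OF H(1,3,1) s(2) s(2)] bform_diff(2)[OF H(1,3,3) s(2) s(2)] bform_sym12[of u' u v]
    unfolding e_def by linarith
  have b2: "bform \<Omega> u e d = bform \<Omega> u u v - bform \<Omega> u u v' - bform \<Omega> u u' v + bform \<Omega> u u' v'"
    using bform_diff(2)[OF H(1,3,1) He(2) He(2)] bform_diff(3)[OF H(1,1,1) s(2) s'(2)] bform_diff(3)[OF H(1,3,1) s(2) s'(2)]
    unfolding e_def d_def by linarith
  have sy: "bform \<Omega> u v u' = bform \<Omega> u u' v" "bform \<Omega> u' v' u = bform \<Omega> u u' v'"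
    using bform_sym23[OF s(1,2) s'(1)] bform_sym23[OF s'(1,2) s(1)] bform_sym12[of u' u v'] by simp_all
  \<comment> \<open>Eliminating \<open>b(e,e,d)\<close> with the second equation leaves a quadratic form in \<open>(e,d)\<close> whose coefficients
    involve only \<open>(u,v)\<close>, so no smallness of \<open>(u',v')\<close> is required.\<close>
  have main: "(tnorm \<Omega> e)\<^sup>2 + 2 * (tnorm \<Omega> d)\<^sup>2 + 2 * bform \<Omega> e e v - 2 * bform \<Omega> u e d \<le> 0"
    using est ee dd b1 b2 sy av aform_sym[of u' u] tnorm_sq[of u] tnorm_sq[of v] tnorm_sq[of u'] tnorm_sq[of v'] by linarith
  define E D A B where "E = tnorm \<Omega> e" "D = tnorm \<Omega> d" "A = \<bar>CS\<bar> * tnorm \<Omega> u" "B = \<bar>CS\<bar> * tnorm \<Omega> v"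
  note d' = this
  have n: "E \<ge> 0" "D \<ge> 0" "A \<ge> 0" "B \<ge> 0" by (simp_all add: d' tnorm_nonneg)
  have "\<bar>bform \<Omega> e e v\<bar> \<le> B * E\<^sup>2" using bform_bound[OF H(5,5) s(2)] by (simp add: d' power2_eq_square mult.assoc mult.left_commute mult.commute)
  moreover have "\<bar>bform \<Omega> u e d\<bar> \<le> A * E * D" using bform_bound[OF H(1,5) He(2)] by (simp add: d')
  ultimately have m: "E\<^sup>2 + 2 * D\<^sup>2 \<le> 2 * (B * E\<^sup>2) + 2 * (A * E * D)" using main unfolding d'(1,2)[symmetric] by linarith
  have sm: "A\<^sup>2 / 2 + B\<^sup>2 < (sqrt 2 - 1)\<^sup>2" using small by (simp add: d' power_mult_distrib algebra_simps)
  \<comment> \<open>With r = sqrt 2 - 1, smallness gives A^2/2 + B^2 < r^2 and so B < r. As r < 1/2,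
    also r < 1 - B, hence A^2/2 + B^2 < (1 - B)^2, which rearranges to 1 - 2 B - A^2/2 > 0.\<close>
  have "sqrt 2 < 3 / 2" by (rule real_less_lsqrt) (simp_all add: power2_eq_square)
  then have "sqrt 2 - 1 < 1 / 2" by simp
  have "B\<^sup>2 < (sqrt 2 - 1)\<^sup>2" using sm zero_le_power2[of A] by linarith
  then have "B < sqrt 2 - 1" by (rule power2_less_imp_less) simp
  then have "sqrt 2 - 1 < 1 - B" using \<open>sqrt 2 - 1 < 1 / 2\<close> by linarith
  then have "(sqrt 2 - 1)\<^sup>2 < (1 - B)\<^sup>2" by (rule power_strict_mono) auto
  then have pos: "1 - 2 * B - A\<^sup>2 / 2 > 0" using sm by (simp add: power2_diff)
  \<comment> \<open>Completing the square in D: 2 D^2 - 2 A E D = 2 (D - A E / 2)^2 - A^2 E^2 / 2,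
    so the mixed term costs A^2/2 of the coefficient of E^2.\<close>
  have sq: "(1 - 2 * B - A\<^sup>2 / 2) * E\<^sup>2 + 2 * (D - A * E / 2)\<^sup>2 \<le> 0"
    using m by (simp add: power2_eq_square algebra_simps)
  then have "(1 - 2 * B - A\<^sup>2 / 2) * E\<^sup>2 \<le> 0" using zero_le_power2[of "D - A * E / 2"] by linarith
  then have E0: "E = 0" using pos by (simp add: mult_le_0_iff)
  then have D0: "D = 0" using sq by simp
  \<comment> \<open>The Sobolev bound turns vanishing energy of the difference into vanishing almost
    everywhere.\<close>
  show "AE z in lebesgue. z \<in> \<Omega> \<longrightarrow> u' z = u z" 
    using sobolev_bound[OF He(1)] E0 unfolding d'(1) by (auto elim!: eventually_mono simp: e_def)
  show "AE z in lebesgue. z \<in> \<Omega> \<longrightarrow> v' z = v z"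
    using sobolev_bound[OF He(2)] D0 unfolding d'(2) by (auto elim!: eventually_mono simp: d_def)
qed

end

theorem theorem2p3:
  fixes \<Omega> :: "pt set" and obs :: "pt \<Rightarrow> real"
  assumes "polygonal_domain \<Omega>"
    and "H2 \<Omega> obs" and "continuous_on (closure \<Omega>) obs"
    and "(SUP z\<in>frontier \<Omega>. obs z) < 0"
  shows "\<exists>Cchi>0. \<forall>f CS CF u v.
     L2 \<Omega> f \<and> sobolev_const \<Omega> CS \<and> friedrichs_const \<Omega> CF \<and> vk_solution \<Omega> obs f u v \<longrightarrow>
     (let N2 = 2 * jfun \<Omega> f u + 2 * CF\<^sup>2 * (l2norm \<Omega> f)\<^sup>2;
          M2 = Cchi + 3 * CF\<^sup>2 * (l2norm \<Omega> f)\<^sup>2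
      in (1/2) * (tnorm \<Omega> u)\<^sup>2 + (tnorm \<Omega> v)\<^sup>2 \<le> N2 \<and> N2 \<le> M2) \<and>
     (CS\<^sup>2 * ((1/2) * (tnorm \<Omega> u)\<^sup>2 + (tnorm \<Omega> v)\<^sup>2) < (sqrt 2 - 1)\<^sup>2 \<longrightarrow>
        (\<forall>u' v'. vk_solution \<Omega> obs f u' v' \<longrightarrow>
           (AE z in lebesgue. z \<in> \<Omega> \<longrightarrow> u' z = u z) \<and>
           (AE z in lebesgue. z \<in> \<Omega> \<longrightarrow> v' z = v z)))"
proof (cases "\<exists>CS CF \<phi>. sobolev_const \<Omega> CS \<and> friedrichs_const \<Omega> CF \<and> \<phi> \<in> Kset \<Omega> obs")
  \<comment> \<open>The constant precedes f, the embedding constants and the solution in the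
    quantifier order. Without any admissible triple of embedding constants and competitor the claim
    is vacuous, and any positive number serves.\<close>
  case False
  then have "\<not> (L2 \<Omega> f \<and> sobolev_const \<Omega> CS \<and> friedrichs_const \<Omega> CF \<and> vk_solution \<Omega> obs f u v)" for f CS CF u v
    by (auto simp: vk_solution_def)
  then show ?thesis by (intro exI[of _ 1]) (metis zero_less_one)
next
  case True
  \<comment> \<open>These witnesses are fixed before f and the solution are introduced, so the
    constant built from them depends on neither; the constants \<open>CS\<close> and
    \<open>CF\<close> quantified in the claim need not coincide with them.\<close>
  then obtain CS0 CF0 \<phi> where 0: "sobolev_const \<Omega> CS0" "friedrichs_const \<Omega> CF0" "\<phi> \<in> Kset \<Omega> obs" by blast
  have dom: "bounded_domain \<Omega>" using assms(1) by (simp add: bounded_domain_def polygonal_domain_def)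
  obtain T W C where bar: "barrier \<Omega> (frontier \<Omega>) T W C" using polygonal_barrier[OF assms(1)] by blast
  have H\<phi>: "H20 \<Omega> \<phi>" using 0 by (simp add: Kset_def)
  interpret D: bounded_domain \<Omega> by (rule dom)
  interpret D0: sobolev_domain \<Omega> CS0 by unfold_locales (rule 0)
  obtain B where B: "B \<ge> 0" "\<And>u v. H20 \<Omega> u \<Longrightarrow> H20 \<Omega> v \<Longrightarrow> (\<And>\<psi>. H20 \<Omega> \<psi> \<Longrightarrow> aform \<Omega> v \<psi> = bform \<Omega> u u \<psi>) \<Longrightarrow>
    2 * aform \<Omega> u \<phi> + 4 * bform \<Omega> u v \<phi> - (tnorm \<Omega> u)\<^sup>2 - 3 * (tnorm \<Omega> v)\<^sup>2 \<le> B"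
    using D0.coercivity[OF bar 0(2) H\<phi>] by blast
  show ?thesis
  \<comment> \<open>\<open>B\<close> comes from coercivity, |\<phi>|^2 from Young's inequality for
    the pairing of f with \<open>\<phi>\<close>, and 1 makes the constant positive.\<close>
  proof (intro exI[of _ "B + (tnorm \<Omega> \<phi>)\<^sup>2 + 1"] conjI allI impI)
    show "0 < B + (tnorm \<Omega> \<phi>)\<^sup>2 + 1" using B(1) by (simp add: add_nonneg_pos)
    fix f CS CF u v
    assume "L2 \<Omega> f \<and> sobolev_const \<Omega> CS \<and> friedrichs_const \<Omega> CF \<and> vk_solution \<Omega> obs f u v"
    then have f: "L2 \<Omega> f" and CS: "sobolev_const \<Omega> CS" and CF: "friedrichs_const \<Omega> CF" and sol: "vk_solution \<Omega> obs f u v" by auto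
    interpret S: sobolev_domain \<Omega> CS by unfold_locales (rule CS)
    note s = S.vk_solution_props[OF sol]
    define F where "F = CF * l2norm \<Omega> f"
    have yng: "2 * \<bar>l2ip \<Omega> f w\<bar> \<le> t * F\<^sup>2 + (tnorm \<Omega> w)\<^sup>2 / t" if w: "H20 \<Omega> w" and t: "t > 0" for w t
    proof -
      have "2 * \<bar>l2ip \<Omega> f w\<bar> \<le> 2 * (F * tnorm \<Omega> w)"
        using D.friedrichs_bound[OF CF f w] by (simp add: F_def algebra_simps)
      moreover have "0 \<le> (t * F - tnorm \<Omega> w)\<^sup>2 / t" using t by simp
      moreover have "(t * F - tnorm \<Omega> w)\<^sup>2 / t = t * F\<^sup>2 + (tnorm \<Omega> w)\<^sup>2 / t - 2 * (F * tnorm \<Omega> w)"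
        using t by (simp add: power2_eq_square field_simps)
      ultimately show ?thesis by linarith
    qed
    have j: "2 * jfun \<Omega> f u = (tnorm \<Omega> u)\<^sup>2 + (tnorm \<Omega> v)\<^sup>2 - 2 * l2ip \<Omega> f u"
      by (simp add: jfun_def S.tnorm_Gop[OF sol])
    have F2: "F\<^sup>2 = CF\<^sup>2 * (l2norm \<Omega> f)\<^sup>2" by (simp add: F_def power_mult_distrib)
    \<comment> \<open>Weight t = 2 bounds twice the pairing with u by 2 F^2 plus half of |u|^2,
      exactly the half that the claim gives away.\<close>
    have 1: "(1/2) * (tnorm \<Omega> u)\<^sup>2 + (tnorm \<Omega> v)\<^sup>2 \<le> 2 * jfun \<Omega> f u + 2 * F\<^sup>2"
      using yng[OF s(1), of 2] abs_ge_self[of "l2ip \<Omega> f u"] unfolding j by linarith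
    \<comment> \<open>Subtracting |u|^2 + 3 |v|^2 from twice the estimate leaves 2 j(u) on the left
      and the expression bounded by \<open>B\<close> on the right, up to the pairing of f with
      \<open>\<phi>\<close>. The latter costs one F^2, which with the two in N^2 makes
      three.\<close>
    have 2: "2 * jfun \<Omega> f u \<le> B + (tnorm \<Omega> \<phi>)\<^sup>2 + 1 + F\<^sup>2"
      using S.vk_solution_estimate[OF sol 0(3) f] B(2)[OF s] yng[OF H\<phi>, of 1] abs_ge_minus_self[of "l2ip \<Omega> f \<phi>"]
      unfolding j by linarith
    show "let N2 = 2 * jfun \<Omega> f u + 2 * CF\<^sup>2 * (l2norm \<Omega> f)\<^sup>2;
          M2 = B + (tnorm \<Omega> \<phi>)\<^sup>2 + 1 + 3 * CF\<^sup>2 * (l2norm \<Omega> f)\<^sup>2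
      in (1/2) * (tnorm \<Omega> u)\<^sup>2 + (tnorm \<Omega> v)\<^sup>2 \<le> N2 \<and> N2 \<le> M2"
      unfolding Let_def mult.assoc F2[symmetric] using 1 2 by linarith
    fix u' v'
    assume "CS\<^sup>2 * ((1/2) * (tnorm \<Omega> u)\<^sup>2 + (tnorm \<Omega> v)\<^sup>2) < (sqrt 2 - 1)\<^sup>2" "vk_solution \<Omega> obs f u' v'"
    from S.vk_solution_unique[OF sol this(2) f this(1)]
    show "AE z in lebesgue. z \<in> \<Omega> \<longrightarrow> u' z = u z" "AE z in lebesgue. z \<in> \<Omega> \<longrightarrow> v' z = v z" .
  qed
qed

end
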